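(* Let $X$ be a Banach space such that either $X$ or $X^*$ is a GT-space of cotype 2. Let $A,B$ be commuting sectorial operators on $X$ such that $A$ admits an $H^\infty$-calculus. Let $f\in H^\infty(\Sigma_\sigma\times\Sigma_{\sigma'})$ where $\sigma>\omega_H(A)$ and $\sigma'>\omega(B)$. Suppose that for each $z\in\Sigma_\sigma$ the function $f_z(w)=f(z,w)$ belongs to $\mathcal H(B)$ and $\sup_{z\in\Sigma_\sigma}\|f(z,B)\|<\infty$. Then $f\in\mathcal H(A,B)$, i.e. $f(A,B)$ is bounded.
   Context: A Banach space $Y$ is a GT-space if there is $C$ such that every bounded $T:Y\to\ell_2$ is absolutely summing with $\pi_1(T)\le C\|T\|$. $\Sigma_\sigma=\{z\ne0:|\arg z|<\sigma\}$. A closed densely defined operator $A$ is sectorial of type $\omega$ if injective with dense range, $R(\lambda,A)$ exists for $|\arg\lambda|>\omega$, and $\sup_{|\arg\lambda|\ge\sigma}\|\lambda R(\lambda,A)\|<\infty$ for $\sigma\in(\omega,\pi)$; $\omega(A)$ is the infimum of such $\omega$. Commuting means the resolvents commute. For bounded analytic $g$ on $\Sigma_\sigma$ with $|g(z)|\le C(|z|/(1+|z|^2))^\epsilon$, $g(A)=\frac1{2\pi i}\int_{\partial\Sigma_\nu}g(\lambda)R(\lambda,A)d\lambda$ ($\omega(A)<\nu<\sigma$, oriented from $\infty e^{i\nu}$ through 0 to $\infty e^{-i\nu}$). $A$ admits an $H^\infty(\Sigma_\sigma)$-calculus if $\|g(A)\|\le C\sup_{\Sigma_\sigma}|g|$ for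 all such $g$; $\omega_H(A)$ is the infimum of $\sigma$ for which this holds. Let $\varphi_n(z)=\frac n{n+z}-\frac1{1+nz}$. For a bounded analytic $g$ on $\Sigma_{\sigma'}$, $g\in\mathcal H(B)$ means $\sup_n\|(\varphi_ng)(B)\|<\infty$, and $g(B)$ is the strong limit of $(\varphi_ng)(B)$. $H^\infty(\Sigma_\sigma\times\Sigma_{\sigma'})$ is the space of bounded analytic functions on $\Sigma_\sigma\times\Sigma_{\sigma'}$; with $\psi_n(w,z)=\varphi_n(w)\varphi_n(z)$, $(\psi_nf)(A,B)=(\frac1{2\pi i})^2\int_{\partial\Sigma_\nu}\int_{\partial\Sigma_{\nu'}}\psi_n(\lambda,\mu)f(\lambda,\mu)R(\lambda,A)R(\mu,B)d\mu\,d\lambda$; $f\in\mathcal H(A,B)$ means $\sup_n\|(\psi_nf)(A,B)\|<\infty$, and then $f(A,B)$ is the strong limit of $(\psi_nf)(A,B)$. *)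

theory Defs
  imports "HOL-Analysis.Analysis"
begin

section \<open>Complex Banach spaces, modelled as a real Banach space with a complex structure\<close>

text \<open>J is multiplication by the imaginary unit.\<close>
definition cscale :: "('a::real_normed_vector \<Rightarrow> 'a) \<Rightarrow> complex \<Rightarrow> 'a \<Rightarrow> 'a" where
  "cscale J c x = Re c *\<^sub>R x + Im c *\<^sub>R J x"

definition cstruct :: "('a::real_normed_vector \<Rightarrow> 'a) \<Rightarrow> bool" where
  "cstruct J \<longleftrightarrow> bounded_linear J \<and> (\<forall>x. J (J x) = - x)
      \<and> (\<forall>c x. norm (cscale J c x) = cmod c * norm x)"

definition lin_op :: "('a::real_normed_vector \<Rightarrow> 'a) \<Rightarrow> 'a set \<Rightarrow> ('a \<Rightarrow> 'a) \<Rightarrow> bool" where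
  "lin_op J D A \<longleftrightarrow> 0 \<in> D \<and> (\<forall>x\<in>D. \<forall>y\<in>D. x + y \<in> D \<and> A (x + y) = A x + A y)
      \<and> (\<forall>c. \<forall>x\<in>D. cscale J c x \<in> D \<and> A (cscale J c x) = cscale J c (A x))"

definition is_resolvent ::
  "('a::real_normed_vector \<Rightarrow> 'a) \<Rightarrow> 'a set \<Rightarrow> ('a \<Rightarrow> 'a) \<Rightarrow> complex \<Rightarrow> ('a \<Rightarrow> 'a) \<Rightarrow> bool" where
  "is_resolvent J D A l R \<longleftrightarrow> bounded_linear R
      \<and> (\<forall>x. R x \<in> D \<and> cscale J l (R x) - A (R x) = x)
      \<and> (\<forall>y\<in>D. R (cscale J l y - A y) = y)"

definition res :: "('a::real_normed_vector \<Rightarrow> 'a) \<Rightarrow> 'a set \<Rightarrow> ('a \<Rightarrow> 'a) \<Rightarrow> complex \<Rightarrow> 'a \<Rightarrow> 'a" where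
  "res J D A l = (THE R. is_resolvent J D A l R)"

definition sector :: "real \<Rightarrow> complex set" where
  "sector s = {z. z \<noteq> 0 \<and> \<bar>Arg z\<bar> < s}"

definition sectorial_type :: "('a::real_normed_vector \<Rightarrow> 'a) \<Rightarrow> 'a set \<Rightarrow> ('a \<Rightarrow> 'a) \<Rightarrow> real \<Rightarrow> bool" where
  "sectorial_type J D A w \<longleftrightarrow> 0 \<le> w \<and> w < pi
      \<and> lin_op J D A
      \<and> closed {(x, A x) | x. x \<in> D}
      \<and> closure D = UNIV
      \<and> inj_on A D
      \<and> closure (A ` D) = UNIV
      \<and> (\<forall>l. l \<noteq> 0 \<and> \<bar>Arg l\<bar> > w \<longrightarrow> (\<exists>R. is_resolvent J D A l R))
      \<and> (\<forall>s. w < s \<and> s < pi \<longrightarrow>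
            (\<exists>M. \<forall>l x. l \<noteq> 0 \<and> \<bar>Arg l\<bar> \<ge> s \<longrightarrow>
                  norm (cscale J l (res J D A l x)) \<le> M * norm x))"

definition sectorial :: "('a::real_normed_vector \<Rightarrow> 'a) \<Rightarrow> 'a set \<Rightarrow> ('a \<Rightarrow> 'a) \<Rightarrow> bool" where
  "sectorial J D A \<longleftrightarrow> (\<exists>w. sectorial_type J D A w)"

definition omega :: "('a::real_normed_vector \<Rightarrow> 'a) \<Rightarrow> 'a set \<Rightarrow> ('a \<Rightarrow> 'a) \<Rightarrow> real" where
  "omega J D A = Inf {w. sectorial_type J D A w}"

definition commuting ::
  "('a::real_normed_vector \<Rightarrow> 'a) \<Rightarrow> 'a set \<Rightarrow> ('a \<Rightarrow> 'a) \<Rightarrow> 'a set \<Rightarrow> ('a \<Rightarrow> 'a) \<Rightarrow> bool" where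
  "commuting J DA A DB B \<longleftrightarrow> (\<forall>l m R S. is_resolvent J DA A l R \<and> is_resolvent J DB B m S
      \<longrightarrow> (\<forall>x. R (S x) = S (R x)))"

text \<open>Integral of h over the boundary of the sector of angle nu, oriented from
  infinity times e^(i nu) through 0 to infinity times e^(-i nu), i.e. the integral of h(lambda) d lambda.\<close>
definition bnd_int :: "('a::banach \<Rightarrow> 'a) \<Rightarrow> real \<Rightarrow> (complex \<Rightarrow> 'a) \<Rightarrow> 'a" where
  "bnd_int J nu h = integral {0..} (\<lambda>t::real.
      cscale J (- cis nu) (h (of_real t * cis nu)) + cscale J (cis (- nu)) (h (of_real t * cis (- nu))))"

text \<open>Canonical choice of the contour angle: omega(A) < nu < sigma (independent of the choice).\<close>
definition nu_of :: "('a::real_normed_vector \<Rightarrow> 'a) \<Rightarrow> 'a set \<Rightarrow> ('a \<Rightarrow> 'a) \<Rightarrow> real \<Rightarrow> real" where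
  "nu_of J D A s = (omega J D A + min s pi) / 2"

definition fcalc :: "('a::banach \<Rightarrow> 'a) \<Rightarrow> 'a set \<Rightarrow> ('a \<Rightarrow> 'a) \<Rightarrow> real \<Rightarrow> (complex \<Rightarrow> complex) \<Rightarrow> 'a \<Rightarrow> 'a" where
  "fcalc J D A s g x = cscale J (1 / (2 * pi * \<i>))
      (bnd_int J (nu_of J D A s) (\<lambda>l. cscale J (g l) (res J D A l x)))"

definition fcalc2 :: "('a::banach \<Rightarrow> 'a) \<Rightarrow> 'a set \<Rightarrow> ('a \<Rightarrow> 'a) \<Rightarrow> 'a set \<Rightarrow> ('a \<Rightarrow> 'a)
      \<Rightarrow> real \<Rightarrow> real \<Rightarrow> (complex \<Rightarrow> complex \<Rightarrow> complex) \<Rightarrow> 'a \<Rightarrow> 'a" where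
  "fcalc2 J DA A DB B s s' f x = cscale J ((1 / (2 * pi * \<i>)) ^ 2)
      (bnd_int J (nu_of J DA A s) (\<lambda>l. bnd_int J (nu_of J DB B s') (\<lambda>m.
          cscale J (f l m) (res J DA A l (res J DB B m x)))))"

definition admissible :: "real \<Rightarrow> (complex \<Rightarrow> complex) \<Rightarrow> bool" where
  "admissible s g \<longleftrightarrow> g holomorphic_on sector s \<and> bounded (g ` sector s)
      \<and> (\<exists>C e. e > 0 \<and> (\<forall>z\<in>sector s. cmod (g z) \<le> C * (cmod z / (1 + cmod z ^ 2)) powr e))"

definition Hinf_calc :: "('a::banach \<Rightarrow> 'a) \<Rightarrow> 'a set \<Rightarrow> ('a \<Rightarrow> 'a) \<Rightarrow> real \<Rightarrow> bool" where
  "Hinf_calc J D A s \<longleftrightarrow> omega J D A < s \<and>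
      (\<exists>C. \<forall>g. admissible s g \<longrightarrow>
          (\<forall>x. norm (fcalc J D A s g x) \<le> C * (SUP z\<in>sector s. cmod (g z)) * norm x))"

definition admits_Hinf :: "('a::banach \<Rightarrow> 'a) \<Rightarrow> 'a set \<Rightarrow> ('a \<Rightarrow> 'a) \<Rightarrow> bool" where
  "admits_Hinf J D A \<longleftrightarrow> (\<exists>s. Hinf_calc J D A s)"

definition omegaH :: "('a::banach \<Rightarrow> 'a) \<Rightarrow> 'a set \<Rightarrow> ('a \<Rightarrow> 'a) \<Rightarrow> real" where
  "omegaH J D A = Inf {s. Hinf_calc J D A s}"

definition phi :: "nat \<Rightarrow> complex \<Rightarrow> complex" where
  "phi n z = of_nat n / (of_nat n + z) - 1 / (1 + of_nat n * z)"

text \<open>g \<in> H(B) for g bounded analytic on the sector of angle s.\<close>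
definition in_H :: "('a::banach \<Rightarrow> 'a) \<Rightarrow> 'a set \<Rightarrow> ('a \<Rightarrow> 'a) \<Rightarrow> real \<Rightarrow> (complex \<Rightarrow> complex) \<Rightarrow> bool" where
  "in_H J D B s g \<longleftrightarrow> (\<exists>M. \<forall>n\<ge>1. \<forall>x. norm (fcalc J D B s (\<lambda>z. phi n z * g z) x) \<le> M * norm x)"

definition fcalc_lim :: "('a::banach \<Rightarrow> 'a) \<Rightarrow> 'a set \<Rightarrow> ('a \<Rightarrow> 'a) \<Rightarrow> real \<Rightarrow> (complex \<Rightarrow> complex) \<Rightarrow> 'a \<Rightarrow> 'a" where
  "fcalc_lim J D B s g x = lim (\<lambda>n. fcalc J D B s (\<lambda>z. phi n z * g z) x)"

text \<open>Bounded analytic functions on a product of sectors (analytic in each variable separately,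
  which by Hartogs' theorem is the same as jointly analytic).\<close>
definition Hinf2 :: "real \<Rightarrow> real \<Rightarrow> (complex \<Rightarrow> complex \<Rightarrow> complex) \<Rightarrow> bool" where
  "Hinf2 s s' f \<longleftrightarrow> bounded ((\<lambda>(z, w). f z w) ` (sector s \<times> sector s'))
      \<and> (\<forall>w\<in>sector s'. (\<lambda>z. f z w) holomorphic_on sector s)
      \<and> (\<forall>z\<in>sector s. f z holomorphic_on sector s')"

definition in_H2 :: "('a::banach \<Rightarrow> 'a) \<Rightarrow> 'a set \<Rightarrow> ('a \<Rightarrow> 'a) \<Rightarrow> 'a set \<Rightarrow> ('a \<Rightarrow> 'a)
      \<Rightarrow> real \<Rightarrow> real \<Rightarrow> (complex \<Rightarrow> complex \<Rightarrow> complex) \<Rightarrow> bool" where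
  "in_H2 J DA A DB B s s' f \<longleftrightarrow> (\<exists>M. \<forall>n\<ge>1. \<forall>x.
      norm (fcalc2 J DA A DB B s s' (\<lambda>l m. phi n l * phi n m * f l m) x) \<le> M * norm x)"

section \<open>Cotype 2 and GT-spaces for a complex normed space (carrier V, complex scalar multiplication sm)\<close>

definition signs :: "nat \<Rightarrow> (nat \<Rightarrow> real) set" where
  "signs n = {e. (\<forall>i<n. e i = 1 \<or> e i = -1) \<and> (\<forall>i\<ge>n. e i = 0)}"

definition cotype2 :: "'v::real_normed_vector set \<Rightarrow> bool" where
  "cotype2 V \<longleftrightarrow> (\<exists>C. \<forall>n (x::nat \<Rightarrow> 'v). (\<forall>i<n. x i \<in> V) \<longrightarrow>
      (\<Sum>i<n. norm (x i) ^ 2) \<le> C * ((\<Sum>e\<in>signs n. norm (\<Sum>i<n. e i *\<^sub>R x i) ^ 2) / 2 ^ n))"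

definition dual_ball :: "'v::real_normed_vector set \<Rightarrow> (complex \<Rightarrow> 'v \<Rightarrow> 'v) \<Rightarrow> ('v \<Rightarrow> complex) set" where
  "dual_ball V sm = {p. (\<forall>x\<in>V. \<forall>y\<in>V. p (x + y) = p x + p y)
      \<and> (\<forall>c. \<forall>x\<in>V. p (sm c x) = c * p x) \<and> (\<forall>x\<in>V. cmod (p x) \<le> norm x)}"

definition weak1 :: "'v::real_normed_vector set \<Rightarrow> (complex \<Rightarrow> 'v \<Rightarrow> 'v) \<Rightarrow> (nat \<Rightarrow> 'v) \<Rightarrow> nat \<Rightarrow> real" where
  "weak1 V sm x n = (SUP p\<in>dual_ball V sm. \<Sum>i<n. cmod (p (x i)))"

definition l2norm :: "(nat \<Rightarrow> complex) \<Rightarrow> real" where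
  "l2norm y = sqrt (\<Sum>k. cmod (y k) ^ 2)"

definition bdd_l2_op :: "'v::real_normed_vector set \<Rightarrow> (complex \<Rightarrow> 'v \<Rightarrow> 'v) \<Rightarrow> ('v \<Rightarrow> nat \<Rightarrow> complex) \<Rightarrow> bool" where
  "bdd_l2_op V sm T \<longleftrightarrow> (\<forall>x\<in>V. summable (\<lambda>k. cmod (T x k) ^ 2))
      \<and> (\<forall>x\<in>V. \<forall>y\<in>V. T (x + y) = (\<lambda>k. T x k + T y k))
      \<and> (\<forall>c. \<forall>x\<in>V. T (sm c x) = (\<lambda>k. c * T x k))
      \<and> (\<exists>M. \<forall>x\<in>V. l2norm (T x) \<le> M * norm x)"

definition l2_opnorm :: "'v::real_normed_vector set \<Rightarrow> ('v \<Rightarrow> nat \<Rightarrow> complex) \<Rightarrow> real" where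
  "l2_opnorm V T = Inf {M. M \<ge> 0 \<and> (\<forall>x\<in>V. l2norm (T x) \<le> M * norm x)}"

text \<open>GT-space: every bounded T : V \<rightarrow> l2 is absolutely summing with pi_1(T) \<le> C ||T||.\<close>
definition GT_space :: "'v::real_normed_vector set \<Rightarrow> (complex \<Rightarrow> 'v \<Rightarrow> 'v) \<Rightarrow> bool" where
  "GT_space V sm \<longleftrightarrow> (\<exists>C. \<forall>T. bdd_l2_op V sm T \<longrightarrow>
      (\<forall>n (x::nat \<Rightarrow> 'v). (\<forall>i<n. x i \<in> V) \<longrightarrow>
          (\<Sum>i<n. l2norm (T (x i))) \<le> C * l2_opnorm V T * weak1 V sm x n))"

definition dualsp :: "('a::real_normed_vector \<Rightarrow> 'a) \<Rightarrow> ('a \<Rightarrow>\<^sub>L complex) set" where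
  "dualsp J = {p. \<forall>c x. blinfun_apply p (cscale J c x) = c * blinfun_apply p x}"

definition dual_sm :: "complex \<Rightarrow> ('a::real_normed_vector \<Rightarrow>\<^sub>L complex) \<Rightarrow> ('a \<Rightarrow>\<^sub>L complex)" where
  "dual_sm c p = Blinfun (\<lambda>x. c * blinfun_apply p x)"

end

theory Submission
  imports Defs "HOL-Complex_Analysis.Complex_Analysis" "HOL-Real_Asymp.Real_Asymp"
begin

text \<open>
  The resolvent identity together with Cauchy's theorem for scalar functions (applied through
  norming functionals) shows that multiplying \<open>G(A) = (2\<pi>\<i>)\<^sup>-\<^sup>1 \<integral> R(\<lambda>,A) G(\<lambda>) d\<lambda>\<close> by \<open>-a R(-a,A)\<close> multiplies
  the symbol by \<open>a/(a+\<lambda>)\<close>, also when \<open>G\<close> is operator-valued. For \<open>B\<close> this gives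
  \<open>(\<phi>\<^sub>n f\<^sub>\<lambda>)(B) = \<phi>\<^sub>n(B) f(\<lambda>,B)\<close>, so that \<open>G(\<lambda>) = \<phi>\<^sub>n(\<lambda>) (\<phi>\<^sub>n f\<^sub>\<lambda>)(B)\<close> is bounded uniformly in \<open>\<lambda>\<close> and \<open>n\<close>, and
  the claim is a uniform bound for \<open>G(A)\<close>.

  Put \<open>v\<^sub>k(z) = 2\<^sup>k/(2\<^sup>k + z)\<close>, \<open>w\<^sub>k = v\<^sub>k\<^sub>+\<^sub>1 - v\<^sub>k\<close> and \<open>Q(v) = v\<^sup>3 (10 - 15 v + 6 v\<^sup>2)\<close>. Then
  \<open>Q(v\<^sub>k\<^sub>+\<^sub>1) - Q(v\<^sub>k) = w\<^sub>k\<^sup>2 \<rho>\<^sub>k\<close>, where \<open>|\<rho>\<^sub>k(\<lambda>)|/|\<lambda>|\<close> is integrable over the contour uniformly in \<open>k\<close>, and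
  the left-hand sides telescope to \<open>1\<close>. Hence \<open>G(A) = \<Sum>\<^sub>k w\<^sub>k(A)\<^sup>2 T\<^sub>k\<close> with \<open>T\<^sub>k = (\<rho>\<^sub>k G)(A)\<close> uniformly bounded and
  commuting with \<open>A\<close>. The \<open>H\<^sup>\<infinity>\<close>-calculus makes the family \<open>w\<^sub>k(A)\<close> unconditional. In a GT-space of cotype 2 the map
  \<open>y \<mapsto> (p\<^sub>k(w\<^sub>k(A) y))\<^sub>k\<close> is bounded into \<open>\<ell>\<^sub>2\<close> for bounded functionals \<open>p\<^sub>k\<close>, hence absolutely summing, which yields
  \<open>\<Sum>\<^sub>k |p\<^sub>k(w\<^sub>k(A)\<^sup>2 x)| \<le> C \<parallel>x\<parallel>\<close>; take \<open>p\<^sub>k = q \<circ> T\<^sub>k\<close>. If only the dual is such a space, the same argument is run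
  with the adjoints of \<open>w\<^sub>k(A)\<close> and the functionals \<open>r \<mapsto> r(T\<^sub>k x)\<close>.

  For \<open>\<sigma> > \<pi>\<close> the sector is the punctured plane and the hypothesis on the \<open>H\<^sup>\<infinity>\<close>-calculus is void, but then
  \<open>f\<close> is constant in its first variable by Liouville's theorem.
\<close>

section \<open>Norming functionals\<close>

text \<open>The calculus of A is given for scalar symbols, and boundedness of an operator-valued
  symbol does not by itself bound its integral. GT with cotype 2 makes up for this at the price of
  two copies of w_k(A) in each term: one makes the vectors weakly summable, the other, by cotype 2,
  makes the operator into l2 bounded. A third factor w_k is needed so that the integral defining T_k
  is bounded independently of k. Hence the partition of unity must have increments divisible by
  w_k^3. The polynomial Q, with Q' = 30 v^2 (1 - v)^2, achieves this through the relation w_k (1 +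
  v_k) = v_k (1 - v_k), which is special to scales of ratio 2; Q(0) = 0 and Q(1) = 1 make the sum 1.
  A second obstacle is the contour. The calculus of A is known at some angle below \<sigma>, with a
  contour of its own, while f(A,B) is integrated over the contour belonging to \<sigma>. The two
  meet only in the operators w_k(A), differences of resolvents that \<open>ocalc_wfun\<close>
  recovers from either contour.\<close>

definition sublinear :: "('a::real_normed_vector \<Rightarrow> real) \<Rightarrow> bool" where
  "sublinear p \<longleftrightarrow> (\<forall>x y. p (x + y) \<le> p x + p y) \<and> (\<forall>t x. t > 0 \<longrightarrow> p (t *\<^sub>R x) = t * p x)
     \<and> (\<forall>x. p x \<le> norm x)"

text \<open>Since \<open>p 0 = 0\<close> and \<open>p\<close> is subadditive, the built-in bound by
  \<open>norm\<close> is two-sided. It keeps infima along chains finite in the Zorn argument and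
  bounds the final functional.\<close>

lemma sublinear_lower: "- norm x \<le> p x" if "sublinear p"
proof -
  have "p ((2::real) *\<^sub>R 0) = 2 * p 0" using that unfolding sublinear_def by (meson zero_less_numeral)
  then have z: "p 0 = 0" by simp
  have "0 \<le> p x + p (- x)" using that z unfolding sublinear_def by (metis add.right_inverse)
  moreover have "p (- x) \<le> norm x" using that unfolding sublinear_def by (metis norm_minus_cancel)
  ultimately show ?thesis by linarith
qed

lemma sublinear_zero: "p 0 = 0" if "sublinear p"
  using sublinear_lower[OF that, of 0] that unfolding sublinear_def by (metis norm_zero neg_0_equal_iff_equal order_antisym)

text \<open>The usual lowering of \<open>p\<close> in the direction \<open>y\<close>: the choices
  \<open>t = 0\<close> and \<open>t = 1\<close> put it below \<open>p\<close> and give it a value of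
  at most \<open>- p y\<close> at \<open>- y\<close>.\<close>

definition lower_shift :: "('a::real_normed_vector \<Rightarrow> real) \<Rightarrow> 'a \<Rightarrow> 'a \<Rightarrow> real" where
  "lower_shift p y x = (INF t\<in>{0::real..}. p (x + t *\<^sub>R y) - t * p y)"

lemma lower_shift_bdd:
  assumes p: "sublinear p"
  shows "bdd_below ((\<lambda>t. p (x + t *\<^sub>R y) - t * p y) ` {0::real..})"
proof (rule bdd_belowI2)
  fix t :: real assume t: "t \<in> {0..}"
  have "t * p y = p (t *\<^sub>R y)"
    using p t sublinear_zero[OF p] unfolding sublinear_def by (cases "t = 0") auto
  also have "\<dots> \<le> p (x + t *\<^sub>R y) + p (- x)"
  proof -
    have "p (t *\<^sub>R y) = p ((x + t *\<^sub>R y) + (- x))" by simp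
    also have "\<dots> \<le> p (x + t *\<^sub>R y) + p (- x)" using p unfolding sublinear_def by blast
    finally show ?thesis .
  qed
  also have "p (- x) \<le> norm x" using p unfolding sublinear_def by (metis norm_minus_cancel)
  finally show "- norm x \<le> p (x + t *\<^sub>R y) - t * p y" by linarith
qed

lemma lower_shift_le:
  assumes p: "sublinear p" and t: "t \<ge> 0"
  shows "lower_shift p y x \<le> p (x + t *\<^sub>R y) - t * p y"
  unfolding lower_shift_def using cINF_lower[OF lower_shift_bdd[OF p]] t by auto

lemma lower_shift_sublinear:
  assumes p: "sublinear p"
  shows "sublinear (lower_shift p y)"
  unfolding sublinear_def
proof (intro conjI allI impI)
  fix x z
  have "lower_shift p y (x + z) - lower_shift p y x \<le> p (z + s *\<^sub>R y) - s * p y" if s: "s \<ge> 0" for s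
  proof -
    have "lower_shift p y (x + z) - (p (z + s *\<^sub>R y) - s * p y) \<le> p (x + t *\<^sub>R y) - t * p y" if t: "t \<ge> 0" for t
    proof -
      have "lower_shift p y (x + z) \<le> p ((x + z) + (t + s) *\<^sub>R y) - (t + s) * p y"
        using lower_shift_le[OF p] s t by simp
      also have "(x + z) + (t + s) *\<^sub>R y = (x + t *\<^sub>R y) + (z + s *\<^sub>R y)" by (simp add: algebra_simps)
      also have "p \<dots> \<le> p (x + t *\<^sub>R y) + p (z + s *\<^sub>R y)" using p unfolding sublinear_def by blast
      finally show ?thesis by (simp add: algebra_simps)
    qed
    then have "lower_shift p y (x + z) - (p (z + s *\<^sub>R y) - s * p y) \<le> lower_shift p y x"
      unfolding lower_shift_def[of p y x] by (intro cINF_greatest) auto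
    then show ?thesis by linarith
  qed
  then have "lower_shift p y (x + z) - lower_shift p y x \<le> lower_shift p y z"
    unfolding lower_shift_def[of p y z] by (intro cINF_greatest) auto
  then show "lower_shift p y (x + z) \<le> lower_shift p y x + lower_shift p y z" by linarith
next
  have le: "lower_shift p y (t *\<^sub>R x) \<le> t * lower_shift p y x" if t: "t > 0" for t x
  proof -
    have "lower_shift p y (t *\<^sub>R x) / t \<le> p (x + s *\<^sub>R y) - s * p y" if s: "s \<ge> 0" for s
    proof -
      have "lower_shift p y (t *\<^sub>R x) \<le> p (t *\<^sub>R x + (t * s) *\<^sub>R y) - (t * s) * p y"
        using lower_shift_le[OF p] s t by simp
      also have "t *\<^sub>R x + (t * s) *\<^sub>R y = t *\<^sub>R (x + s *\<^sub>R y)" by (simp add: algebra_simps)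
      also have "p \<dots> = t * p (x + s *\<^sub>R y)" using p t unfolding sublinear_def by blast
      finally show ?thesis using t by (simp add: field_simps)
    qed
    then have "lower_shift p y (t *\<^sub>R x) / t \<le> lower_shift p y x"
      unfolding lower_shift_def[of p y x] by (intro cINF_greatest) auto
    then show ?thesis using t by (simp add: field_simps)
  qed
  fix t :: real and x :: 'a assume t: "t > 0"
  have "lower_shift p y x \<le> inverse t * lower_shift p y (t *\<^sub>R x)"
    using le[of "inverse t" "t *\<^sub>R x"] t by simp
  then show "lower_shift p y (t *\<^sub>R x) = t * lower_shift p y x"
    using le[OF t, of x] t by (simp add: field_simps)
next
  fix x
  show "lower_shift p y x \<le> norm x"
  proof -
    have "lower_shift p y x \<le> p x" using lower_shift_le[OF p, of 0 y x] by simp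
    also have "\<dots> \<le> norm x" using p unfolding sublinear_def by blast
    finally show ?thesis .
  qed
qed

lemma sublinear_norm: "sublinear norm"
  unfolding sublinear_def by (auto simp: norm_triangle_ineq)

text \<open>Hahn--Banach: a minimal sublinear functional \<open>q\<close> is fixed by all the maps
  \<open>lower_shift\<close>, which forces additivity.\<close>
lemma minimal_sublinear_additive:
  assumes q: "sublinear q" and min: "\<And>r. sublinear r \<Longrightarrow> (\<And>x. r x \<le> q x) \<Longrightarrow> r = q"
  shows "q (x + y) = q x + q y"
proof -
  have "lower_shift q y = q"
    by (rule min[OF lower_shift_sublinear[OF q]]) (use lower_shift_le[OF q, of 0] in simp)
  then have "q x \<le> q (x + y) - q y" using lower_shift_le[OF q, of 1 y x] by simp
  moreover have "q (x + y) \<le> q x + q y" using q unfolding sublinear_def by blast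
  ultimately show ?thesis by linarith
qed

text \<open>Zorn's lemma for the reversed pointwise order \<open>P\<close>. A chain is bounded by
  its pointwise infimum, and subadditivity survives because two members of a chain are comparable,
  so that the smaller one can serve for both summands.\<close>

lemma ex_minimal_sublinear:
  fixes p :: "'a::real_normed_vector \<Rightarrow> real"
  assumes p: "sublinear p"
  shows "\<exists>q. sublinear q \<and> (\<forall>x. q x \<le> p x) \<and> (\<forall>r. sublinear r \<longrightarrow> (\<forall>x. r x \<le> q x) \<longrightarrow> r = q)"
proof -
  define S where "S = {q. sublinear q \<and> (\<forall>x. q x \<le> p x)}"
  define P :: "('a \<Rightarrow> real) \<Rightarrow> ('a \<Rightarrow> real) \<Rightarrow> bool" where "P f g \<longleftrightarrow> (\<forall>x. g x \<le> f x)" for f g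
  have "\<exists>m\<in>S. \<forall>a\<in>S. P m a \<longrightarrow> a = m"
  proof (rule predicate_Zorn)
    show "partial_order_on S (relation_of P S)"
      by (rule partial_order_on_relation_ofI)
        (auto simp: P_def fun_eq_iff intro: order_trans order_antisym)
  next
    fix C assume C: "C \<in> Chains (relation_of P S)"
    then have CS: "C \<subseteq> S" unfolding Chains_def relation_of_def by blast
    have lin: "P f g \<or> P g f" if "f \<in> C" "g \<in> C" for f g
      using C that unfolding Chains_def relation_of_def by blast
    show "\<exists>u\<in>S. \<forall>a\<in>C. P a u"
    proof (cases "C = {}")
      case True
      then show ?thesis using p unfolding S_def by auto
    next
      case False
      define u where "u x = (INF f\<in>C. f x)" for x
      have bdd: "bdd_below ((\<lambda>f. f x) ` C)" for x
        using CS sublinear_lower unfolding S_def by (intro bdd_belowI2[of _ "- norm x"]) blast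
      have ule: "u x \<le> f x" if "f \<in> C" for f x
        unfolding u_def using bdd that by (rule cINF_lower)
      have uge: "c \<le> u x" if "\<And>f. f \<in> C \<Longrightarrow> c \<le> f x" for c x
        unfolding u_def using False that by (rule cINF_greatest)
      have subl: "sublinear f" if "f \<in> C" for f using CS that unfolding S_def by blast
      have subadd: "f (x + y) \<le> f x + f y" if "f \<in> C" for f x y
        using subl[OF that] unfolding sublinear_def by blast
      have "sublinear u" unfolding sublinear_def
      proof (intro conjI allI impI)
        fix x y
        have "u (x + y) - g y \<le> u x" if g: "g \<in> C" for g
        proof (rule uge)
          fix f assume f: "f \<in> C"
          from lin[OF f g] consider "\<forall>x. f x \<le> g x" | "\<forall>x. g x \<le> f x" unfolding P_def by blast
          then show "u (x + y) - g y \<le> f x"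
          proof cases
            case 1
            have "u (x + y) \<le> f x + f y" using order_trans[OF ule[OF f, of "x + y"] subadd[OF f]] .
            then show ?thesis using 1[rule_format, of y] by linarith
          next
            case 2
            have "u (x + y) \<le> g x + g y" using order_trans[OF ule[OF g, of "x + y"] subadd[OF g]] .
            then show ?thesis using 2[rule_format, of x] by linarith
          qed
        qed
        then have "u (x + y) - u x \<le> g y" if "g \<in> C" for g using that by (simp add: algebra_simps)
        then have "u (x + y) - u x \<le> u y" by (rule uge)
        then show "u (x + y) \<le> u x + u y" by linarith
      next
        have le: "u (t *\<^sub>R x) \<le> t * u x" if t: "t > 0" for t x
        proof -
          have "u (t *\<^sub>R x) / t \<le> u x"
          proof (rule uge)
            fix f assume f: "f \<in> C"
            have "u (t *\<^sub>R x) \<le> t * f x"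
              using ule[OF f, of "t *\<^sub>R x"] CS f t unfolding S_def sublinear_def by auto
            then show "u (t *\<^sub>R x) / t \<le> f x" using t by (simp add: field_simps)
          qed
          then show ?thesis using t by (simp add: field_simps)
        qed
        fix t :: real and x :: 'a assume t: "t > 0"
        have "u x \<le> inverse t * u (t *\<^sub>R x)" using le[of "inverse t" "t *\<^sub>R x"] t by simp
        then show "u (t *\<^sub>R x) = t * u x" using le[OF t, of x] t by (simp add: field_simps)
      next
        fix x
        from False obtain f where "f \<in> C" by blast
        then show "u x \<le> norm x" using ule[of f x] subl[of f] unfolding sublinear_def by (meson order_trans)
      qed
      moreover have "u x \<le> p x" for x
      proof -
        from False obtain f where f: "f \<in> C" by blast
        then have "f x \<le> p x" using CS unfolding S_def by blast
        then show ?thesis using ule[OF f, of x] by linarith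
      qed
      ultimately have "u \<in> S" unfolding S_def by blast
      then show ?thesis using ule unfolding P_def by blast
    qed
  qed
  then obtain m where m: "m \<in> S" "\<And>a. a \<in> S \<Longrightarrow> P m a \<Longrightarrow> a = m" by blast
  show ?thesis
  proof (intro exI conjI allI impI)
    show "sublinear m" "m x \<le> p x" for x using m(1) unfolding S_def by auto
    fix r assume r: "sublinear r" "\<forall>x. r x \<le> m x"
    then have "r \<in> S" using m(1) unfolding S_def by (auto intro: order_trans)
    then show "r = m" using m(2) r unfolding P_def by blast
  qed
qed

text \<open>The minimal functional is sought below \<open>lower_shift norm y\<close> instead of
  \<open>norm\<close>: this forces \<open>q (- y) \<le> - norm y\<close>, hence equality at
  \<open>y\<close> once \<open>q\<close> is linear.\<close>

lemma real_norming_functional: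
  fixes y :: "'a::real_normed_vector"
  shows "\<exists>f. linear f \<and> (\<forall>x. \<bar>f x\<bar> \<le> norm x) \<and> f y = norm y"
proof -
  obtain q where q: "sublinear q" "\<And>x. q x \<le> lower_shift norm y x"
      "\<And>r. sublinear r \<Longrightarrow> (\<And>x. r x \<le> q x) \<Longrightarrow> r = q"
    using ex_minimal_sublinear[OF lower_shift_sublinear[OF sublinear_norm, of y]] by metis
  note add = minimal_sublinear_additive[OF q(1,3)]
  have neg: "q (- x) = - q x" for x using add[of x "- x"] sublinear_zero[OF q(1)] by simp
  have "linear q"
  proof (rule linearI)
    fix c :: real and x
    consider "c > 0" | "c = 0" | "- c > 0" by linarith
    then show "q (c *\<^sub>R x) = c *\<^sub>R q x"
    proof cases
      case 3
      then have "q ((- c) *\<^sub>R x) = - c * q x" using q(1) unfolding sublinear_def by blast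
      then show ?thesis using neg[of "c *\<^sub>R x"] by simp
    qed (use q(1) sublinear_zero[OF q(1)] in \<open>auto simp: sublinear_def\<close>)
  qed (rule add)
  moreover have "\<bar>q x\<bar> \<le> norm x" for x
  proof -
    have "q x \<le> norm x" using q(1) unfolding sublinear_def by blast
    then show ?thesis using sublinear_lower[OF q(1), of x] by linarith
  qed
  moreover have "q (- y) \<le> - norm y"
    using q(2)[of "- y"] lower_shift_le[OF sublinear_norm, of 1 y "- y"] by simp
  moreover have "q y \<le> norm y" using q(1) unfolding sublinear_def by blast
  ultimately show ?thesis using neg[of y] by (intro exI[of _ q] conjI allI) auto
qed

section \<open>Complex scalars and complex norming functionals\<close>

locale complex_structure =
  fixes J :: "'a::banach \<Rightarrow> 'a"
  assumes cstruct: "cstruct J"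
begin

abbreviation scale :: "complex \<Rightarrow> 'a \<Rightarrow> 'a"  (infixr "\<odot>" 75)
  where "c \<odot> x \<equiv> cscale J c x"

lemma J: "bounded_linear J" "J (J x) = - x"
  using cstruct unfolding cstruct_def by auto

lemmas J_add = linear_add[OF bounded_linear.linear[OF J(1)]]
lemmas J_scaleR = linear_scale[OF bounded_linear.linear[OF J(1)]]

lemma norm_scale [simp]: "norm (c \<odot> x) = cmod c * norm x"
  using cstruct unfolding cstruct_def by auto

lemma bounded_bilinear_scale: "bounded_bilinear (cscale J)"
proof (rule bounded_bilinear.intro)
  show "\<exists>K. \<forall>a b. norm (a \<odot> b) \<le> norm a * norm b * K" by (rule exI[of _ 1]) simp
qed (auto simp: cscale_def J_add J_scaleR algebra_simps)

lemmas bounded_linear_scale = bounded_bilinear.bounded_linear_right[OF bounded_bilinear_scale]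
lemmas scale_add_right = bounded_bilinear.add_right[OF bounded_bilinear_scale]
lemmas scale_add_left = bounded_bilinear.add_left[OF bounded_bilinear_scale]
lemmas scale_diff_right = bounded_bilinear.diff_right[OF bounded_bilinear_scale]
lemmas scale_diff_left = bounded_bilinear.diff_left[OF bounded_bilinear_scale]
lemmas scale_minus_right = bounded_bilinear.minus_right[OF bounded_bilinear_scale]
lemmas scale_minus_left = bounded_bilinear.minus_left[OF bounded_bilinear_scale]
lemmas scale_sum_left = bounded_bilinear.sum_left[OF bounded_bilinear_scale]
lemmas continuous_on_scale = bounded_bilinear.continuous_on[OF bounded_bilinear_scale]

lemma scale_scale: "a \<odot> b \<odot> x = (a * b) \<odot> x"
  by (simp add: cscale_def J_add J_scaleR J(2) algebra_simps)

lemma scale_one [simp]: "1 \<odot> x = x"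
  and scale_zero_left [simp]: "0 \<odot> x = 0"
  and scale_zero_right [simp]: "c \<odot> 0 = 0"
  and scale_of_real: "of_real r \<odot> x = r *\<^sub>R x"
  using linear_0[OF bounded_linear.linear[OF J(1)]] by (auto simp: cscale_def)

definition clinear :: "('a \<Rightarrow> 'a) \<Rightarrow> bool" where
  "clinear S \<longleftrightarrow> bounded_linear S \<and> (\<forall>c x. S (c \<odot> x) = c \<odot> S x)"

definition cfun :: "('a \<Rightarrow> complex) \<Rightarrow> bool" where
  "cfun q \<longleftrightarrow> bounded_linear q \<and> (\<forall>c x. q (c \<odot> x) = c * q x)"

lemma cfun_scale: "cfun q \<Longrightarrow> q (c \<odot> x) = c * q x"
  unfolding cfun_def by blast

text \<open>Complexification of a real norming functional: \<open>f x - \<i> f (J x)\<close> is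
  complex linear, and its real part at \<open>y\<close> is already \<open>norm y\<close>.\<close>

lemma norming_cfun: "\<exists>q. cfun q \<and> (\<forall>x. cmod (q x) \<le> norm x) \<and> cmod (q y) = norm y"
proof -
  obtain f where f: "linear f" "\<And>x. \<bar>f x\<bar> \<le> norm x" "f y = norm y"
    using real_norming_functional[of y] by blast
  define q where "q x = Complex (f x) (- f (J x))" for x
  have fadd: "f (a + b) = f a + f b" and fsc: "f (r *\<^sub>R a) = r * f a" for a b r
    using linear_add[OF f(1)] linear_scale[OF f(1)] by auto
  have add: "q (a + b) = q a + q b" for a b
    by (simp add: q_def complex_eq_iff J_add fadd)
  have fneg: "f (- a) = - f a" and fdiff: "f (a - b) = f a - f b" for a b
    using linear_neg[OF f(1)] linear_diff[OF f(1)] by auto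
  have sc: "q (c \<odot> a) = c * q a" for c a
    by (simp add: q_def complex_eq_iff cscale_def J_add J_scaleR J(2) fadd fsc fneg fdiff algebra_simps)
  have le: "cmod (q a) \<le> norm a" for a
  proof (cases "q a = 0")
    case False
    \<comment> \<open>A unimodular rotation makes \<open>q\<close> real and positive at
      \<open>u \<odot> a\<close>, where it equals \<open>f\<close> and so inherits the real
      bound.\<close>
    define u where "u = cnj (q a) / cmod (q a)"
    have u: "u * q a = cmod (q a)" "cmod u = 1"
      using False by (auto simp: u_def norm_divide complex_norm_square[symmetric] power2_eq_square mult.commute)
    have "cmod (q a) = Re (q (u \<odot> a))" by (simp add: sc u)
    also have "\<dots> = f (u \<odot> a)" by (simp add: q_def)
    also have "\<dots> \<le> norm a" using f(2)[of "u \<odot> a"] u by simp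
    finally show ?thesis .
  qed simp
  have "bounded_linear q"
    by (rule bounded_linear_intro[where K = 1])
      (auto simp: add le, simp add: sc scale_of_real[symmetric] scaleR_conv_of_real)
  moreover have "cmod (q y) = norm y"
    using le[of y] abs_Re_le_cmod[of "q y"] f(3) by (simp add: q_def)
  ultimately show ?thesis using sc le unfolding cfun_def by blast
qed

lemma cfun_eqI:
  assumes "\<And>q. cfun q \<Longrightarrow> q x = q y"
  shows "x = y"
proof -
  obtain q where q: "cfun q" "cmod (q (x - y)) = norm (x - y)" using norming_cfun by blast
  then have "q (x - y) = 0"
    using assms[OF q(1)] linear_diff[OF bounded_linear.linear, of q x y] unfolding cfun_def by simp
  then show ?thesis using q(2) by simp
qed

lemma norm_leI_cfun:
  assumes "\<And>q. cfun q \<Longrightarrow> (\<And>y. cmod (q y) \<le> norm y) \<Longrightarrow> cmod (q x) \<le> C"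
  shows "norm x \<le> C"
  using norming_cfun[of x] assms by metis

end

section \<open>Integrals over the half-line\<close>

text \<open>Cauchy criterion for gauge integrals: on a gauge common to \<open>h\<close> and
  \<open>k\<close> the Riemann sums of \<open>f - h\<close> are dominated by those of
  \<open>k\<close>, hence below e/6 + e/6, and all sums of \<open>f\<close> lie within e/2 of the
  integral of \<open>h\<close>. Only Riemann sums occur, so values in any Banach space are
  allowed.\<close>

lemma integrable_L1_limit_cbox:
  fixes f :: "'n::euclidean_space \<Rightarrow> 'b::banach"
  assumes "\<And>e. e > 0 \<Longrightarrow> \<exists>h k. h integrable_on cbox a b \<and> k integrable_on cbox a b
     \<and> (\<forall>x\<in>cbox a b. norm (f x - h x) \<le> k x) \<and> integral (cbox a b) k < e"
  shows "f integrable_on cbox a b"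
  unfolding integrable_Cauchy
proof (intro allI impI)
  fix e :: real assume e: "e > 0"
  then obtain h k where hk: "h integrable_on cbox a b" "k integrable_on cbox a b"
    "\<And>x. x \<in> cbox a b \<Longrightarrow> norm (f x - h x) \<le> k x" "integral (cbox a b) k < e / 6"
    using assms[of "e / 6"] by auto
  have e6: "e / 6 > 0" using e by simp
  obtain g1 where g1: "gauge g1"
    "\<And>D. D tagged_division_of cbox a b \<Longrightarrow> g1 fine D \<Longrightarrow>
      norm ((\<Sum>(x,K)\<in>D. measure lborel K *\<^sub>R h x) - integral (cbox a b) h) < e / 6"
    using integrable_integral[OF hk(1)] e6 unfolding has_integral by metis
  obtain g2 where g2: "gauge g2"
    "\<And>D. D tagged_division_of cbox a b \<Longrightarrow> g2 fine D \<Longrightarrow>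
      norm ((\<Sum>(x,K)\<in>D. measure lborel K *\<^sub>R k x) - integral (cbox a b) k) < e / 6"
    using integrable_integral[OF hk(2)] e6 unfolding has_integral by metis
  define g where "g x = g1 x \<inter> g2 x" for x
  have close: "norm ((\<Sum>(x,K)\<in>D. measure lborel K *\<^sub>R f x) - integral (cbox a b) h) < e / 2"
    if D: "D tagged_division_of cbox a b" and fine: "g fine D" for D
  proof -
    have f1: "g1 fine D" "g2 fine D" using fine unfolding g_def fine_Int by auto
    have "norm ((\<Sum>(x,K)\<in>D. measure lborel K *\<^sub>R f x) - (\<Sum>(x,K)\<in>D. measure lborel K *\<^sub>R h x))
        = norm (\<Sum>(x,K)\<in>D. measure lborel K *\<^sub>R (f x - h x))"
      by (simp add: sum_subtractf[symmetric] case_prod_unfold algebra_simps)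
    also have "\<dots> \<le> (\<Sum>(x,K)\<in>D. measure lborel K *\<^sub>R k x)"
    proof (rule sum_norm_le, clarify)
      fix x K assume "(x, K) \<in> D"
      then have "x \<in> cbox a b" using D by (meson tag_in_interval)
      then show "norm (measure lborel K *\<^sub>R (f x - h x)) \<le> measure lborel K *\<^sub>R k x"
        using hk(3) by (simp add: mult_left_mono)
    qed
    also have "\<dots> < e / 6 + e / 6" using g2(2)[OF D f1(2)] hk(4) unfolding real_norm_def real_scaleR_def by linarith
    finally show ?thesis using g1(2)[OF D f1(1)]
      norm_triangle_ineq[of "(\<Sum>(x,K)\<in>D. measure lborel K *\<^sub>R f x) - (\<Sum>(x,K)\<in>D. measure lborel K *\<^sub>R h x)"
        "(\<Sum>(x,K)\<in>D. measure lborel K *\<^sub>R h x) - integral (cbox a b) h"] by simp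
  qed
  show "\<exists>\<gamma>. gauge \<gamma> \<and> (\<forall>D1 D2. D1 tagged_division_of cbox a b \<and> \<gamma> fine D1 \<and>
            D2 tagged_division_of cbox a b \<and> \<gamma> fine D2 \<longrightarrow>
            norm ((\<Sum>(x,K)\<in>D1. measure lborel K *\<^sub>R f x) - (\<Sum>(x,K)\<in>D2. measure lborel K *\<^sub>R f x)) < e)"
  proof (intro exI[of _ g] conjI allI impI)
    show "gauge g" unfolding g_def using g1(1) g2(1) by (rule gauge_Int)
    fix D1 D2 assume "D1 tagged_division_of cbox a b \<and> g fine D1 \<and>
            D2 tagged_division_of cbox a b \<and> g fine D2"
    then show "norm ((\<Sum>(x,K)\<in>D1. measure lborel K *\<^sub>R f x) - (\<Sum>(x,K)\<in>D2. measure lborel K *\<^sub>R f x)) < e"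
      using norm_triangle_half_l[OF close[of D1] close[of D2]] by blast
  qed
qed

text \<open>Passage to unbounded \<open>S\<close>: the integrals of \<open>f\<close> and
  \<open>h\<close> over a box differ by less than e/3 uniformly in the box, because \<open>k\<close>
  is nonnegative on \<open>S\<close> and its total integral is small.\<close>

lemma integrable_L1_limit:
  fixes f :: "'n::euclidean_space \<Rightarrow> 'b::banach"
  assumes "\<And>e. e > 0 \<Longrightarrow> \<exists>h k. h integrable_on S \<and> k integrable_on S
     \<and> (\<forall>x\<in>S. norm (f x - h x) \<le> k x) \<and> integral S k < e"
  shows "f integrable_on S"
proof -
  define cut where "cut g x = (if x \<in> S then g x else 0)" for g :: "'n \<Rightarrow> 'b" and x
  define cutr where "cutr g x = (if x \<in> S then g x else 0)" for g :: "'n \<Rightarrow> real" and x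
  have approx: "\<exists>h k. h integrable_on S \<and> (\<forall>a b. cut h integrable_on cbox a b \<and> cutr k integrable_on cbox a b
      \<and> integral (cbox a b) (cutr k) < e) \<and> (\<forall>x. norm (cut f x - cut h x) \<le> cutr k x)" if e: "e > 0" for e
  proof -
    obtain h k where hk: "h integrable_on S" "k integrable_on S"
      "\<And>x. x \<in> S \<Longrightarrow> norm (f x - h x) \<le> k x" "integral S k < e" using assms[OF e] by blast
    have kU: "cutr k integrable_on UNIV" "integral UNIV (cutr k) = integral S k"
      using hk(2) unfolding cutr_def by (auto simp: integrable_restrict_UNIV integral_restrict_UNIV)
    have kb: "cutr k integrable_on cbox a b" for a b
      using integrable_on_subcbox[OF kU(1)] by simp
    have k0: "cutr k x \<ge> 0" for x using hk(3)[of x] by (auto simp: cutr_def intro: order_trans[OF norm_ge_zero])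
    have "integral (cbox a b) (cutr k) < e" for a b
      using integral_subset_le[OF subset_UNIV kb kU(1)] k0 kU(2) hk(4) by (metis order_le_less_trans)
    moreover have "cut h integrable_on cbox a b" for a b
      using hk(1) unfolding cut_def by (subst (asm) integrable_alt) blast
    moreover have "norm (cut f x - cut h x) \<le> cutr k x" for x
      using hk(3) by (simp add: cut_def cutr_def)
    ultimately show ?thesis using kb hk(1) by blast
  qed
  have fb: "cut f integrable_on cbox a b" for a b
  proof (rule integrable_L1_limit_cbox)
    fix e :: real assume "e > 0"
    then show "\<exists>h k. h integrable_on cbox a b \<and> k integrable_on cbox a b
     \<and> (\<forall>x\<in>cbox a b. norm (cut f x - h x) \<le> k x) \<and> integral (cbox a b) k < e"
      using approx[of e] by blast
  qed
  show ?thesis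
  proof (subst integrable_alt, intro conjI allI impI)
    fix a b show "(\<lambda>x. if x \<in> S then f x else 0) integrable_on cbox a b"
      using fb[of a b] unfolding cut_def .
  next
    fix e :: real assume "e > 0"
    then have e: "e / 3 > 0" by simp
    obtain h k where H: "h integrable_on S" "\<forall>a b. cut h integrable_on cbox a b \<and> cutr k integrable_on cbox a b
      \<and> integral (cbox a b) (cutr k) < e / 3" "\<forall>x. norm (cut f x - cut h x) \<le> cutr k x"
      using approx[OF e] by (elim exE conjE)
    then have hk: "h integrable_on S" "\<And>a b. cut h integrable_on cbox a b"
      "\<And>a b. cutr k integrable_on cbox a b" "\<And>a b. integral (cbox a b) (cutr k) < e / 3"
      "\<And>x. norm (cut f x - cut h x) \<le> cutr k x" by blast+
    have d: "norm (integral (cbox a b) (cut f) - integral (cbox a b) (cut h)) < e / 3" for a b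
    proof -
      have "norm (integral (cbox a b) (\<lambda>x. cut f x - cut h x)) \<le> integral (cbox a b) (cutr k)"
        using hk fb by (intro integral_norm_bound_integral integrable_diff) auto
      then show ?thesis using hk(4)[of a b] integral_diff[OF fb hk(2), of a b] by simp
    qed
    obtain B where B: "B > 0" "\<And>a b c d. ball 0 B \<subseteq> cbox a b \<and> ball 0 B \<subseteq> cbox c d \<Longrightarrow>
        norm (integral (cbox a b) (cut h) - integral (cbox c d) (cut h)) < e / 3"
      using integrable_altD(2)[OF hk(1) e] unfolding cut_def by blast
    have "norm (integral (cbox a b) (cut f) - integral (cbox c d) (cut f)) < e"
      if "ball 0 B \<subseteq> cbox a b \<and> ball 0 B \<subseteq> cbox c d" for a b c d
    proof -
      have "norm (u - v) \<le> norm (u - u') + norm (u' - v') + norm (v - v')" for u v u' v' :: 'b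
        using norm_triangle_ineq[of "u - u'" "u' - v"] norm_triangle_ineq[of "u' - v'" "v' - v"]
        by (simp add: norm_minus_commute)
      from this[of "integral (cbox a b) (cut f)" "integral (cbox c d) (cut f)" "integral (cbox a b) (cut h)"
          "integral (cbox c d) (cut h)"]
      show ?thesis using d[of a b] d[of c d] B(2)[OF that] by linarith
    qed
    then show "\<exists>B>0. \<forall>a b c d. ball 0 B \<subseteq> cbox a b \<and> ball 0 B \<subseteq> cbox c d \<longrightarrow>
       norm (integral (cbox a b) (\<lambda>x. if x \<in> S then f x else 0) -
         integral (cbox c d) (\<lambda>x. if x \<in> S then f x else 0)) < e"
      using B(1) unfolding cut_def by blast
  qed
qed

lemma has_integral_arctan:
  assumes "0 \<le> a" "a \<le> b"
  shows "((\<lambda>t::real. 1 / (1 + t^2)) has_integral (arctan b - arctan a)) {a..b}"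
proof (rule fundamental_theorem_of_calculus[OF assms(2)])
  fix x assume "x \<in> {a..b}"
  show "(arctan has_vector_derivative 1 / (1 + x^2)) (at x within {a..b})"
    by (auto intro!: derivative_eq_intros simp: has_real_derivative_iff_has_vector_derivative[symmetric] inverse_eq_divide)
qed

lemma arctan_kernel:
  "(\<lambda>t::real. 1 / (1 + t^2)) integrable_on {0..}" "integral {0..} (\<lambda>t::real. 1 / (1 + t^2)) = pi / 2"
proof -
  define f where "f n t = (if t \<in> {0..real n} then 1 / (1 + t^2) else 0)" for n and t :: real
  have sub: "{0..real n} \<subseteq> {0..}" for n by auto
  have fi: "(f n has_integral arctan (real n)) {0..}" for n
    unfolding f_def has_integral_restrict[OF sub] using has_integral_arctan[of 0 "real n"] by simp
  have "(\<lambda>t::real. 1 / (1 + t^2)) integrable_on {0..} \<and>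
      (\<lambda>n. integral {0..} (f n)) \<longlonglongrightarrow> integral {0..} (\<lambda>t. 1 / (1 + t^2))"
  proof (rule monotone_convergence_increasing)
    show "f n integrable_on {0..}" for n using fi by blast
    show "f n t \<le> f (Suc n) t" for n t by (auto simp: f_def)
    show "(\<lambda>n. f n t) \<longlonglongrightarrow> 1 / (1 + t^2)" if "t \<in> {0..}" for t
    proof (rule tendsto_eventually)
      obtain m where "t \<le> real m" using real_arch_simple by blast
      then show "\<forall>\<^sub>F n in sequentially. f n t = 1 / (1 + t^2)"
        using that by (auto simp: eventually_sequentially f_def intro!: exI[of _ m])
    qed
    have "integral {0..} (f n) = arctan (real n)" for n using fi integral_unique by blast
    then show "bounded (range (\<lambda>n. integral {0..} (f n)))"
      using arctan_bounded by (intro boundedI[of _ "pi/2"]) (auto simp: abs_le_iff less_imp_le minus_le_iff)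
  qed
  moreover have "(\<lambda>n. integral {0..} (f n)) \<longlonglongrightarrow> pi / 2"
  proof -
    have "integral {0..} (f n) = arctan (real n)" for n using fi integral_unique by blast
    moreover have "(\<lambda>n. arctan (real n)) \<longlonglongrightarrow> pi / 2"
      using tendsto_arctan_at_top filterlim_real_sequentially by (rule filterlim_compose)
    ultimately show ?thesis by simp
  qed
  ultimately show "(\<lambda>t::real. 1 / (1 + t^2)) integrable_on {0..}"
    "integral {0..} (\<lambda>t::real. 1 / (1 + t^2)) = pi / 2" using LIMSEQ_unique by blast+
qed

text \<open>The class of integrands on a ray. The origin is left out because resolvents live on
  \<open>outer om\<close>, which misses 0. The majorant is what first-order decay of a symbol, t /
  (1 + t^2), leaves after multiplication by the resolvent bound 1/t, and its integral is
  explicit.\<close>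

definition tame :: "(real \<Rightarrow> 'b::banach) \<Rightarrow> bool" where
  "tame f \<longleftrightarrow> continuous_on {0<..} f \<and> (\<exists>C. \<forall>t>0. norm (f t) \<le> C / (1 + t^2))"

lemma tameI: "continuous_on {0<..} f \<Longrightarrow> (\<And>t. t > 0 \<Longrightarrow> norm (f t) \<le> C / (1 + t^2)) \<Longrightarrow> tame f"
  unfolding tame_def by blast

text \<open>Truncation to [1/(n+1), n+1] leaves an error whose majorant \<open>k n\<close> has
  integral \<open>K n\<close>, an explicit expression in arctangents tending to 0; this gives
  integrability and the limit together.\<close>

lemma tame_truncation:
  fixes f :: "real \<Rightarrow> 'b::banach"
  assumes f: "tame f"
  shows "f integrable_on {0..}"
    and "(\<lambda>n. integral {1 / real (Suc n)..real (Suc n)} f) \<longlonglongrightarrow> integral {0..} f"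
proof -
  obtain C where cont: "continuous_on {0<..} f" and C: "\<And>t. t > 0 \<Longrightarrow> norm (f t) \<le> C / (1 + t^2)"
    using f unfolding tame_def by blast
  have C0: "C \<ge> 0" using order_trans[OF norm_ge_zero C[of 1]] by simp
  define I where "I n = {1 / real (Suc n)..real (Suc n)}" for n
  \<comment> \<open>The bound says nothing at \<open>t = 0\<close>, so the value there is reset; a
    single point does not affect the integral.\<close>
  define f0 where "f0 t = (if t = 0 then 0 else f t)" for t
  define h where "h n t = (if t \<in> I n then f t else 0)" for n t
  define k where "k n t = (if t \<in> I n then 0 else C / (1 + t^2))" for n t
  have I: "I n \<subseteq> {0..}" "I n \<subseteq> {0<..}" "1 / real (Suc n) \<le> real (Suc n)" for n
  proof -
    have pos: "1 / real (Suc n) > 0" by simp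
    show "I n \<subseteq> {0..}" "I n \<subseteq> {0<..}" using order_less_le_trans[OF pos] unfolding I_def by (auto intro: less_imp_le)
    have "1 / real (Suc n) \<le> 1" by simp
    also have "1 \<le> real (Suc n)" by simp
    finally show "1 / real (Suc n) \<le> real (Suc n)" .
  qed
  have fI: "f integrable_on I n" for n
    using integrable_continuous_real[OF continuous_on_subset[OF cont I(2)[of n, unfolded I_def]]] unfolding I_def .
  have hI: "(h n has_integral integral (I n) f) {0..}" for n
    unfolding h_def has_integral_restrict[OF I(1)] using fI by (rule integrable_integral)
  have g: "((\<lambda>t. C / (1 + t^2)) has_integral C * (pi / 2)) {0..}"
    using has_integral_mult_right[OF integrable_integral[OF arctan_kernel(1)], of C] arctan_kernel(2) by simp
  have gI: "((\<lambda>t. if t \<in> I n then C / (1 + t^2) else 0) has_integral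
      C * (arctan (real (Suc n)) - arctan (1 / real (Suc n)))) {0..}" for n
    unfolding has_integral_restrict[OF I(1)]
    using has_integral_mult_right[OF has_integral_arctan[of "1 / real (Suc n)" "real (Suc n)"], of C] I(3)[of n]
    unfolding I_def by simp
  define K where "K n = C * (pi / 2) - C * (arctan (real (Suc n)) - arctan (1 / real (Suc n)))" for n
  have kI: "(k n has_integral K n) {0..}" for n
    using has_integral_diff[OF g gI[of n]] unfolding K_def k_def
    by (rule has_integral_eq[rotated]) auto
  have K: "K \<longlonglongrightarrow> 0"
  proof -
    have "(\<lambda>n. arctan (real (Suc n))) \<longlonglongrightarrow> pi / 2"
      using filterlim_compose[OF tendsto_arctan_at_top filterlim_compose[OF filterlim_real_sequentially filterlim_Suc]] .
    moreover have "(\<lambda>n. arctan (1 / real (Suc n))) \<longlonglongrightarrow> arctan 0"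
      using tendsto_arctan[OF LIMSEQ_inverse_real_of_nat] unfolding inverse_eq_divide .
    ultimately have "(\<lambda>n. C * (pi / 2) - C * (arctan (real (Suc n)) - arctan (1 / real (Suc n))))
        \<longlonglongrightarrow> C * (pi / 2) - C * (pi / 2 - arctan 0)"
      by (intro tendsto_diff tendsto_mult tendsto_const)
    then show ?thesis unfolding K_def by simp
  qed
  have bound: "norm (f0 t - h n t) \<le> k n t" if "t \<in> {0..}" for n t
    using C[of t] that I(2)[of n] C0 by (auto simp: f0_def h_def k_def)
  have f0: "f0 integrable_on {0..}"
  proof (rule integrable_L1_limit)
    fix e :: real assume "e > 0"
    then obtain n where n: "K n < e" using eventually_happens[OF order_tendstoD(2)[OF K \<open>e > 0\<close>]] by auto
    show "\<exists>h k. h integrable_on {0..} \<and> k integrable_on {0..} \<and>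
        (\<forall>x\<in>{0..}. norm (f0 x - h x) \<le> k x) \<and> integral {0..} k < e"
      using hI[of n] kI[of n] bound n integral_unique[OF kI[of n]]
      by (intro exI[of _ "h n"] exI[of _ "k n"]) (auto simp: has_integral_integrable)
  qed
  have spike: "negligible {0::real}" "\<And>x. x \<in> {0..} - {0} \<Longrightarrow> f x = f0 x" by (auto simp: f0_def)
  show fint: "f integrable_on {0..}" using integrable_spike[OF f0 spike] .
  have eq: "integral {0..} f0 = integral {0..} f" by (rule integral_spike[OF spike])
  have "norm (integral {1 / real (Suc n)..real (Suc n)} f - integral {0..} f) \<le> K n" for n
  proof -
    have "norm (integral {0..} (\<lambda>t. f0 t - h n t)) \<le> integral {0..} (k n)"
      using bound f0 has_integral_integrable[OF hI] has_integral_integrable[OF kI]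
      by (intro integral_norm_bound_integral integrable_diff)
    moreover have "integral {0..} (\<lambda>t. f0 t - h n t) = integral {0..} f0 - integral (I n) f"
      using integral_diff[OF f0 has_integral_integrable[OF hI[of n]]] integral_unique[OF hI[of n]] by simp
    ultimately show ?thesis using integral_unique[OF kI] unfolding eq I_def by (simp add: norm_minus_commute)
  qed
  then have "(\<lambda>n. integral {1 / real (Suc n)..real (Suc n)} f - integral {0..} f) \<longlonglongrightarrow> 0"
    by (rule Lim_null_comparison[OF always_eventually[OF allI] K])
  then show "(\<lambda>n. integral {1 / real (Suc n)..real (Suc n)} f) \<longlonglongrightarrow> integral {0..} f"
    by (rule LIM_zero_cancel)
qed

lemmas tame_integrable = tame_truncation(1)

lemma tame_bounded_linear:
  assumes "tame f" "bounded_linear S"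
  shows "tame (\<lambda>t. S (f t))" "integral {0..} (\<lambda>t. S (f t)) = S (integral {0..} f)"
proof -
  obtain C where cont: "continuous_on {0<..} f" and C: "\<And>t. t > 0 \<Longrightarrow> norm (f t) \<le> C / (1 + t^2)"
    using assms unfolding tame_def by blast
  obtain K where K: "K > 0" "\<And>x. norm (S x) \<le> norm x * K" using bounded_linear.pos_bounded[OF assms(2)] by blast
  show "tame (\<lambda>t. S (f t))"
  proof (rule tameI)
    show "continuous_on {0<..} (\<lambda>t. S (f t))" using bounded_linear.continuous_on[OF assms(2) cont] .
    fix t :: real assume "t > 0"
    then have "norm (f t) * K \<le> C / (1 + t^2) * K" using C K by (intro mult_right_mono) auto
    then show "norm (S (f t)) \<le> (C * K) / (1 + t^2)" using K(2)[of "f t"] by simp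
  qed
  show "integral {0..} (\<lambda>t. S (f t)) = S (integral {0..} f)"
    using integral_linear[OF tame_integrable[OF assms(1)] assms(2)] by (simp add: o_def)
qed

lemma tame_add:
  assumes "tame f" "tame g"
  shows "tame (\<lambda>t. f t + g t)"
proof -
  obtain C where f: "continuous_on {0<..} f" "\<And>t. t > 0 \<Longrightarrow> norm (f t) \<le> C / (1 + t^2)"
    using assms unfolding tame_def by blast
  obtain D where g: "continuous_on {0<..} g" "\<And>t. t > 0 \<Longrightarrow> norm (g t) \<le> D / (1 + t^2)"
    using assms unfolding tame_def by blast
  show ?thesis
  proof (rule tameI)
    show "continuous_on {0<..} (\<lambda>t. f t + g t)" using f g by (intro continuous_intros)
    fix t :: real assume "t > 0"
    then show "norm (f t + g t) \<le> (C + D) / (1 + t^2)"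
      using f(2)[of t] g(2)[of t] norm_triangle_ineq[of "f t" "g t"] by (simp add: add_divide_distrib)
  qed
qed

lemma tame_norm_integral:
  assumes f: "tame f" and C: "\<And>t. t > 0 \<Longrightarrow> norm (f t) \<le> C / (1 + t^2)"
  shows "norm (integral {0..} f) \<le> C * (pi / 2)"
proof -
  define f0 where "f0 t = (if t = 0 then 0 else f t)" for t
  have C0: "C \<ge> 0" using order_trans[OF norm_ge_zero C[of 1]] by simp
  have spike: "negligible {0::real}" "\<And>x. x \<in> {0..} - {0} \<Longrightarrow> f0 x = f x" by (auto simp: f0_def)
  have "f0 integrable_on {0..}" using integrable_spike[OF tame_integrable[OF f] spike] .
  moreover have g: "((\<lambda>t. C / (1 + t^2)) has_integral C * (pi / 2)) {0..}"
    using has_integral_mult_right[OF integrable_integral[OF arctan_kernel(1)], of C] arctan_kernel(2) by simp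
  ultimately have "norm (integral {0..} f0) \<le> integral {0..} (\<lambda>t. C / (1 + t^2))"
    using C C0 by (intro integral_norm_bound_integral) (auto simp: f0_def)
  then show ?thesis using integral_unique[OF g] integral_spike[of "{0}" "{0..}" f f0] by (auto simp: f0_def)
qed

section \<open>Cauchy's theorem in sectors\<close>

text \<open>The sector of half-angle \<open>arccos c\<close>, expressed without \<open>Arg\<close>:
  openness and star-shapedness become norm estimates, also when the half-angle exceeds pi/2
  (\<open>c < 0\<close>).\<close>

definition cone :: "real \<Rightarrow> complex set" where
  "cone c = {z. c * cmod z < Re z}"

text \<open>The complement of the closed sector of half-angle \<open>s\<close>, written as a
  reflected cone so that primitives can be transported by the reflection in 0.\<close>

definition outer :: "real \<Rightarrow> complex set" where
  "outer s = {z. - z \<in> cone (- cos s)}"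

lemma cos_Arg_cmod: "Re z = cmod z * cos \<bar>Arg z\<bar>"
  using arg_cong[OF rcis_cmod_Arg[of z], of Re] by simp

lemma sector_eq_cone:
  assumes "0 \<le> s" "s \<le> pi"
  shows "sector s = cone (cos s)"
proof -
  have "z \<in> sector s \<longleftrightarrow> z \<in> cone (cos s)" for z
  proof (cases "z = 0")
    case False
    have "\<bar>Arg z\<bar> \<le> pi" using Arg_bounded[of z] by auto
    then have "\<bar>Arg z\<bar> < s \<longleftrightarrow> cos s < cos \<bar>Arg z\<bar>" using cos_mono_less_eq[of s "\<bar>Arg z\<bar>"] assms by simp
    then show ?thesis using False cos_Arg_cmod[of z] by (auto simp: sector_def cone_def)
  qed (auto simp: sector_def cone_def)
  then show ?thesis by blast
qed

lemma mem_outer_iff: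
  assumes "0 \<le> s" "s \<le> pi"
  shows "z \<in> outer s \<longleftrightarrow> z \<noteq> 0 \<and> s < \<bar>Arg z\<bar>"
proof (cases "z = 0")
  case False
  have "\<bar>Arg z\<bar> \<le> pi" using Arg_bounded[of z] by auto
  then have "s < \<bar>Arg z\<bar> \<longleftrightarrow> cos \<bar>Arg z\<bar> < cos s" using cos_mono_less_eq[of "\<bar>Arg z\<bar>" s] assms by simp
  then show ?thesis using False cos_Arg_cmod[of z] by (auto simp: outer_def cone_def mult.commute)
qed (auto simp: outer_def cone_def)

lemma open_cone: "open (cone c)"
  unfolding cone_def by (intro open_Collect_less continuous_intros)

lemma open_outer: "open (outer s)"
proof -
  have "outer s = uminus -` cone (- cos s)" unfolding outer_def by auto
  then show ?thesis using open_vimage[OF open_cone] continuous_on_minus[OF continuous_on_id] by metis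
qed

text \<open>The centre is 1. For \<open>c < 0\<close> the cone is not convex, and the sign of
  \<open>c\<close> decides whether \<open>cmod w\<close> has to be estimated from above or from
  below; hence the different triangle inequalities in the two cases.\<close>

lemma starlike_cone:
  assumes "-1 \<le> c" "c < 1"
  shows "starlike (cone c)"
  unfolding starlike_def
proof (intro bexI ballI subsetI)
  show "1 \<in> cone c" using assms by (simp add: cone_def)
  fix z w assume z: "z \<in> cone c" and w: "w \<in> closed_segment 1 z"
  obtain u where u: "0 \<le> u" "u \<le> 1" and w: "w = of_real (1 - u) + of_real u * z"
    using w unfolding closed_segment_def by (auto simp: scaleR_conv_of_real)
  have nu: "cmod (1 - complex_of_real u) = 1 - u" using norm_of_real[of "1 - u", where 'a = complex] u by simp
  have Rew: "Re w = (1 - u) + u * Re z" using w by simp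
  show "w \<in> cone c"
  proof (cases "c \<ge> 0")
    case True
    have "cmod w \<le> (1 - u) + u * cmod z"
      using norm_triangle_ineq[of "of_real (1 - u) :: complex" "of_real u * z"] u unfolding w by (simp add: norm_mult nu)
    then have "c * cmod w \<le> c * ((1 - u) + u * cmod z)" using True by (rule mult_left_mono)
    also have "\<dots> = (1 - u) * c + u * (c * cmod z)" by (simp add: algebra_simps)
    also have "\<dots> < (1 - u) + u * Re z"
    proof (cases "u = 0")
      case False
      have "u * (c * cmod z) < u * Re z" using z u False by (auto simp: cone_def)
      moreover have "(1 - u) * c \<le> 1 - u" using u assms by (simp add: mult_left_le)
      ultimately show ?thesis by linarith
    qed (use assms in simp)
    finally show ?thesis using Rew by (simp add: cone_def)
  next
    case False
    show ?thesis
    proof (rule ccontr)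
      assume "w \<notin> cone c"
      then have le: "Re w \<le> c * cmod w" by (simp add: cone_def)
      have u0: "u \<noteq> 0"
      proof
        assume "u = 0"
        then have "w = 1" using w by simp
        then show False using le assms by simp
      qed
      have "u * cmod z \<le> cmod w + (1 - u)"
        using norm_triangle_ineq4[of w "of_real (1 - u)"] u unfolding w by (simp add: norm_mult nu)
      then have "c * (cmod w + (1 - u)) \<le> c * (u * cmod z)" using False by (intro mult_left_mono_neg) auto
      moreover have "- (1 - u) \<le> c * (1 - u)" using mult_right_mono[of "-1" c "1 - u"] u assms by simp
      ultimately have "u * Re z \<le> u * (c * cmod z)" using le Rew by (simp add: algebra_simps)
      moreover have "u * (c * cmod z) < u * Re z" using z u u0 by (auto simp: cone_def)
      ultimately show False by linarith
    qed
  qed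
qed

lemma primitive_sector:
  assumes "0 < s" "s \<le> pi" "h holomorphic_on sector s"
  shows "\<exists>P. \<forall>z\<in>sector s. (P has_field_derivative h z) (at z)"
proof -
  have c: "-1 \<le> cos s" "cos s < 1" using cos_mono_less_eq[of s 0] assms by auto
  have eq: "sector s = cone (cos s)" using sector_eq_cone assms by simp
  show ?thesis
    using holomorphic_starlike_primitive[OF holomorphic_on_imp_continuous_on starlike_cone[OF c] open_cone finite.emptyI, of h]
      holomorphic_on_imp_differentiable_at[OF _ open_cone] assms(3) unfolding eq by auto
qed

lemma primitive_outer:
  assumes "0 \<le> s" "s < pi" "h holomorphic_on outer s"
  shows "\<exists>P. \<forall>z\<in>outer s. (P has_field_derivative h z) (at z)"
proof -
  have c: "-1 \<le> - cos s" "- cos s < 1" using cos_mono_less_eq[of pi s] assms by auto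
  have im: "uminus ` cone (- cos s) = outer s" unfolding outer_def
    by (auto simp: image_iff) (metis minus_minus)
  have h': "(\<lambda>z. h (- z)) holomorphic_on cone (- cos s)"
    using holomorphic_on_compose[of uminus "cone (- cos s)" h] assms(3) im
    by (simp add: o_def holomorphic_on_minus holomorphic_on_ident)
  then obtain Q where Q: "\<And>z. z \<in> cone (- cos s) \<Longrightarrow> (Q has_field_derivative h (- z)) (at z)"
    using holomorphic_starlike_primitive[OF holomorphic_on_imp_continuous_on[OF h'] starlike_cone[OF c] open_cone finite.emptyI]
      holomorphic_on_imp_differentiable_at[OF h' open_cone] by auto
  have "((\<lambda>z. - Q (- z)) has_field_derivative h z) (at z)" if "z \<in> outer s" for z
  proof -
    have "(Q has_field_derivative h z) (at (- z))" using Q[of "- z"] that by (simp add: outer_def)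
    then show ?thesis by (auto intro!: derivative_eq_intros DERIV_chain2[where f = Q])
  qed
  then show ?thesis by blast
qed

abbreviation ray :: "real \<Rightarrow> real \<Rightarrow> complex" where
  "ray t \<theta> \<equiv> of_real t * cis \<theta>"

lemma sector_pos: "z \<in> sector s \<Longrightarrow> cmod z > 0"
  by (simp add: sector_def)

lemma ray_in_sector:
  assumes "\<bar>\<theta>\<bar> < s" "s \<le> pi" "t > 0"
  shows "ray t \<theta> \<in> sector s"
proof -
  have "cos s < cos \<bar>\<theta>\<bar>" using cos_mono_less_eq[of s "\<bar>\<theta>\<bar>"] assms by auto
  then show ?thesis using assms by (subst sector_eq_cone) (auto simp: cone_def norm_mult)
qed

lemma ray_in_outer:
  assumes "s < \<theta>" "\<theta> < 2 * pi - s" "0 \<le> s" "t > 0"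
  shows "ray t \<theta> \<in> outer s"
proof -
  have "cos \<theta> < cos s"
  proof (cases "\<theta> \<le> pi")
    case True
    then show ?thesis using cos_mono_less_eq[of \<theta> s] assms by auto
  next
    case False
    have "cos (2 * pi - \<theta>) < cos s" using cos_mono_less_eq[of "2 * pi - \<theta>" s] assms False by auto
    then show ?thesis by simp
  qed
  then show ?thesis using assms by (auto simp: outer_def cone_def norm_mult)
qed

text \<open>On the boundary \<open>Re z = c * cmod z\<close> the difference of the squares is
  exactly \<open>(1 - c) / 2 * (cmod z - a)^2\<close>. For \<open>c = cos s\<close> with s in
  [0, pi] the constant is the cosine of s/2.\<close>

lemma cmod_add_of_real_ge:
  assumes "c * cmod z \<le> Re z" "-1 \<le> c" "c \<le> 1" "a \<ge> 0"
  shows "sqrt ((1 + c) / 2) * (cmod z + a) \<le> cmod (z + of_real a)"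
proof (rule power2_le_imp_le)
  have "(cmod (z + of_real a))^2 = (cmod z)^2 + 2 * a * Re z + a^2"
    unfolding cmod_power2 by (simp add: power2_eq_square algebra_simps)
  moreover have "a * (c * cmod z) \<le> a * Re z" using assms by (intro mult_left_mono) auto
  moreover have "0 \<le> (1 - c) / 2 * (cmod z - a)^2" using assms by simp
  moreover have "(sqrt ((1 + c) / 2) * (cmod z + a))^2 = (1 + c) / 2 * (cmod z + a)^2"
    using assms by (simp add: power_mult_distrib)
  ultimately show "(sqrt ((1 + c) / 2) * (cmod z + a))^2 \<le> (cmod (z + of_real a))^2"
    by (simp add: power2_eq_square field_simps)
qed simp

lemma ray_FTC:
  assumes "x \<le> y" "\<And>t. t \<in> {x..y} \<Longrightarrow> (P has_field_derivative h (ray t \<theta>)) (at (ray t \<theta>))"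
  shows "cis \<theta> * integral {x..y} (\<lambda>t. h (ray t \<theta>)) = P (of_real y * cis \<theta>) - P (of_real x * cis \<theta>)"
proof -
  have "((\<lambda>t. cis \<theta> * h (ray t \<theta>)) has_integral
      (P (of_real y * cis \<theta>) - P (of_real x * cis \<theta>))) {x..y}"
  proof (rule fundamental_theorem_of_calculus[OF assms(1), of "\<lambda>t. P (ray t \<theta>)"])
    fix t assume t: "t \<in> {x..y}"
    have "((\<lambda>t. ray t \<theta>) has_vector_derivative cis \<theta>) (at t)"
      by (auto intro!: derivative_eq_intros simp: has_vector_derivative_def scaleR_conv_of_real)
    from field_vector_diff_chain_at[OF this assms(2)[OF t]]
    show "((\<lambda>t. P (ray t \<theta>)) has_vector_derivative cis \<theta> * h (ray t \<theta>)) (at t within {x..y})"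
      by (auto simp: o_def intro: has_vector_derivative_at_within)
  qed
  then show ?thesis by (metis integral_mult_right integral_unique)
qed

text \<open>A primitive turns the two truncated ray integrals into increments of \<open>P\<close>,
  and their difference into increments along the arcs of radius n+1 and 1/(n+1). Along an arc of
  radius r the increment is O(r / (1 + r^2)), which vanishes at both ends.\<close>

lemma sector_Cauchy:
  fixes P h :: "complex \<Rightarrow> complex"
  assumes "\<theta>1 \<le> \<theta>2"
    and P: "\<And>r \<theta>. r > 0 \<Longrightarrow> \<theta> \<in> {\<theta>1..\<theta>2} \<Longrightarrow> (P has_field_derivative h (of_real r * cis \<theta>)) (at (of_real r * cis \<theta>))"
    and bound: "\<And>r \<theta>. r > 0 \<Longrightarrow> \<theta> \<in> {\<theta>1..\<theta>2} \<Longrightarrow> cmod (h (of_real r * cis \<theta>)) \<le> C / (1 + r^2)"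
    and tame: "tame (\<lambda>t. h (of_real t * cis \<theta>1))" "tame (\<lambda>t. h (of_real t * cis \<theta>2))"
  shows "cis \<theta>1 * integral {0..} (\<lambda>t. h (of_real t * cis \<theta>1)) = cis \<theta>2 * integral {0..} (\<lambda>t. h (of_real t * cis \<theta>2))"
proof -
  have C0: "C \<ge> 0" using order_trans[OF norm_ge_zero bound[of 1 \<theta>1]] assms(1) by simp
  define I where "I \<theta> n = cis \<theta> * integral {1 / real (Suc n)..real (Suc n)} (\<lambda>t. h (ray t \<theta>))" for \<theta> n
  have lim: "I \<theta> \<longlonglongrightarrow> cis \<theta> * integral {0..} (\<lambda>t. h (ray t \<theta>))"
    if "tame (\<lambda>t. h (ray t \<theta>))" for \<theta>
    unfolding I_def using tame_truncation(2)[OF that] by (intro tendsto_mult tendsto_const)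
  have arc: "cmod (P (of_real r * cis \<theta>2) - P (of_real r * cis \<theta>1)) \<le> r * C / (1 + r^2) * (\<theta>2 - \<theta>1)"
    if r: "r > 0" for r
  proof -
    have "norm (P (of_real r * cis \<theta>2) - P (of_real r * cis \<theta>1)) \<le> r * C / (1 + r^2) * norm (\<theta>2 - \<theta>1)"
    proof (rule differentiable_bound[of "{\<theta>1..\<theta>2}" "\<lambda>\<theta>. P (of_real r * cis \<theta>)"
          "\<lambda>\<theta> u. u *\<^sub>R ((\<i> * (of_real r * cis \<theta>)) * h (of_real r * cis \<theta>))"])
      fix \<theta> assume th: "\<theta> \<in> {\<theta>1..\<theta>2}"
      have "((\<lambda>\<theta>. of_real r * cis \<theta>) has_vector_derivative \<i> * (of_real r * cis \<theta>)) (at \<theta>)"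
        unfolding cis_conv_exp
        by (auto intro!: derivative_eq_intros has_vector_derivative_real_field simp: algebra_simps)
      from field_vector_diff_chain_at[OF this P[OF r th]]
      show "((\<lambda>\<theta>. P (of_real r * cis \<theta>)) has_derivative
          (\<lambda>u. u *\<^sub>R ((\<i> * (of_real r * cis \<theta>)) * h (of_real r * cis \<theta>)))) (at \<theta> within {\<theta>1..\<theta>2})"
        by (auto simp: o_def has_vector_derivative_def intro: has_derivative_at_withinI)
      show "onorm (\<lambda>u. u *\<^sub>R ((\<i> * (of_real r * cis \<theta>)) * h (of_real r * cis \<theta>))) \<le> r * C / (1 + r^2)"
      proof (rule onorm_le)
        fix u :: real
        have "r * cmod (h (of_real r * cis \<theta>)) \<le> r * (C / (1 + r^2))"
          using bound[OF r th] r by (intro mult_left_mono) auto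
        then show "norm (u *\<^sub>R ((\<i> * (of_real r * cis \<theta>)) * h (of_real r * cis \<theta>))) \<le> r * C / (1 + r^2) * norm u"
          using r mult_right_mono[of _ _ "\<bar>u\<bar>"] by (fastforce simp: norm_mult mult.commute)
      qed
    qed (use assms(1) in auto)
    then show ?thesis using assms(1) by simp
  qed
  define a where "a r = r * C / (1 + r^2) * (\<theta>2 - \<theta>1)" for r :: real
  have ends: "(\<lambda>n. a (real (Suc n))) \<longlonglongrightarrow> 0" "(\<lambda>n. a (1 / real (Suc n))) \<longlonglongrightarrow> 0"
    unfolding a_def by real_asymp+
  have I: "I \<theta> n = P (of_real (real (Suc n)) * cis \<theta>) - P (of_real (1 / real (Suc n)) * cis \<theta>)"
    if "\<theta> \<in> {\<theta>1..\<theta>2}" for \<theta> n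
    unfolding I_def
  proof (rule ray_FTC)
    have "1 / real (Suc n) \<le> 1" by simp
    also have "1 \<le> real (Suc n)" by simp
    finally show "1 / real (Suc n) \<le> real (Suc n)" .
    fix t assume "t \<in> {1 / real (Suc n)..real (Suc n)}"
    moreover have "1 / real (Suc n) > 0" by simp
    ultimately have "t > 0" using order_less_le_trans unfolding atLeastAtMost_iff by blast
    then show "(P has_field_derivative h (ray t \<theta>)) (at (ray t \<theta>))" using P that by blast
  qed
  have "cmod (I \<theta>2 n - I \<theta>1 n) \<le> a (real (Suc n)) + a (1 / real (Suc n))" for n
    using arc[of "real (Suc n)"] arc[of "1 / real (Suc n)"] assms(1)
      norm_triangle_ineq4[of "P (of_real (real (Suc n)) * cis \<theta>2) - P (of_real (real (Suc n)) * cis \<theta>1)"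
       "P (of_real (1 / real (Suc n)) * cis \<theta>2) - P (of_real (1 / real (Suc n)) * cis \<theta>1)"]
    unfolding a_def[symmetric] by (simp add: I algebra_simps)
  then have "(\<lambda>n. I \<theta>2 n - I \<theta>1 n) \<longlonglongrightarrow> 0"
    by (rule Lim_null_comparison[OF always_eventually[OF allI]]) (use tendsto_add[OF ends] in simp)
  moreover have "(\<lambda>n. I \<theta>2 n - I \<theta>1 n) \<longlonglongrightarrow>
      cis \<theta>2 * integral {0..} (\<lambda>t. h (of_real t * cis \<theta>2)) - cis \<theta>1 * integral {0..} (\<lambda>t. h (of_real t * cis \<theta>1))"
    using lim tame by (intro tendsto_diff)
  ultimately show ?thesis using LIMSEQ_unique by fastforce
qed

text \<open>The branch \<open>Ln (\<i> (\<lambda> + a) / (\<lambda> - 1))\<close> is analytic on the upper half-plane, and at both ends of a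
  ray it tends to points off the cut of \<open>Ln\<close>.\<close>
lemma ray_integral_log:
  assumes a: "a > 0" and nu: "0 < \<nu>" "\<nu> < pi"
    and tame: "tame (\<lambda>t. 1 / (ray t \<nu> + of_real a) - 1 / (ray t \<nu> - 1))"
  shows "cis \<nu> * integral {0..} (\<lambda>t. 1 / (ray t \<nu> + of_real a) - 1 / (ray t \<nu> - 1))
     = \<i> * pi - of_real (ln a)"
proof -
  define q where "q z = (z + of_real a) / (z - 1)" for z :: complex
  define P where "P z = Ln (\<i> * q z)" for z
  define h where "h z = 1 / (z + of_real a) - 1 / (z - 1)" for z :: complex
  have im: "Im (ray t \<nu>) > 0" if "t > 0" for t
    using that nu sin_gt_zero by simp
  have der: "(P has_field_derivative h z) (at z)" if z: "Im z > 0" for z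
  proof -
    have ne: "z - 1 \<noteq> 0" "z + of_real a \<noteq> 0" using z by (auto simp: complex_eq_iff)
    \<comment> \<open>The Moebius map \<open>q\<close> has negative determinant - (1 + a), so it
      sends the upper half-plane to the lower one; the factor \<open>\<i>\<close> then moves the
      values into the right half-plane, off the cut.\<close>
    have "Im (q z) = - ((1 + a) * Im z) / (cmod (z - 1))^2"
      unfolding q_def Im_divide cmod_power2 by (simp add: algebra_simps)
    then have "Re (\<i> * q z) = (1 + a) * Im z / (cmod (z - 1))^2" by simp
    moreover have "(cmod (z - 1))^2 > 0" using ne by simp
    ultimately have "Re (\<i> * q z) > 0" using z a by (metis add_pos_pos divide_pos_pos mult_pos_pos zero_less_one)
    then have nn: "\<i> * q z \<notin> \<real>\<^sub>\<le>\<^sub>0" by (auto simp: complex_nonpos_Reals_iff)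
    have dq: "(q has_field_derivative - of_real (1 + a) / (z - 1)^2) (at z)"
      unfolding q_def using ne by (auto intro!: derivative_eq_intros simp: power2_eq_square algebra_simps)
    have qz: "q z \<noteq> 0" using ne unfolding q_def by simp
    have "(P has_field_derivative (\<i> * (- of_real (1 + a) / (z - 1)^2)) / (\<i> * q z)) (at z)"
      unfolding P_def
      using DERIV_chain2[OF has_field_derivative_Ln[OF nn] DERIV_cmult[OF dq]] by (simp add: divide_inverse mult.commute)
    moreover have "(\<i> * (- of_real (1 + a) / (z - 1)^2)) / (\<i> * q z) = (- of_real (1 + a) / (z - 1)^2) / q z"
      using qz by simp
    moreover have "\<dots> = h z" unfolding q_def h_def using ne by (simp add: power2_eq_square divide_simps)
    ultimately show ?thesis by simp
  qed
  have c0: "cis \<nu> \<noteq> 0" by simp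
  have inf: "(\<lambda>n. P (of_real (real (Suc n)) * cis \<nu>)) \<longlonglongrightarrow> Ln \<i>"
  proof -
    have r0: "(\<lambda>n. of_real (inverse (real (Suc n))) :: complex) \<longlonglongrightarrow> of_real 0"
      by (rule tendsto_of_real[OF LIMSEQ_inverse_real_of_nat])
    have "(\<lambda>n. (cis \<nu> + of_real a * of_real (inverse (real (Suc n)))) / (cis \<nu> - of_real (inverse (real (Suc n)))))
       \<longlonglongrightarrow> (cis \<nu> + of_real a * of_real 0) / (cis \<nu> - of_real 0)"
      by (intro tendsto_divide tendsto_add tendsto_diff tendsto_mult tendsto_const r0) simp
    moreover have "(cis \<nu> + of_real a * of_real (inverse (real (Suc n)))) / (cis \<nu> - of_real (inverse (real (Suc n))))
       = q (of_real (real (Suc n)) * cis \<nu>)" for n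
    proof -
      have "of_real (real (Suc n)) * of_real (inverse (real (Suc n))) = (1 :: complex)"
        unfolding of_real_mult[symmetric] by simp
      then have "q (of_real (real (Suc n)) * cis \<nu>) =
         (of_real (real (Suc n)) * (cis \<nu> + of_real a * of_real (inverse (real (Suc n))))) /
         (of_real (real (Suc n)) * (cis \<nu> - of_real (inverse (real (Suc n)))))"
        unfolding q_def by (simp add: algebra_simps del: of_nat_Suc)
      then show ?thesis by (simp del: of_nat_Suc)
    qed
    ultimately have "(\<lambda>n. q (of_real (real (Suc n)) * cis \<nu>)) \<longlonglongrightarrow> 1" by simp
    then have "(\<lambda>n. Ln (\<i> * q (of_real (real (Suc n)) * cis \<nu>))) \<longlonglongrightarrow> Ln (\<i> * 1)"
      by (intro tendsto_Ln tendsto_mult tendsto_const) (auto simp: complex_nonpos_Reals_iff)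
    then show ?thesis unfolding P_def by simp
  qed
  have zero: "(\<lambda>n. P (of_real (1 / real (Suc n)) * cis \<nu>)) \<longlonglongrightarrow> Ln (- (\<i> * of_real a))"
  proof -
    have r0: "(\<lambda>n. of_real (1 / real (Suc n)) :: complex) \<longlonglongrightarrow> of_real 0"
      by (rule tendsto_of_real[OF LIMSEQ_inverse_real_of_nat[unfolded inverse_eq_divide]])
    have "(\<lambda>n. q (of_real (1 / real (Suc n)) * cis \<nu>)) \<longlonglongrightarrow> (of_real 0 * cis \<nu> + of_real a) / (of_real 0 * cis \<nu> - 1)"
      unfolding q_def by (intro tendsto_divide tendsto_add tendsto_diff tendsto_mult tendsto_const r0) simp
    then have "(\<lambda>n. Ln (\<i> * q (of_real (1 / real (Suc n)) * cis \<nu>))) \<longlonglongrightarrow> Ln (\<i> * (- of_real a))"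
      using a by (intro tendsto_Ln tendsto_mult tendsto_const) (auto simp: complex_nonpos_Reals_iff)
    then show ?thesis unfolding P_def by simp
  qed
  have FTC: "cis \<nu> * integral {1 / real (Suc n)..real (Suc n)} (\<lambda>t. h (ray t \<nu>)) =
      P (of_real (real (Suc n)) * cis \<nu>) - P (of_real (1 / real (Suc n)) * cis \<nu>)" for n
  proof (rule ray_FTC)
    have "1 / real (Suc n) \<le> 1" by simp
    also have "1 \<le> real (Suc n)" by simp
    finally show "1 / real (Suc n) \<le> real (Suc n)" .
    fix t assume "t \<in> {1 / real (Suc n)..real (Suc n)}"
    moreover have "1 / real (Suc n) > 0" by simp
    ultimately have "t > 0" using order_less_le_trans unfolding atLeastAtMost_iff by blast
    then show "(P has_field_derivative h (ray t \<nu>)) (at (ray t \<nu>))" using der im by blast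
  qed
  have "(\<lambda>n. cis \<nu> * integral {1 / real (Suc n)..real (Suc n)} (\<lambda>t. h (ray t \<nu>)))
     \<longlonglongrightarrow> Ln \<i> - Ln (- (\<i> * of_real a))"
    unfolding FTC using inf zero by (rule tendsto_diff)
  moreover have "(\<lambda>n. cis \<nu> * integral {1 / real (Suc n)..real (Suc n)} (\<lambda>t. h (ray t \<nu>)))
     \<longlonglongrightarrow> cis \<nu> * integral {0..} (\<lambda>t. h (ray t \<nu>))"
    using tame unfolding h_def by (intro tendsto_mult tendsto_const tame_truncation(2))
  ultimately have "cis \<nu> * integral {0..} (\<lambda>t. h (ray t \<nu>)) = Ln \<i> - Ln (- (\<i> * of_real a))"
    using LIMSEQ_unique by blast
  also have "Ln (- (\<i> * of_real a)) = of_real (ln a) - \<i> * pi / 2"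
    using Ln_times_of_real[OF a, of "- \<i>"] a by (simp add: Ln_of_real mult.commute)
  also have "Ln \<i> - (of_real (ln a) - \<i> * pi / 2) = \<i> * pi - of_real (ln a)" by simp
  finally show ?thesis unfolding h_def .
qed

text \<open>The two rays are conjugate, so the sum is minus a number plus its conjugate: the real
  part involving \<open>ln a\<close> cancels and the imaginary part doubles. The value comes from
  the residue of \<open>- 1 / (z - 1)\<close> at 1, the pole inside the sector, and is therefore the
  same for all \<open>a\<close>.\<close>

lemma boundary_integral_log:
  assumes a: "a > 0" and nu: "0 < \<nu>" "\<nu> < pi"
    and tame: "tame (\<lambda>t. 1 / (ray t \<nu> + of_real a) - 1 / (ray t \<nu> - 1))"
  shows "- cis \<nu> * integral {0..} (\<lambda>t. 1 / (ray t \<nu> + of_real a) - 1 / (ray t \<nu> - 1))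
    + cis (- \<nu>) * integral {0..} (\<lambda>t. 1 / (ray t (- \<nu>) + of_real a) - 1 / (ray t (- \<nu>) - 1))
     = - (2 * pi * \<i>)"
proof -
  define h where "h t = 1 / (ray t \<nu> + of_real a) - 1 / (ray t \<nu> - 1)" for t :: real
  have c: "1 / (ray t (- \<nu>) + of_real a) - 1 / (ray t (- \<nu>) - 1) = cnj (h t)" for t
    unfolding h_def by (simp add: cis_cnj)
  have "cis (- \<nu>) * integral {0..} (\<lambda>t. cnj (h t)) = cnj (cis \<nu> * integral {0..} h)"
    using tame_bounded_linear(2)[OF tame bounded_linear_cnj] unfolding h_def by (simp add: cis_cnj)
  then show ?thesis using ray_integral_log[OF assms] unfolding c h_def[symmetric] by simp
qed

section \<open>Scalar contour integrals over the boundary of a sector\<close>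

definition cbnd_int :: "real \<Rightarrow> (complex \<Rightarrow> complex) \<Rightarrow> complex" where
  "cbnd_int \<nu> g = - cis \<nu> * integral {0..} (\<lambda>t. g (ray t \<nu>))
     + cis (- \<nu>) * integral {0..} (\<lambda>t. g (ray t (- \<nu>)))"

definition tame2 :: "real \<Rightarrow> (complex \<Rightarrow> 'b::banach) \<Rightarrow> bool" where
  "tame2 \<nu> h \<longleftrightarrow> tame (\<lambda>t. h (ray t \<nu>)) \<and> tame (\<lambda>t. h (ray t (- \<nu>)))"

lemma tame2I:
  assumes "continuous_on S h" "\<And>t. t > 0 \<Longrightarrow> ray t \<nu> \<in> S \<and> ray t (- \<nu>) \<in> S"
    and "\<And>z. z \<in> S \<Longrightarrow> norm (h z) \<le> C / (1 + (cmod z)^2)"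
  shows "tame2 \<nu> h"
  unfolding tame2_def
proof (intro conjI tameI)
  fix t :: real assume t: "t > 0"
  then show "norm (h (ray t \<nu>)) \<le> C / (1 + t^2)" "norm (h (ray t (- \<nu>))) \<le> C / (1 + t^2)"
    using assms(3)[of "ray t \<nu>"] assms(3)[of "ray t (- \<nu>)"] assms(2)[OF t] by (simp_all add: norm_mult)
qed (use assms(2) in \<open>auto intro!: continuous_on_compose2[OF assms(1)] continuous_intros\<close>)

lemma tame_cong: "tame f \<longleftrightarrow> tame g" if "\<And>t. t > 0 \<Longrightarrow> f t = g t"
proof -
  have "continuous_on {0<..} f \<longleftrightarrow> continuous_on {0<..} g" using that by (intro continuous_on_cong) auto
  then show ?thesis using that unfolding tame_def by simp
qed

lemma tame2_cong:
  assumes "\<And>t. t > 0 \<Longrightarrow> f (ray t \<nu>) = g (ray t \<nu>)"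
    and "\<And>t. t > 0 \<Longrightarrow> f (ray t (- \<nu>)) = g (ray t (- \<nu>))"
  shows "tame2 \<nu> f \<longleftrightarrow> tame2 \<nu> g"
  unfolding tame2_def using tame_cong[of "\<lambda>t. f (ray t \<nu>)" "\<lambda>t. g (ray t \<nu>)"]
    tame_cong[of "\<lambda>t. f (ray t (- \<nu>))" "\<lambda>t. g (ray t (- \<nu>))"] assms by simp

lemma integral_cong_pos:
  fixes f g :: "real \<Rightarrow> 'b::banach"
  assumes "\<And>t. t > 0 \<Longrightarrow> f t = g t"
  shows "integral {0..} f = integral {0..} g"
  by (rule integral_spike[of "{0}"]) (use assms in auto)

lemma tame2_bounded_linear: "tame2 \<nu> h \<Longrightarrow> bounded_linear S \<Longrightarrow> tame2 \<nu> (\<lambda>z. S (h z))"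
  unfolding tame2_def using tame_bounded_linear(1) by auto

lemma tame2_add: "tame2 \<nu> h \<Longrightarrow> tame2 \<nu> k \<Longrightarrow> tame2 \<nu> (\<lambda>z. h z + k z)"
  unfolding tame2_def using tame_add by auto

lemma tame2_diff: "tame2 \<nu> h \<Longrightarrow> tame2 \<nu> k \<Longrightarrow> tame2 \<nu> (\<lambda>z. h z - k z)"
  using tame2_add[of \<nu> h "\<lambda>z. - k z"] tame2_bounded_linear[OF _ bounded_linear_minus[OF bounded_linear_ident], of \<nu> k] by simp

lemma cbnd_int_diff:
  assumes "tame2 \<nu> g" "tame2 \<nu> h"
  shows "cbnd_int \<nu> (\<lambda>z. g z - h z) = cbnd_int \<nu> g - cbnd_int \<nu> h"
proof -
  have g: "tame (\<lambda>t. g (ray t \<nu>))" "tame (\<lambda>t. g (ray t (- \<nu>)))"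
    and h: "tame (\<lambda>t. h (ray t \<nu>))" "tame (\<lambda>t. h (ray t (- \<nu>)))"
    using assms unfolding tame2_def by auto
  show ?thesis unfolding cbnd_int_def
      integral_diff[OF tame_integrable[OF g(1)] tame_integrable[OF h(1)]]
      integral_diff[OF tame_integrable[OF g(2)] tame_integrable[OF h(2)]]
    by (simp only: ring_distribs) (simp add: algebra_simps)
qed

lemma cbnd_int_mult: "cbnd_int \<nu> (\<lambda>z. c * g z) = c * cbnd_int \<nu> g"
  unfolding cbnd_int_def by (simp add: algebra_simps)

lemma cbnd_int_sector_zero:
  assumes hol: "g holomorphic_on sector s" and nu: "0 < \<nu>" "\<nu> < s" "s \<le> pi"
    and C: "\<And>z. z \<in> sector s \<Longrightarrow> cmod (g z) \<le> C / (1 + (cmod z)^2)"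
  shows "tame2 \<nu> g" "cbnd_int \<nu> g = 0"
proof -
  have ray: "ray t \<theta> \<in> sector s" if "t > 0" "\<theta> \<in> {-\<nu>..\<nu>}" for t \<theta>
    using that nu by (intro ray_in_sector) auto
  show t: "tame2 \<nu> g"
    using holomorphic_on_imp_continuous_on[OF hol] by (rule tame2I[OF _ _ C]) (use ray nu in auto)
  obtain P where P: "\<And>z. z \<in> sector s \<Longrightarrow> (P has_field_derivative g z) (at z)"
    using primitive_sector[OF _ _ hol] nu by auto
  have "cis (- \<nu>) * integral {0..} (\<lambda>t. g (ray t (- \<nu>))) = cis \<nu> * integral {0..} (\<lambda>t. g (ray t \<nu>))"
    using nu t unfolding tame2_def
    by (intro sector_Cauchy[of _ _ P g C] P ray) (use C[OF ray] in \<open>auto simp: norm_mult\<close>)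
  then show "cbnd_int \<nu> g = 0" unfolding cbnd_int_def by simp
qed

text \<open>Here the contour is closed on the outside: the upper ray is rotated to the angle
  \<open>2 * pi - \<nu>\<close> across the negative axis. Analyticity is asked on
  \<open>outer s\<close> with \<open>s < \<nu>\<close>, an open set containing both rays, the bound
  only in the closed region between them.\<close>

lemma cbnd_int_outer_zero:
  assumes hol: "g holomorphic_on outer s" and nu: "0 \<le> s" "s < \<nu>" "\<nu> < pi"
    and C: "\<And>z. z \<noteq> 0 \<Longrightarrow> Re z \<le> cos \<nu> * cmod z \<Longrightarrow> cmod (g z) \<le> C / (1 + (cmod z)^2)"
  shows "tame2 \<nu> g" "cbnd_int \<nu> g = 0"
proof -
  have ray: "ray t \<theta> \<in> outer s" if "t > 0" "\<theta> \<in> {\<nu>..2 * pi - \<nu>}" for t \<theta>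
    using that nu by (intro ray_in_outer) auto
  have cis: "cis (2 * pi - \<nu>) = cis (- \<nu>)" by (simp add: complex_eq_iff)
  have le: "cos \<theta> \<le> cos \<nu>" if "\<theta> \<in> {\<nu>..2 * pi - \<nu>}" for \<theta>
  proof (cases "\<theta> \<le> pi")
    case True
    then show ?thesis using cos_mono_le_eq[of \<theta> \<nu>] nu that by auto
  next
    case False
    have "cos (2 * pi - \<theta>) \<le> cos \<nu>" using cos_mono_le_eq[of "2 * pi - \<theta>" \<nu>] nu that False by auto
    then show ?thesis by simp
  qed
  have bd: "cmod (g (ray t \<theta>)) \<le> C / (1 + t^2)" if "t > 0" "\<theta> \<in> {\<nu>..2 * pi - \<nu>}" for t \<theta>
    using C[of "ray t \<theta>"] that le[OF that(2)] by (simp add: norm_mult mult.commute)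
  have tm: "tame (\<lambda>t. g (ray t \<theta>))" if th: "\<theta> \<in> {\<nu>..2 * pi - \<nu>}" for \<theta>
    using ray[OF _ th] bd[OF _ th]
    by (intro tameI) (auto intro!: continuous_on_compose2[OF holomorphic_on_imp_continuous_on[OF hol]] continuous_intros)
  show t: "tame2 \<nu> g"
    using tm[of \<nu>] tm[of "2 * pi - \<nu>"] nu unfolding tame2_def cis by simp
  obtain P where P: "\<And>z. z \<in> outer s \<Longrightarrow> (P has_field_derivative g z) (at z)"
    using primitive_outer[OF _ _ hol] nu by auto
  have "cis \<nu> * integral {0..} (\<lambda>t. g (ray t \<nu>)) = cis (2 * pi - \<nu>) * integral {0..} (\<lambda>t. g (of_real t * cis (2 * pi - \<nu>)))"
    using nu t cis bd unfolding tame2_def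
    by (intro sector_Cauchy[of _ _ P g C] P ray) auto
  then show "cbnd_int \<nu> g = 0" unfolding cbnd_int_def cis by simp
qed

lemma cmod_outer_diff_ge:
  assumes "0 < \<nu>" "\<nu> < pi" "Re z \<le> cos \<nu> * cmod z" "a \<ge> 0"
  shows "sqrt ((1 - cos \<nu>) / 2) * (cmod z + a) \<le> cmod (z - of_real a)"
  using cmod_add_of_real_ge[of "- cos \<nu>" "- z" a] assms by (simp add: norm_minus_commute)

text \<open>From \<open>(r + a) * (r + b) \<ge> a * b + r^2\<close>. The constant grows when
  \<open>a * b\<close> tends to 0, so estimates uniform in the scale have to go another way
  (\<open>norm_ocalc_dyadic\<close>).\<close>

lemma kernel_bound:
  assumes "a > 0" "b > 0" "r \<ge> (0::real)"
  shows "1 / ((r + a) * (r + b)) \<le> (1 + 1 / (a * b)) / (1 + r^2)"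
proof -
  have "0 < (r + a) * (r + b)" using assms by simp
  moreover have "1 + r^2 \<le> (1 + 1 / (a * b)) * ((r + a) * (r + b))"
  proof -
    have "a * b + r^2 \<le> (r + a) * (r + b)" using assms by (simp add: power2_eq_square algebra_simps)
    then have "(1 + 1 / (a * b)) * (a * b + r^2) \<le> (1 + 1 / (a * b)) * ((r + a) * (r + b))"
      using assms by (intro mult_left_mono) auto
    moreover have "(1 + 1 / (a * b)) * (a * b + r^2) = a * b + r^2 + 1 + r^2 / (a * b)" using assms by (simp add: field_simps)
    moreover have "0 \<le> a * b + r^2 / (a * b)" using assms by simp
    ultimately show ?thesis by linarith
  qed
  moreover have "1 + r^2 > 0" by (simp add: add_pos_nonneg)
  ultimately show ?thesis by (simp add: field_simps)
qed

text \<open>A single kernel \<open>1 / (z + a)\<close> decays only to first order at infinity.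
  Subtracting the pole at 1, on the other side of the contour, produces the product of the two
  denominators and hence an integrable majorant.\<close>

lemma tame2_log_kernel:
  assumes a: "a > 0" and nu: "0 < \<nu>" "\<nu> < pi"
  shows "tame2 \<nu> (\<lambda>z. 1 / (z + of_real a) - 1 / (z - 1))"
proof -
  define S where "S = {z. z \<noteq> 0 \<and> Re z = cos \<nu> * cmod z}"
  define k1 where "k1 = sqrt ((1 + cos \<nu>) / 2)"
  define k2 where "k2 = sqrt ((1 - cos \<nu>) / 2)"
  have k: "k1 > 0" "k2 > 0" using cos_mono_less_eq[of pi \<nu>] cos_mono_less_eq[of \<nu> 0] nu by (auto simp: k1_def k2_def)
  have b1: "k1 * (cmod z + a) \<le> cmod (z + of_real a)" and b2: "k2 * (cmod z + 1) \<le> cmod (z - 1)" if "z \<in> S" for z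
    using cmod_add_of_real_ge[of "cos \<nu>" z a] cmod_outer_diff_ge[of \<nu> z 1] that nu a by (auto simp: S_def k1_def k2_def)
  have pos: "0 < k1 * (cmod z + a)" "0 < k2 * (cmod z + 1)" for z
    using k a norm_ge_zero[of z] by (auto intro!: mult_pos_pos add_nonneg_pos)
  have ne: "z + of_real a \<noteq> 0" "z - 1 \<noteq> 0" if "z \<in> S" for z
    using order_less_le_trans[OF pos(1) b1[OF that]] order_less_le_trans[OF pos(2) b2[OF that]] by auto
  show ?thesis
  proof (rule tame2I[of S _ _ "(1 + a) / (k1 * k2) * (1 + 1 / (a * 1))"])
    show "continuous_on S (\<lambda>z. 1 / (z + of_real a) - 1 / (z - 1))" using ne by (intro continuous_intros) auto
    show "ray t \<nu> \<in> S \<and> ray t (- \<nu>) \<in> S" if "t > 0" for t using that by (simp add: S_def norm_mult)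
    fix z assume z: "z \<in> S"
    have "1 / (z + of_real a) - 1 / (z - 1) = - of_real (1 + a) / ((z + of_real a) * (z - 1))"
      using ne[OF z] by (simp add: field_simps)
    then have "cmod (1 / (z + of_real a) - 1 / (z - 1)) = (1 + a) / (cmod (z + of_real a) * cmod (z - 1))"
      using a by (simp add: norm_divide norm_mult del: of_real_add)
    also have "\<dots> \<le> (1 + a) / ((k1 * (cmod z + a)) * (k2 * (cmod z + 1)))"
      using b1[OF z] b2[OF z] less_imp_le[OF pos(1)] less_imp_le[OF pos(2)] a ne[OF z]
        mult_pos_pos[OF pos[of z]]
      by (intro divide_left_mono mult_mono) (auto intro!: mult_pos_pos)
    also have "\<dots> = (1 + a) / (k1 * k2) * (1 / ((cmod z + a) * (cmod z + 1)))" by simp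
    also have "\<dots> \<le> (1 + a) / (k1 * k2) * ((1 + 1 / (a * 1)) / (1 + (cmod z)^2))"
      using k a by (intro mult_left_mono kernel_bound) auto
    finally show "cmod (1 / (z + of_real a) - 1 / (z - 1)) \<le> (1 + a) / (k1 * k2) * (1 + 1 / (a * 1)) / (1 + (cmod z)^2)" by simp
  qed
qed

lemma cbnd_int_log_kernel:
  assumes "a > 0" "0 < \<nu>" "\<nu> < pi"
  shows "cbnd_int \<nu> (\<lambda>z. 1 / (z + of_real a) - 1 / (z - 1)) = - (2 * pi * \<i>)"
  unfolding cbnd_int_def using boundary_integral_log[OF assms] tame2_log_kernel[OF assms] unfolding tame2_def by blast

section \<open>Vector-valued contour integrals\<close>

context complex_structure
begin

lemma tame2_scale: "tame2 \<nu> h \<Longrightarrow> tame2 \<nu> (\<lambda>z. c \<odot> h z)"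
  by (rule tame2_bounded_linear[OF _ bounded_linear_scale])

lemma bnd_int_split:
  assumes "tame2 \<nu> h"
  shows "bnd_int J \<nu> h = (- cis \<nu>) \<odot> integral {0..} (\<lambda>t. h (ray t \<nu>))
     + cis (- \<nu>) \<odot> integral {0..} (\<lambda>t. h (ray t (- \<nu>)))"
proof -
  have "tame (\<lambda>t. h (ray t \<nu>))" "tame (\<lambda>t. h (ray t (- \<nu>)))"
    using assms unfolding tame2_def by auto
  note * = tame_bounded_linear[OF this(1) bounded_linear_scale, of "- cis \<nu>"]
    tame_bounded_linear[OF this(2) bounded_linear_scale, of "cis (- \<nu>)"]
  show ?thesis unfolding bnd_int_def
    using integral_add[OF tame_integrable[OF *(1)] tame_integrable[OF *(3)]] *(2,4) by simp
qed

lemma bnd_int_cong: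
  assumes "\<And>t. t > 0 \<Longrightarrow> f (ray t \<nu>) = g (ray t \<nu>)"
    and "\<And>t. t > 0 \<Longrightarrow> f (ray t (- \<nu>)) = g (ray t (- \<nu>))"
  shows "bnd_int J \<nu> f = bnd_int J \<nu> g"
  unfolding bnd_int_def using assms by (intro integral_cong_pos) simp

lemma cfun_bnd_int:
  assumes "cfun q" "tame2 \<nu> h"
  shows "q (bnd_int J \<nu> h) = cbnd_int \<nu> (\<lambda>z. q (h z))"
proof -
  have q: "bounded_linear q" using assms(1) unfolding cfun_def by blast
  show ?thesis
    using assms(2) unfolding bnd_int_split[OF assms(2)] cbnd_int_def tame2_def
    by (simp add: linear_add[OF bounded_linear.linear[OF q]] cfun_scale[OF assms(1)] tame_bounded_linear(2)[OF _ q])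
qed

lemma clinear_bnd_int:
  assumes "clinear S" "tame2 \<nu> h"
  shows "S (bnd_int J \<nu> h) = bnd_int J \<nu> (\<lambda>z. S (h z))"
proof -
  have S: "bounded_linear S" "\<And>c x. S (c \<odot> x) = c \<odot> S x" using assms(1) unfolding clinear_def by auto
  show ?thesis
    using assms(2) unfolding bnd_int_split[OF assms(2)] bnd_int_split[OF tame2_bounded_linear[OF assms(2) S(1)]] tame2_def
    by (simp add: linear_add[OF bounded_linear.linear[OF S(1)]] S(2) tame_bounded_linear(2)[OF _ S(1)])
qed

lemma clinear_scale: "clinear (cscale J c)"
  unfolding clinear_def using bounded_linear_scale by (simp add: scale_scale mult.commute)

lemma bnd_int_add:
  assumes "tame2 \<nu> f" "tame2 \<nu> g"
  shows "bnd_int J \<nu> (\<lambda>z. f z + g z) = bnd_int J \<nu> f + bnd_int J \<nu> g"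
proof -
  have f: "tame (\<lambda>t. f (ray t \<nu>))" "tame (\<lambda>t. f (ray t (- \<nu>)))"
    and g: "tame (\<lambda>t. g (ray t \<nu>))" "tame (\<lambda>t. g (ray t (- \<nu>)))"
    using assms unfolding tame2_def by auto
  show ?thesis unfolding bnd_int_split[OF assms(1)] bnd_int_split[OF assms(2)]
      bnd_int_split[OF tame2_add[OF assms]]
      integral_add[OF tame_integrable[OF f(1)] tame_integrable[OF g(1)]]
      integral_add[OF tame_integrable[OF f(2)] tame_integrable[OF g(2)]]
    by (simp add: scale_add_right)
qed

lemma norm_bnd_int_le:
  assumes "tame2 \<nu> h" "\<And>t. t > 0 \<Longrightarrow> norm (h (ray t \<nu>)) \<le> C / (1 + t^2)"
    "\<And>t. t > 0 \<Longrightarrow> norm (h (ray t (- \<nu>))) \<le> C / (1 + t^2)"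
  shows "norm (bnd_int J \<nu> h) \<le> C * pi"
proof -
  have "norm (integral {0..} (\<lambda>t. h (ray t \<nu>))) \<le> C * (pi / 2)"
    "norm (integral {0..} (\<lambda>t. h (ray t (- \<nu>)))) \<le> C * (pi / 2)"
    using assms(1) tame_norm_integral[OF _ assms(2)] tame_norm_integral[OF _ assms(3)] unfolding tame2_def by blast+
  then show ?thesis unfolding bnd_int_split[OF assms(1)] by (intro norm_triangle_le) simp
qed

end

section \<open>Resolvents and the elementary functional calculus\<close>

context complex_structure
begin

text \<open>Symbols of a vector-valued calculus. First-order decay at 0 and at infinity is what the
  factors \<open>phi n\<close> and \<open>wfun a b\<close> provide, and together with the 1/|l|
  bound of the resolvent it yields \<open>tame\<close> integrands. Analyticity is asked weakly,
  being used after application of a functional; norm continuity serves integrability.\<close>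

definition decaying :: "real \<Rightarrow> (complex \<Rightarrow> 'a) \<Rightarrow> bool" where
  "decaying s h \<longleftrightarrow> continuous_on (sector s) h \<and> (\<forall>q. cfun q \<longrightarrow> (\<lambda>z. q (h z)) holomorphic_on sector s)
     \<and> (\<exists>C\<ge>0. \<forall>z\<in>sector s. norm (h z) \<le> C * cmod z / (1 + (cmod z)^2))"

lemma decayingI:
  assumes "continuous_on (sector s) h" "\<And>q. cfun q \<Longrightarrow> (\<lambda>z. q (h z)) holomorphic_on sector s"
    and "\<And>z. z \<in> sector s \<Longrightarrow> norm (h z) \<le> C * cmod z / (1 + (cmod z)^2)" "C \<ge> 0"
  shows "decaying s h"
  unfolding decaying_def using assms by (intro conjI allI impI exI[of _ C] ballI)

lemma decaying_bound:
  assumes "decaying s h"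
  obtains C where "C \<ge> 0" "\<And>z. z \<in> sector s \<Longrightarrow> norm (h z) \<le> C * cmod z / (1 + (cmod z)^2)"
proof -
  have "\<exists>C\<ge>0. \<forall>z\<in>sector s. norm (h z) \<le> C * cmod z / (1 + (cmod z)^2)"
    using assms unfolding decaying_def by (elim conjE)
  then obtain C where "C \<ge> 0" "\<forall>z\<in>sector s. norm (h z) \<le> C * cmod z / (1 + (cmod z)^2)" by blast
  then show thesis by (intro that[of C]) auto
qed

lemma decaying_continuous: "decaying s h \<Longrightarrow> continuous_on (sector s) h"
  and decaying_holomorphic: "decaying s h \<Longrightarrow> cfun q \<Longrightarrow> (\<lambda>z. q (h z)) holomorphic_on sector s"
  unfolding decaying_def by auto

lemma decaying_mult:
  assumes h: "decaying s h" and g: "g holomorphic_on sector s" "\<And>z. z \<in> sector s \<Longrightarrow> cmod (g z) \<le> K"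
  shows "decaying s (\<lambda>z. g z \<odot> h z)"
proof -
  obtain C where C: "C \<ge> 0" "\<And>z. z \<in> sector s \<Longrightarrow> norm (h z) \<le> C * cmod z / (1 + (cmod z)^2)"
    using decaying_bound[OF h] by metis
  show ?thesis
  proof (rule decayingI[of _ _ "max K 0 * C"])
    show "continuous_on (sector s) (\<lambda>z. g z \<odot> h z)"
      using h holomorphic_on_imp_continuous_on[OF g(1)] unfolding decaying_def by (intro continuous_on_scale) auto
    show "(\<lambda>z. q (g z \<odot> h z)) holomorphic_on sector s" if "cfun q" for q
      using h that g(1) unfolding decaying_def cfun_scale[OF that] by (intro holomorphic_on_mult) auto
    fix z assume z: "z \<in> sector s"
    have "norm (g z \<odot> h z) \<le> max K 0 * (C * cmod z / (1 + (cmod z)^2))"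
      unfolding norm_scale using g(2)[OF z] C(2)[OF z] by (intro mult_mono) auto
    then show "norm (g z \<odot> h z) \<le> max K 0 * C * cmod z / (1 + (cmod z)^2)" by simp
  qed (use C in simp)
qed

lemma clinear_bounded_linear: "clinear S \<Longrightarrow> bounded_linear S"
  and clinear_apply_scale: "clinear S \<Longrightarrow> S (c \<odot> x) = c \<odot> S x"
  unfolding clinear_def by auto

lemma cfun_bounded_linear: "cfun q \<Longrightarrow> bounded_linear q"
  unfolding cfun_def by auto

lemma cfun_bound:
  assumes "cfun q"
  shows "\<exists>K\<ge>0. \<forall>x. cmod (q x) \<le> K * norm x"
  using bounded_linear.nonneg_bounded[OF cfun_bounded_linear[OF assms]] by (simp add: mult.commute)

lemma cfun_add: "q (x + y) = q x + q y"
  and cfun_diff: "q (x - y) = q x - q y"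
  and cfun_sum: "q (sum f I) = (\<Sum>i\<in>I. q (f i))" if "cfun q"
  using linear_add[of q] linear_diff[of q] linear_sum[of q] bounded_linear.linear[OF cfun_bounded_linear[OF that]] by auto

lemma clinear_add: "S (x + y) = S x + S y"
  and clinear_diff: "S (x - y) = S x - S y"
  and clinear_minus: "S (- x) = - S x" if "clinear S"
  using linear_add[of S] linear_diff[of S] linear_neg[of S]
    bounded_linear.linear[OF clinear_bounded_linear[OF that]] by auto

lemma decaying_add:
  assumes g: "decaying s g" and h: "decaying s h"
  shows "decaying s (\<lambda>z. g z + h z)"
proof -
  obtain C where C: "C \<ge> 0" "\<And>z. z \<in> sector s \<Longrightarrow> norm (g z) \<le> C * cmod z / (1 + (cmod z)^2)"
    using decaying_bound[OF g] by metis
  obtain E where E: "E \<ge> 0" "\<And>z. z \<in> sector s \<Longrightarrow> norm (h z) \<le> E * cmod z / (1 + (cmod z)^2)"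
    using decaying_bound[OF h] by metis
  show ?thesis
  proof (rule decayingI[of _ _ "C + E"])
    show "continuous_on (sector s) (\<lambda>z. g z + h z)"
      using decaying_continuous[OF g] decaying_continuous[OF h] by (rule continuous_on_add)
    show "(\<lambda>z. q (g z + h z)) holomorphic_on sector s" if "cfun q" for q
      unfolding cfun_add[OF that] using decaying_holomorphic[OF g that] decaying_holomorphic[OF h that] by (rule holomorphic_on_add)
    fix z assume z: "z \<in> sector s"
    show "norm (g z + h z) \<le> (C + E) * cmod z / (1 + (cmod z)^2)"
      using C(2)[OF z] E(2)[OF z] norm_triangle_ineq[of "g z" "h z"] by (simp add: add_divide_distrib distrib_right)
  qed (use C E in simp)
qed

lemma decaying_zero: "decaying s (\<lambda>z. 0)"
  by (rule decayingI[of _ _ 0]) (auto simp: cfun_scale[of _ 0 0, simplified])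

end

section \<open>Sectorial operators and their resolvents\<close>

lemma sectorial_type_omega:
  assumes "sectorial J D A" "omega J D A < s"
  shows "\<exists>w<s. sectorial_type J D A w"
proof -
  have "{w. sectorial_type J D A w} \<noteq> {}" using assms(1) unfolding sectorial_def by auto
  then show ?thesis using cInf_lessD[of "{w. sectorial_type J D A w}" s] assms(2) unfolding omega_def by auto
qed

lemma omega_bounds:
  assumes "sectorial J D A"
  shows "0 \<le> omega J D A" "omega J D A < pi"
proof -
  obtain w where w: "sectorial_type J D A w" using assms unfolding sectorial_def by blast
  have bdd: "bdd_below {w. sectorial_type J D A w}" unfolding sectorial_type_def by (intro bdd_belowI[of _ 0]) auto
  show "0 \<le> omega J D A" unfolding omega_def
  proof (rule cInf_greatest)
    show "{w. sectorial_type J D A w} \<noteq> {}" using w by blast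
  qed (simp add: sectorial_type_def)
  have "omega J D A \<le> w" unfolding omega_def using w bdd by (intro cInf_lower) auto
  then show "omega J D A < pi" using w unfolding sectorial_type_def by simp
qed

locale sectorial_op = complex_structure J for J :: "'a::banach \<Rightarrow> 'a" +
  fixes D :: "'a set" and A :: "'a \<Rightarrow> 'a"
  assumes sectorial: "sectorial J D A"
begin

abbreviation R where "R \<equiv> res J D A"
abbreviation om where "om \<equiv> omega J D A"

lemmas om = omega_bounds[OF sectorial]

lemma lin_op: "lin_op J D A"
  and dense_domain: "closure D = UNIV" and dense_range: "closure (A ` D) = UNIV"
  using sectorial unfolding sectorial_def sectorial_type_def by auto

lemma is_resolvent_unique:
  assumes "is_resolvent J D A l S" "is_resolvent J D A l T"
  shows "S = T"
proof
  fix x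
  have "T (l \<odot> S x - A (S x)) = S x" using assms unfolding is_resolvent_def by blast
  then show "S x = T x" using assms(1) unfolding is_resolvent_def by metis
qed

lemma mem_outer: "l \<in> outer om \<longleftrightarrow> l \<noteq> 0 \<and> om < \<bar>Arg l\<bar>"
  using mem_outer_iff om by simp

lemma is_resolvent:
  assumes "l \<in> outer om"
  shows "is_resolvent J D A l (R l)"
proof -
  obtain w where "w < \<bar>Arg l\<bar>" "sectorial_type J D A w"
    using sectorial_type_omega[OF sectorial] assms unfolding mem_outer by blast
  then obtain S where S: "is_resolvent J D A l S" using assms unfolding mem_outer sectorial_type_def by blast
  then have "R l = S" unfolding res_def by (intro the_equality) (auto intro: is_resolvent_unique)
  then show ?thesis using S by simp
qed

lemma R_domain: "l \<in> outer om \<Longrightarrow> R l x \<in> D"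
  and R_right: "l \<in> outer om \<Longrightarrow> l \<odot> R l x - A (R l x) = x"
  and R_left: "l \<in> outer om \<Longrightarrow> y \<in> D \<Longrightarrow> R l (l \<odot> y - A y) = y"
  and R_bounded_linear: "l \<in> outer om \<Longrightarrow> bounded_linear (R l)"
  using is_resolvent unfolding is_resolvent_def by auto

lemma A_add: "x \<in> D \<Longrightarrow> y \<in> D \<Longrightarrow> A (x + y) = A x + A y"
  and D_add: "x \<in> D \<Longrightarrow> y \<in> D \<Longrightarrow> x + y \<in> D"
  and A_scale: "x \<in> D \<Longrightarrow> A (c \<odot> x) = c \<odot> A x"
  and D_scale: "x \<in> D \<Longrightarrow> c \<odot> x \<in> D"
  using lin_op unfolding lin_op_def by auto

lemma A_diff: "x \<in> D \<Longrightarrow> y \<in> D \<Longrightarrow> A (x - y) = A x - A y"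
  and D_diff: "x \<in> D \<Longrightarrow> y \<in> D \<Longrightarrow> x - y \<in> D"
  using A_add[of x "(-1) \<odot> y"] D_add[of x "(-1) \<odot> y"] A_scale[of y "-1"] D_scale[of y "-1"]
  by (simp_all add: scale_minus_left)

lemma R_clinear: "clinear (R l)" if l: "l \<in> outer om"
  unfolding clinear_def
proof (intro conjI allI)
  fix c x
  have "R l (l \<odot> (c \<odot> R l x) - A (c \<odot> R l x)) = c \<odot> R l x"
    using R_left[OF l D_scale[OF R_domain[OF l]]] .
  moreover have "l \<odot> (c \<odot> R l x) - A (c \<odot> R l x) = c \<odot> (l \<odot> R l x - A (R l x))"
    by (simp add: A_scale[OF R_domain[OF l]] scale_diff_right scale_scale mult.commute)
  ultimately show "R l (c \<odot> x) = c \<odot> R l x" using R_right[OF l] by simp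
qed (rule R_bounded_linear[OF l])

lemma resolvent_identity:
  assumes l: "l \<in> outer om" and m: "m \<in> outer om"
  shows "R m x = R l x + (l - m) \<odot> R l (R m x)"
proof -
  have "R m x = R l (l \<odot> R m x - A (R m x))" using R_left[OF l R_domain[OF m]] by simp
  also have "l \<odot> R m x - A (R m x) = x + (l - m) \<odot> R m x"
    using R_right[OF m, of x] by (simp add: scale_diff_left algebra_simps)
  also have "R l (x + (l - m) \<odot> R m x) = R l x + (l - m) \<odot> R l (R m x)"
    unfolding clinear_add[OF R_clinear[OF l]] clinear_apply_scale[OF R_clinear[OF l]] ..
  finally show ?thesis .
qed

lemma R_commute:
  assumes l: "l \<in> outer om" and m: "m \<in> outer om"
  shows "R l (R m x) = R m (R l x)"
proof (cases "l = m")
  case False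
  have "(l - m) \<odot> R l (R m x) = R m x - R l x"
    using resolvent_identity[OF l m, of x] by (metis add_diff_cancel_left')
  also have "\<dots> = - ((m - l) \<odot> R m (R l x))"
    using resolvent_identity[OF m l, of x] by (metis add_diff_cancel_left' minus_diff_eq)
  also have "\<dots> = (l - m) \<odot> R m (R l x)" by (simp add: scale_minus_left[symmetric])
  finally have "inverse (l - m) \<odot> (l - m) \<odot> R l (R m x) = inverse (l - m) \<odot> (l - m) \<odot> R m (R l x)" by simp
  then show ?thesis using False by (simp add: scale_scale)
qed simp

lemma in_outer:
  assumes "om < s" "s < pi" "l \<noteq> 0" "Re l \<le> cos s * cmod l"
  shows "l \<in> outer om"
proof -
  have "cos s < cos om" using cos_mono_less_eq[of s om] assms om by auto
  then have "cos s * cmod l < cos om * cmod l" using assms by (intro mult_strict_right_mono) auto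
  then have "Re l < cos om * cmod l" using assms(4) by linarith
  then show ?thesis by (simp add: outer_def cone_def)
qed

text \<open>\<open>omega\<close> is an infimum that need not be attained, so a bound is available at
  angles strictly above it; every such angle exceeds some admissible type.\<close>

lemma R_bound:
  assumes s: "om < s" "s < pi"
  obtains M where "M \<ge> 0" "\<And>l x. l \<noteq> 0 \<Longrightarrow> Re l \<le> cos s * cmod l \<Longrightarrow> norm (R l x) \<le> M * norm x / cmod l"
proof -
  obtain w where w: "w < s" "sectorial_type J D A w" using sectorial_type_omega[OF sectorial s(1)] by blast
  have "\<forall>s. w < s \<and> s < pi \<longrightarrow>
      (\<exists>M. \<forall>l x. l \<noteq> 0 \<and> \<bar>Arg l\<bar> \<ge> s \<longrightarrow> norm (l \<odot> R l x) \<le> M * norm x)"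
    using w(2) unfolding sectorial_type_def by (elim conjE)
  then obtain M where M: "\<And>l x. l \<noteq> 0 \<Longrightarrow> \<bar>Arg l\<bar> \<ge> s \<Longrightarrow> norm (l \<odot> R l x) \<le> M * norm x"
    using w(1) s(2) by metis
  have "norm (R l x) \<le> max M 0 * norm x / cmod l" if l: "l \<noteq> 0" "Re l \<le> cos s * cmod l" for l x
  proof -
    have "l \<notin> sector s" using sector_eq_cone[of s] s om l by (auto simp: cone_def)
    then have "cmod l * norm (R l x) \<le> M * norm x" using M[of l x] l by (auto simp: sector_def)
    also have "\<dots> \<le> max M 0 * norm x" by (intro mult_right_mono) auto
    finally show ?thesis using l by (simp add: field_simps)
  qed
  then show ?thesis by (intro that[of "max M 0"]) simp_all
qed

lemma neg_in_outer: "a > 0 \<Longrightarrow> - of_real a \<in> outer om"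
  using om cos_mono_less_eq[of pi om] mult_strict_right_mono[of "-1" "cos om" a] by (auto simp: outer_def cone_def)

lemma ray_outer:
  assumes "om < \<nu>" "\<nu> < pi" "t > 0"
  shows "ray t \<nu> \<in> outer om" "ray t (- \<nu>) \<in> outer om"
    "Re (ray t \<nu>) \<le> cos \<nu> * cmod (ray t \<nu>)"
    "Re (ray t (- \<nu>)) \<le> cos \<nu> * cmod (ray t (- \<nu>))"
proof -
  show le: "Re (ray t \<nu>) \<le> cos \<nu> * cmod (ray t \<nu>)"
    "Re (ray t (- \<nu>)) \<le> cos \<nu> * cmod (ray t (- \<nu>))"
    using assms(3) by (simp_all add: norm_mult)
  show "ray t \<nu> \<in> outer om" "ray t (- \<nu>) \<in> outer om"
    using in_outer[OF assms(1,2) _ le(1)] in_outer[OF assms(1,2) _ le(2)] assms(3) by simp_all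
qed

lemma R_tendsto:
  assumes m: "m \<in> outer om"
  shows "((\<lambda>l. R l x) \<longlongrightarrow> R m x) (at m)"
proof -
  \<comment> \<open>An angle strictly between \<open>om\<close> and that of \<open>m\<close>: the
    resolvent bound then holds throughout a neighbourhood of \<open>m\<close>.\<close>
  obtain s where s: "om < s" "s < \<bar>Arg m\<bar>" using m dense unfolding mem_outer by blast
  have s0: "0 \<le> s" "s < pi" using s om Arg_bounded[of m] by auto
  obtain M where M: "M \<ge> 0" "\<And>l x. l \<noteq> 0 \<Longrightarrow> Re l \<le> cos s * cmod l \<Longrightarrow> norm (R l x) \<le> M * norm x / cmod l"
    using R_bound[OF s(1) s0(2)] by metis
  have ms: "m \<in> outer s" using mem_outer_iff[of s m] s s0 m mem_outer by auto
  have ev: "\<forall>\<^sub>F l in at m. l \<in> outer s"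
    using open_outer ms by (metis eventually_at_topological)
  have "\<forall>\<^sub>F l in at m. norm (R l x - R m x) \<le> cmod (m - l) * (M * norm (R m x) / cmod l)"
    using ev
  proof (eventually_elim)
    case (elim l)
    then have l: "l \<noteq> 0" "Re l \<le> cos s * cmod l" by (auto simp: outer_def cone_def)
    have "R m x = R l x + (l - m) \<odot> R l (R m x)"
      by (rule resolvent_identity[OF in_outer[OF s(1) s0(2) l] m])
    then have "R l x - R m x = - ((l - m) \<odot> R l (R m x))" by (metis add_diff_cancel_left' minus_diff_eq)
    then have "R l x - R m x = (m - l) \<odot> R l (R m x)" by (simp add: scale_minus_left[symmetric])
    then have "norm (R l x - R m x) = cmod (m - l) * norm (R l (R m x))" by simp
    also have "\<dots> \<le> cmod (m - l) * (M * norm (R m x) / cmod l)" by (intro mult_left_mono M(2)[OF l]) simp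
    finally show ?case .
  qed
  moreover have "((\<lambda>l. cmod (m - l) * (M * norm (R m x) / cmod l)) \<longlongrightarrow> cmod (m - m) * (M * norm (R m x) / cmod m)) (at m)"
    using m mem_outer by (intro tendsto_intros) auto
  ultimately have "((\<lambda>l. R l x - R m x) \<longlongrightarrow> 0) (at m)" by (elim Lim_null_comparison) simp
  then show ?thesis by (rule LIM_zero_cancel)
qed

lemma R_continuous: "continuous_on (outer om) (\<lambda>l. R l x)"
  using R_tendsto by (intro continuous_at_imp_continuous_on) (auto simp: continuous_at)

text \<open>By the resolvent identity the difference quotient equals
  \<open>- q (R l (R m x))\<close> exactly, so differentiability reduces to strong continuity of the
  resolvent.\<close>

lemma R_holomorphic: "(\<lambda>l. q (R l x)) holomorphic_on outer om" if q: "cfun q"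
proof -
  have "((\<lambda>l. q (R l x)) has_field_derivative - q (R m (R m x))) (at m)" if m: "m \<in> outer om" for m
  proof -
    have lim: "((\<lambda>l. - q (R l (R m x))) \<longlongrightarrow> - q (R m (R m x))) (at m)"
      using tendsto_minus[OF bounded_linear.tendsto[of q, OF _ R_tendsto[OF m]]] q unfolding cfun_def by blast
    have "\<forall>\<^sub>F l in at m. (q (R l x) - q (R m x)) / (l - m) = - q (R l (R m x))"
    proof -
      have "\<forall>\<^sub>F l in at m. l \<in> outer om" using open_outer m by (metis eventually_at_topological)
      moreover have "\<forall>\<^sub>F l in at m. l \<noteq> m" by (simp add: eventually_at_filter)
      ultimately show ?thesis
      proof eventually_elim
        case (elim l)
        have "q (R m x) = q (R l x) + (l - m) * q (R l (R m x))"
          using resolvent_identity[OF elim(1) m, of x] cfun_add[OF q] cfun_scale[OF q] by metis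
        then show ?case using elim by (simp add: field_simps)
      qed
    qed
    then show ?thesis unfolding has_field_derivative_iff using lim
      by (subst tendsto_cong) auto
  qed
  then show ?thesis using open_outer holomorphic_on_open by blast
qed

text \<open>The value \<open>h l\<close> is a vector: \<open>h l = g l \<odot> x\<close> gives g(A)
  x, and \<open>h l = G l x\<close> gives an operator-valued symbol applied to \<open>x\<close>. One
  calculus thus also serves symbols that are themselves functions of a second operator.\<close>

definition ocalc :: "real \<Rightarrow> (complex \<Rightarrow> 'a) \<Rightarrow> 'a" where
  "ocalc \<nu> h = (1 / (2 * pi * \<i>)) \<odot> bnd_int J \<nu> (\<lambda>l. R l (h l))"

lemma tame_ray_R:
  assumes nu: "om < \<nu>" "\<nu> < pi" and th: "\<theta> = \<nu> \<or> \<theta> = - \<nu>"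
    and cont: "continuous_on {0<..} (\<lambda>t. h (ray t \<theta>))"
    and C: "\<And>t. t > 0 \<Longrightarrow> norm (h (ray t \<theta>)) \<le> C * t / (1 + t^2)"
  shows "tame (\<lambda>t. R (ray t \<theta>) (h (ray t \<theta>)))"
proof -
  obtain M where M: "M \<ge> 0" "\<And>l x. l \<noteq> 0 \<Longrightarrow> Re l \<le> cos \<nu> * cmod l \<Longrightarrow> norm (R l x) \<le> M * norm x / cmod l"
    using R_bound[OF nu] by metis
  have ray: "ray t \<theta> \<in> outer om" "norm (R (ray t \<theta>) x) \<le> M * norm x / t" if "t > 0" for t x
  proof -
    show "ray t \<theta> \<in> outer om" using th ray_outer(1,2)[OF nu that] by blast
    have "Re (ray t \<theta>) \<le> cos \<nu> * cmod (ray t \<theta>)" using th ray_outer(3,4)[OF nu that] by blast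
    then have "norm (R (ray t \<theta>) x) \<le> M * norm x / cmod (ray t \<theta>)"
      by (rule M(2)[rotated]) (use that in simp)
    then show "norm (R (ray t \<theta>) x) \<le> M * norm x / t" using that by (simp add: norm_mult)
  qed
  show ?thesis
  proof (rule tameI[of _ "M * C"])
    show "continuous_on {0<..} (\<lambda>t. R (ray t \<theta>) (h (ray t \<theta>)))"
    proof (rule continuous_at_imp_continuous_on, rule ballI)
      fix u :: real assume "u \<in> {0<..}"
      then have u: "u > 0" by simp
      define m where "m = of_real u * cis \<theta>"
      have ev: "\<forall>\<^sub>F t in at u. t > u / 2" using order_tendstoD(1)[OF tendsto_ident_at, of "u / 2" u UNIV] u by simp
      have h: "((\<lambda>t. h (ray t \<theta>)) \<longlongrightarrow> h m) (at u)"
        using cont u unfolding m_def by (auto simp: continuous_on_eq_continuous_at continuous_at)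
      \<comment> \<open>Joint continuity of \<open>R l (h l)\<close> is split into strong continuity
        at the fixed vector \<open>h m\<close> and the locally bounded resolvent applied to
        \<open>h l - h m\<close>.\<close>
      have 1: "((\<lambda>t. R (ray t \<theta>) (h m)) \<longlongrightarrow> R m (h m)) (at u)"
      proof -
        have "continuous_on {0<..} (\<lambda>t. R (ray t \<theta>) (h m))"
          using ray(1) by (intro continuous_on_compose2[OF R_continuous] continuous_intros) auto
        then show ?thesis using u unfolding m_def by (auto simp: continuous_on_eq_continuous_at continuous_at)
      qed
      have 2: "((\<lambda>t. R (ray t \<theta>) (h (ray t \<theta>) - h m)) \<longlongrightarrow> 0) (at u)"
      proof (rule Lim_null_comparison)
        show "\<forall>\<^sub>F t in at u. norm (R (ray t \<theta>) (h (ray t \<theta>) - h m)) \<le> M * norm (h (ray t \<theta>) - h m) / t"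
          using ev by eventually_elim (use u in \<open>auto intro!: ray(2)\<close>)
        have "((\<lambda>t. M * norm (h (ray t \<theta>) - h m) / t) \<longlongrightarrow> M * norm (h m - h m) / u) (at u)"
          using u by (intro tendsto_intros h) auto
        then show "((\<lambda>t. M * norm (h (ray t \<theta>) - h m) / t) \<longlongrightarrow> 0) (at u)" by simp
      qed
      have "((\<lambda>t. R (ray t \<theta>) (h m) + R (ray t \<theta>) (h (ray t \<theta>) - h m)) \<longlongrightarrow> R m (h m) + 0) (at u)"
        by (rule tendsto_add[OF 1 2])
      moreover have "\<forall>\<^sub>F t in at u. R (ray t \<theta>) (h m) + R (ray t \<theta>) (h (ray t \<theta>) - h m)
          = R (ray t \<theta>) (h (ray t \<theta>))"
        using ev by eventually_elim (use u in \<open>simp add: clinear_diff[OF R_clinear[OF ray(1)]]\<close>)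
      ultimately show "isCont (\<lambda>t. R (ray t \<theta>) (h (ray t \<theta>))) u"
        unfolding continuous_at m_def using Lim_transform_eventually by fastforce
    qed
    fix t :: real assume t: "t > 0"
    have "norm (R (ray t \<theta>) (h (ray t \<theta>))) \<le> M * norm (h (ray t \<theta>)) / t" by (rule ray(2)[OF t])
    also have "\<dots> \<le> M * (C * t / (1 + t^2)) / t" using C[OF t] M t by (intro divide_right_mono mult_left_mono) auto
    finally show "norm (R (ray t \<theta>) (h (ray t \<theta>))) \<le> M * C / (1 + t^2)" using t by simp
  qed
qed

lemma tame2_R:
  assumes nu: "om < \<nu>" "\<nu> < s" "s < pi" and h: "decaying s h"
  shows "tame2 \<nu> (\<lambda>l. R l (h l))"
proof -
  obtain C where C: "\<And>z. z \<in> sector s \<Longrightarrow> norm (h z) \<le> C * cmod z / (1 + (cmod z)^2)"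
    using decaying_bound[OF h] by metis
  have "tame (\<lambda>t. R (ray t \<theta>) (h (ray t \<theta>)))" if th: "\<theta> = \<nu> \<or> \<theta> = - \<nu>" for \<theta>
  proof (rule tame_ray_R[OF nu(1) _ th])
    have ray: "ray t \<theta> \<in> sector s" if "t > 0" for t using ray_in_sector[of \<theta> s t] that th nu om by auto
    then show "continuous_on {0<..} (\<lambda>t. h (ray t \<theta>))"
      by (intro continuous_on_compose2[OF decaying_continuous[OF h]] continuous_intros) auto
    show "norm (h (ray t \<theta>)) \<le> C * t / (1 + t^2)" if "t > 0" for t
      using C[OF ray[OF that]] that by (simp add: norm_mult)
  qed (use nu in simp)
  then show ?thesis unfolding tame2_def by blast
qed

text \<open>Partial fractions give \<open>R(-a) R(l) = (R(-a) - R(l)) / (l + a)\<close>. In the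
  first term \<open>R(-a)\<close> can be taken out; in the remaining integral of
  \<open>h l / (l + a)\<close> the extra denominator improves the decay to 1/(1 + |l|^2) in the
  whole sector, so it vanishes by Cauchy's theorem.\<close>

lemma ocalc_resolvent:
  assumes nu: "om < \<nu>" "\<nu> < s" "s < pi" and h: "decaying s h" and a: "a > 0"
  shows "R (- of_real a) (ocalc \<nu> h) = - ocalc \<nu> (\<lambda>l. (1 / (l + of_real a)) \<odot> h l)"
    and "decaying s (\<lambda>l. (1 / (l + of_real a)) \<odot> h l)"
proof -
  define k where "k = sqrt ((1 + cos s) / 2)"
  have cs: "-1 < cos s" using cos_mono_less_eq[of pi s] nu om by auto
  then have k: "k > 0" unfolding k_def by simp
  have lb: "k * (cmod z + a) \<le> cmod (z + of_real a)" if "z \<in> sector s" for z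
    using cmod_add_of_real_ge[of "cos s" z a] that cs a sector_eq_cone[of s] nu om unfolding k_def by (auto simp: cone_def)
  have ne: "z + of_real a \<noteq> 0" if "z \<in> sector s" for z
  proof -
    have "0 < k * (cmod z + a)" using k a by (intro mult_pos_pos) (auto intro: add_nonneg_pos)
    then show ?thesis using lb[OF that] by auto
  qed
  have hol: "(\<lambda>l. 1 / (l + of_real a)) holomorphic_on sector s" using ne by (intro holomorphic_intros) auto
  have le: "cmod (1 / (z + of_real a)) \<le> 1 / (k * (cmod z + a))" if "z \<in> sector s" for z
    using lb[OF that] k a ne[OF that] by (simp add: norm_divide add_nonneg_pos frac_le)
  have le': "cmod (1 / (z + of_real a)) \<le> 1 / (k * a)" if "z \<in> sector s" for z
  proof -
    have "1 / (k * (cmod z + a)) \<le> 1 / (k * a)" using k a by (intro divide_left_mono mult_left_mono mult_pos_pos) (auto intro: add_nonneg_pos)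
    then show ?thesis using le[OF that] by simp
  qed
  show decaying: "decaying s (\<lambda>l. (1 / (l + of_real a)) \<odot> h l)" by (rule decaying_mult[OF h hol le'])
  obtain C where C: "C \<ge> 0" "\<And>z. z \<in> sector s \<Longrightarrow> norm (h z) \<le> C * cmod z / (1 + (cmod z)^2)"
    using decaying_bound[OF h] by metis
  have bd: "norm ((1 / (z + of_real a)) \<odot> h z) \<le> C / k / (1 + (cmod z)^2)" if z: "z \<in> sector s" for z
  proof -
    have "norm ((1 / (z + of_real a)) \<odot> h z) \<le> 1 / (k * (cmod z + a)) * (C * cmod z / (1 + (cmod z)^2))"
      unfolding norm_scale using le[OF z] C(2)[OF z] k a by (intro mult_mono) auto
    also have "\<dots> = (C / k / (1 + (cmod z)^2)) * (cmod z / (cmod z + a))" using k a by simp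
    also have "\<dots> \<le> (C / k / (1 + (cmod z)^2)) * 1" using k a C(1)
      by (intro mult_left_mono) (auto intro!: divide_nonneg_nonneg add_nonneg_nonneg simp: divide_le_eq_1 add_nonneg_pos)
    finally show ?thesis by simp
  qed
  have ray: "ray t \<nu> \<in> sector s \<and> ray t (- \<nu>) \<in> sector s" if "t > 0" for t
    using ray_in_sector[of \<nu> s t] ray_in_sector[of "-\<nu>" s t] that nu om by auto
  have t1: "tame2 \<nu> (\<lambda>l. (1 / (l + of_real a)) \<odot> h l)"
    by (rule tame2I[OF decaying_continuous[OF decaying] _ bd]) (use ray in auto)
  have zero: "bnd_int J \<nu> (\<lambda>l. (1 / (l + of_real a)) \<odot> h l) = 0"
  proof (rule cfun_eqI)
    fix q assume q: "cfun q"
    obtain K where K: "K \<ge> 0" "\<And>x. cmod (q x) \<le> K * norm x" using cfun_bound[OF q] by blast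
    have "cbnd_int \<nu> (\<lambda>z. q ((1 / (z + of_real a)) \<odot> h z)) = 0"
    proof (rule cbnd_int_sector_zero(2))
      show "(\<lambda>z. q ((1 / (z + of_real a)) \<odot> h z)) holomorphic_on sector s"
        by (rule decaying_holomorphic[OF decaying q])
      fix z assume z: "z \<in> sector s"
      have "cmod (q ((1 / (z + of_real a)) \<odot> h z)) \<le> K * (C / k / (1 + (cmod z)^2))"
        using K(2)[of "(1 / (z + of_real a)) \<odot> h z"] mult_left_mono[OF bd[OF z] K(1)] by linarith
      then show "cmod (q ((1 / (z + of_real a)) \<odot> h z)) \<le> (K * (C / k)) / (1 + (cmod z)^2)" by simp
    qed (use nu om in auto)
    then show "q (bnd_int J \<nu> (\<lambda>l. (1 / (l + of_real a)) \<odot> h l)) = q 0"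
      using cfun_bnd_int[OF q t1] cfun_scale[OF q, of 0 0] by simp
  qed
  have n: "- of_real a \<in> outer om" by (rule neg_in_outer[OF a])
  note Rn = R_clinear[OF n]
  have t2: "tame2 \<nu> (\<lambda>l. R l ((1 / (l + of_real a)) \<odot> h l))" by (rule tame2_R[OF nu decaying])
  have t3: "tame2 \<nu> (\<lambda>l. R (- of_real a) ((1 / (l + of_real a)) \<odot> h l))"
    using tame2_bounded_linear[OF t1 R_bounded_linear[OF n]] .
  have pt: "R (- of_real a) (R l (h l)) = R (- of_real a) ((1 / (l + of_real a)) \<odot> h l) + (- 1) \<odot> R l ((1 / (l + of_real a)) \<odot> h l)"
    if l: "l \<in> outer om" "l \<in> sector s" for l
  proof -
    have "R l (h l) = R (- of_real a) (h l) + (- of_real a - l) \<odot> R (- of_real a) (R l (h l))"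
      by (rule resolvent_identity[OF n l(1)])
    then have "(l + of_real a) \<odot> R (- of_real a) (R l (h l)) = R (- of_real a) (h l) - R l (h l)"
      by (simp add: scale_diff_left scale_add_left scale_minus_left algebra_simps)
    then have "(1 / (l + of_real a)) \<odot> ((l + of_real a) \<odot> R (- of_real a) (R l (h l)))
       = (1 / (l + of_real a)) \<odot> (R (- of_real a) (h l) - R l (h l))" by simp
    then show ?thesis using ne[OF l(2)]
      by (simp add: scale_scale scale_diff_right scale_minus_left clinear_apply_scale[OF Rn] clinear_apply_scale[OF R_clinear[OF l(1)]])
  qed
  have nu': "\<nu> < pi" using nu by simp
  have "R (- of_real a) (bnd_int J \<nu> (\<lambda>l. R l (h l))) = bnd_int J \<nu> (\<lambda>l. R (- of_real a) (R l (h l)))"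
    by (rule clinear_bnd_int[OF Rn tame2_R[OF nu h]])
  also have "\<dots> = bnd_int J \<nu> (\<lambda>l. R (- of_real a) ((1 / (l + of_real a)) \<odot> h l) + (- 1) \<odot> R l ((1 / (l + of_real a)) \<odot> h l))"
    using ray ray_outer[OF nu(1) nu'] by (intro bnd_int_cong pt) auto
  also have "\<dots> = R (- of_real a) (bnd_int J \<nu> (\<lambda>l. (1 / (l + of_real a)) \<odot> h l)) + (- 1) \<odot> bnd_int J \<nu> (\<lambda>l. R l ((1 / (l + of_real a)) \<odot> h l))"
    using bnd_int_add[OF t3 tame2_scale[OF t2, of "-1"]] clinear_bnd_int[OF Rn t1] clinear_bnd_int[OF clinear_scale t2, of "-1"] by simp
  also have "\<dots> = - bnd_int J \<nu> (\<lambda>l. R l ((1 / (l + of_real a)) \<odot> h l))"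
    unfolding zero using clinear_apply_scale[OF Rn, of 0 0] by (simp add: scale_minus_left)
  finally show "R (- of_real a) (ocalc \<nu> h) = - ocalc \<nu> (\<lambda>l. (1 / (l + of_real a)) \<odot> h l)"
    unfolding ocalc_def by (simp add: clinear_apply_scale[OF Rn] scale_minus_right)
qed

end

section \<open>The rational functions a / (a + z) and their differences\<close>

definition wfun :: "real \<Rightarrow> real \<Rightarrow> complex \<Rightarrow> complex" where
  "wfun a b z = of_real a / (of_real a + z) - of_real b / (of_real b + z)"

text \<open>For s in [0, pi] this is \<open>cos (s / 2)\<close>, the constant comparing
  \<open>cmod (a + z)\<close> with \<open>cmod z + a\<close> on the sector.\<close>

definition angle_const :: "real \<Rightarrow> real" where
  "angle_const s = sqrt ((1 + cos s) / 2)"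

lemma angle_const_pos: "0 \<le> s \<Longrightarrow> s < pi \<Longrightarrow> angle_const s > 0"
  using cos_mono_less_eq[of pi s] unfolding angle_const_def by simp

lemma cmod_add_sector:
  assumes "0 \<le> s" "s < pi" "z \<in> sector s" "a > 0"
  shows "angle_const s * (cmod z + a) \<le> cmod (of_real a + z)" "of_real a + z \<noteq> 0"
proof -
  show 1: "angle_const s * (cmod z + a) \<le> cmod (of_real a + z)"
    using cmod_add_of_real_ge[of "cos s" z a] assms sector_eq_cone[of s]
    unfolding angle_const_def by (simp add: cone_def add.commute)
  have "0 < angle_const s * (cmod z + a)"
    using angle_const_pos assms by (intro mult_pos_pos) (auto intro: add_nonneg_pos)
  then show "of_real a + z \<noteq> 0" using 1 by auto
qed

lemma vfun_bound:
  assumes "0 \<le> s" "s < pi" "z \<in> sector s" "a > 0"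
  shows "cmod (of_real a / (of_real a + z)) \<le> 1 / angle_const s"
proof -
  note k = angle_const_pos[OF assms(1,2)]
  have "angle_const s * a \<le> angle_const s * (cmod z + a)" using k by (intro mult_left_mono) auto
  then have "angle_const s * a \<le> cmod (of_real a + z)" using cmod_add_sector(1)[OF assms] by linarith
  then show ?thesis using k assms(4) cmod_add_sector(2)[OF assms] by (simp add: norm_divide field_simps)
qed

lemma vfun_holomorphic:
  assumes "0 \<le> s" "s < pi" "a > 0"
  shows "(\<lambda>z. of_real a / (of_real a + z)) holomorphic_on sector s"
  using cmod_add_sector(2)[OF assms(1,2) _ assms(3)] by (intro holomorphic_intros) auto

lemma wfun_holomorphic:
  assumes "0 \<le> s" "s < pi" "a > 0" "b > 0"
  shows "wfun a b holomorphic_on sector s"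
  unfolding wfun_def using vfun_holomorphic assms by (intro holomorphic_on_diff) auto

lemma wfun_bound:
  assumes "0 \<le> s" "s < pi" "z \<in> sector s" "a > 0" "b > 0"
  shows "cmod (wfun a b z) \<le> \<bar>a - b\<bar> * cmod z / ((angle_const s)^2 * ((cmod z + a) * (cmod z + b)))"
proof -
  note k = angle_const_pos[OF assms(1,2)]
  note A = cmod_add_sector[OF assms(1-3) assms(4)] and B = cmod_add_sector[OF assms(1-3) assms(5)]
  have pos: "0 < angle_const s * (cmod z + a)" "0 < angle_const s * (cmod z + b)"
    using k assms(4,5) by (auto intro!: mult_pos_pos add_nonneg_pos)
  have "wfun a b z = of_real (a - b) * z / ((of_real a + z) * (of_real b + z))"
    unfolding wfun_def using A(2) B(2) by (simp add: field_simps)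
  then have "cmod (wfun a b z) = \<bar>a - b\<bar> * cmod z / (cmod (of_real a + z) * cmod (of_real b + z))"
    by (simp only: norm_divide norm_mult norm_of_real)
  also have "\<dots> \<le> \<bar>a - b\<bar> * cmod z / ((angle_const s * (cmod z + a)) * (angle_const s * (cmod z + b)))"
    using mult_mono[OF A(1) B(1) norm_ge_zero less_imp_le[OF pos(2)]] mult_pos_pos[OF pos]
    by (intro frac_le) auto
  finally show ?thesis by (simp add: power2_eq_square mult_ac)
qed

lemma wfun_decay:
  assumes "0 \<le> s" "s < pi" "a > 0" "b > 0"
  shows "\<exists>C\<ge>0. \<forall>z\<in>sector s. cmod (wfun a b z) \<le> C * cmod z / (1 + (cmod z)^2)"
proof (intro exI conjI ballI)
  note k = angle_const_pos[OF assms(1,2)]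
  show "0 \<le> \<bar>a - b\<bar> / (angle_const s)^2 * (1 + 1 / (a * b))" using assms by simp
  fix z assume z: "z \<in> sector s"
  have "cmod (wfun a b z) \<le> \<bar>a - b\<bar> * cmod z / ((angle_const s)^2 * ((cmod z + a) * (cmod z + b)))"
    by (rule wfun_bound[OF assms(1,2) z assms(3,4)])
  also have "\<dots> = \<bar>a - b\<bar> / (angle_const s)^2 * cmod z * (1 / ((cmod z + a) * (cmod z + b)))" by simp
  also have "\<dots> \<le> \<bar>a - b\<bar> / (angle_const s)^2 * cmod z * ((1 + 1 / (a * b)) / (1 + (cmod z)^2))"
    using assms by (intro mult_left_mono kernel_bound) auto
  finally show "cmod (wfun a b z) \<le> \<bar>a - b\<bar> / (angle_const s)^2 * (1 + 1 / (a * b)) * cmod z / (1 + (cmod z)^2)"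
    by (simp add: mult_ac)
qed

text \<open>Since \<open>1 / (1 + n * z)\<close> is \<open>a / (a + z)\<close> for
  \<open>a = 1 / n\<close>, the regularizers of the definition and the dyadic pieces belong to one
  family.\<close>

lemma phi_wfun: "phi n = wfun n (1 / n)" if "n \<ge> 1"
proof
  fix z :: complex
  have "of_real (1 / real n) + z = (1 + of_nat n * z) / of_nat n" using that by (simp add: field_simps)
  then have "of_real (1 / real n) / (of_real (1 / real n) + z) = 1 / (1 + of_nat n * z)"
    using that by simp
  then show "phi n z = wfun n (1 / n) z" unfolding phi_def wfun_def by simp
qed

lemma sector_mono: "s \<le> s' \<Longrightarrow> sector s \<subseteq> sector s'"
  unfolding sector_def by auto

text \<open>The constant in a bound C / (1 + t^2) depends on the scale at which the integrand lives.
  An antiderivative \<open>G\<close> of the majorant with bounded increments gives a bound free of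
  this dependence.\<close>

lemma tame_norm_FTC:
  fixes f :: "real \<Rightarrow> 'b::banach"
  assumes f: "tame f" and g: "\<And>t. t > 0 \<Longrightarrow> norm (f t) \<le> g t"
    and G: "\<And>t. t > 0 \<Longrightarrow> (G has_real_derivative g t) (at t)"
    and B: "\<And>x y. 0 < x \<Longrightarrow> x \<le> y \<Longrightarrow> G y - G x \<le> B"
  shows "norm (integral {0..} f) \<le> B"
proof (rule LIMSEQ_le_const2[OF tendsto_norm[OF tame_truncation(2)[OF f]]])
  show "\<exists>N. \<forall>n\<ge>N. norm (integral {1 / real (Suc n)..real (Suc n)} f) \<le> B"
  proof (intro exI allI impI)
    fix n
    define x where "x = 1 / real (Suc n)"
    define y where "y = real (Suc n)"
    have "x \<le> 1" "1 \<le> y" and x: "x > 0" unfolding x_def y_def by simp_all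
    then have xy: "x \<le> y" by linarith
    have pos: "t > 0" if "t \<in> {x..y}" for t using that x by auto
    have "continuous_on {0<..} f" using f unfolding tame_def by blast
    then have "continuous_on {x..y} f" by (rule continuous_on_subset) (use pos in auto)
    then have fi: "f integrable_on {x..y}" by (rule integrable_continuous_real)
    have gi: "(g has_integral (G y - G x)) {x..y}"
      using G pos by (intro fundamental_theorem_of_calculus[OF xy])
        (auto simp: has_real_derivative_iff_has_vector_derivative[symmetric] intro: has_field_derivative_at_within)
    have "norm (integral {x..y} f) \<le> integral {x..y} g"
      by (rule integral_norm_bound_integral[OF fi has_integral_integrable[OF gi] g[OF pos]])
    also have "\<dots> \<le> B" using integral_unique[OF gi] B[OF x xy] by simp
    finally show "norm (integral {1 / real (Suc n)..real (Suc n)} f) \<le> B" unfolding x_def y_def .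
  qed
qed

lemma (in complex_structure) decaying_const:
  assumes g: "g holomorphic_on sector s" "\<And>z. z \<in> sector s \<Longrightarrow> cmod (g z) \<le> C * cmod z / (1 + (cmod z)^2)" "C \<ge> 0"
  shows "decaying s (\<lambda>z. g z \<odot> x)"
proof (rule decayingI[of _ _ "C * norm x"])
  show "continuous_on (sector s) (\<lambda>z. g z \<odot> x)"
    using holomorphic_on_imp_continuous_on[OF g(1)] by (intro continuous_on_scale continuous_on_const)
  show "(\<lambda>z. q (g z \<odot> x)) holomorphic_on sector s" if "cfun q" for q
    unfolding cfun_scale[OF that] using g(1) by (intro holomorphic_on_mult holomorphic_on_const)
  show "norm (g z \<odot> x) \<le> C * norm x * cmod z / (1 + (cmod z)^2)" if "z \<in> sector s" for z
    using mult_right_mono[OF g(2)[OF that] norm_ge_zero[of x]] by (simp add: mult_ac)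
qed (use g in simp)

section \<open>Multiplication of symbols by rational functions\<close>

context sectorial_op
begin

lemma rays:
  assumes "om < \<nu>" "\<nu> < s" "s < pi" "t > 0"
  shows "ray t \<nu> \<in> outer om" "ray t (- \<nu>) \<in> outer om"
    "ray t \<nu> \<in> sector s" "ray t (- \<nu>) \<in> sector s"
  using ray_outer(1,2)[OF assms(1) _ assms(4)] ray_in_sector[of \<nu> s t] ray_in_sector[of "-\<nu>" s t] assms om by auto

lemma ocalc_cong:
  assumes "\<And>t. t > 0 \<Longrightarrow> g (ray t \<nu>) = h (ray t \<nu>)"
    "\<And>t. t > 0 \<Longrightarrow> g (ray t (- \<nu>)) = h (ray t (- \<nu>))"
  shows "ocalc \<nu> g = ocalc \<nu> h"
  unfolding ocalc_def using assms by (intro arg_cong[where f = "\<lambda>x. _ \<odot> x"] bnd_int_cong) simp_all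

lemma ocalc_commute:
  assumes nu: "om < \<nu>" "\<nu> < s" "s < pi" and h: "decaying s h"
    and S: "clinear S" "\<And>l x. l \<in> outer om \<Longrightarrow> S (R l x) = R l (S x)"
  shows "S (ocalc \<nu> h) = ocalc \<nu> (\<lambda>l. S (h l))"
proof -
  have "S (bnd_int J \<nu> (\<lambda>l. R l (h l))) = bnd_int J \<nu> (\<lambda>l. R l (S (h l)))"
    unfolding clinear_bnd_int[OF S(1) tame2_R[OF nu h]] using rays[OF nu] S(2) by (intro bnd_int_cong) auto
  then show ?thesis unfolding ocalc_def clinear_apply_scale[OF S(1)] by simp
qed

lemma ocalc_scale:
  assumes nu: "om < \<nu>" "\<nu> < s" "s < pi" and h: "decaying s h"
  shows "c \<odot> ocalc \<nu> h = ocalc \<nu> (\<lambda>l. c \<odot> h l)"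
  using clinear_apply_scale[OF R_clinear] by (intro ocalc_commute[OF nu h clinear_scale]) simp

lemma ocalc_add:
  assumes nu: "om < \<nu>" "\<nu> < s" "s < pi" and g: "decaying s g" and h: "decaying s h"
  shows "ocalc \<nu> (\<lambda>l. g l + h l) = ocalc \<nu> g + ocalc \<nu> h"
proof -
  have "bnd_int J \<nu> (\<lambda>l. R l (g l + h l)) = bnd_int J \<nu> (\<lambda>l. R l (g l) + R l (h l))"
    using clinear_add[OF R_clinear] rays[OF nu] by (intro bnd_int_cong) auto
  also have "\<dots> = bnd_int J \<nu> (\<lambda>l. R l (g l)) + bnd_int J \<nu> (\<lambda>l. R l (h l))"
    by (rule bnd_int_add[OF tame2_R[OF nu g] tame2_R[OF nu h]])
  finally show ?thesis unfolding ocalc_def by (simp add: scale_add_right)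
qed

lemma ocalc_zero: "om < \<nu> \<Longrightarrow> \<nu> < s \<Longrightarrow> s < pi \<Longrightarrow> ocalc \<nu> (\<lambda>l. 0) = 0"
  using ocalc_scale[of \<nu> s "\<lambda>l. 0" 0] decaying_zero by simp

lemma ocalc_sum:
  assumes nu: "om < \<nu>" "\<nu> < s" "s < pi" and h: "\<And>i. i < (n::nat) \<Longrightarrow> decaying s (h i)"
  shows "decaying s (\<lambda>l. \<Sum>i<n. h i l) \<and> ocalc \<nu> (\<lambda>l. \<Sum>i<n. h i l) = (\<Sum>i<n. ocalc \<nu> (h i))"
  using h
proof (induction n)
  case 0
  then show ?case using ocalc_zero[OF nu] decaying_zero by simp
next
  case (Suc n)
  then show ?case using decaying_add[of s "\<lambda>l. \<Sum>i<n. h i l" "h n"] ocalc_add[OF nu, of "\<lambda>l. \<Sum>i<n. h i l" "h n"] by simp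
qed

text \<open>As \<open>R (- a)\<close> inverts \<open>- (a + A)\<close>, this is \<open>a\<close>
  times the inverse of \<open>a + A\<close>, the operator with symbol
  \<open>a / (a + z)\<close>.\<close>

definition V :: "real \<Rightarrow> 'a \<Rightarrow> 'a" where
  "V a x = - (of_real a \<odot> R (- of_real a) x)"

lemma V_clinear: "clinear (V a)" if "a > 0"
proof -
  note R = R_clinear[OF neg_in_outer[OF that]]
  have "bounded_linear (\<lambda>x. of_real a \<odot> R (- of_real a) x)"
    using bounded_linear_compose[OF bounded_linear_scale clinear_bounded_linear[OF R]] .
  then have "bounded_linear (V a)" unfolding V_def[abs_def] by (rule bounded_linear_minus)
  then show ?thesis unfolding clinear_def
    by (simp add: V_def clinear_apply_scale[OF R] scale_scale scale_minus_right mult.commute)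
qed

lemma V_commute:
  assumes "a > 0" "clinear S" "\<And>l x. l \<in> outer om \<Longrightarrow> S (R l x) = R l (S x)"
  shows "S (V a x) = V a (S x)"
  unfolding V_def using assms(3)[OF neg_in_outer[OF assms(1)]] by (simp add: clinear_minus[OF assms(2)] clinear_apply_scale[OF assms(2)])

lemma V_bound: "\<exists>M\<ge>0. \<forall>a>0. \<forall>x. norm (V a x) \<le> M * norm x"
proof -
  obtain s where s: "om < s" "s < pi" using dense[OF om(2)] by blast
  obtain M where M: "M \<ge> 0" "\<And>l x. l \<noteq> 0 \<Longrightarrow> Re l \<le> cos s * cmod l \<Longrightarrow> norm (R l x) \<le> M * norm x / cmod l"
    using R_bound[OF s] by metis
  have "norm (V a x) \<le> M * norm x" if a: "a > 0" for a x
  proof -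
    have "- a \<le> cos s * a" using mult_right_mono[of "-1" "cos s" a] a by simp
    then have "norm (R (- of_real a) x) \<le> M * norm x / a" using M(2)[of "- of_real a" x] a by simp
    then have "a * norm (R (- of_real a) x) \<le> a * (M * norm x / a)" using a by (intro mult_left_mono) auto
    then show ?thesis unfolding V_def using a by simp
  qed
  then show ?thesis using M(1) by blast
qed

lemma V_ocalc:
  assumes nu: "om < \<nu>" "\<nu> < s" "s < pi" and h: "decaying s h" and a: "a > 0"
  shows "V a (ocalc \<nu> h) = ocalc \<nu> (\<lambda>l. (of_real a / (of_real a + l)) \<odot> h l)"
    and "decaying s (\<lambda>l. (of_real a / (of_real a + l)) \<odot> h l)"
proof -
  have s: "0 \<le> s" using nu om by simp
  show "decaying s (\<lambda>l. (of_real a / (of_real a + l)) \<odot> h l)"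
    by (rule decaying_mult[OF h vfun_holomorphic[OF s nu(3) a] vfun_bound[OF s nu(3) _ a]])
  have "V a (ocalc \<nu> h) = of_real a \<odot> ocalc \<nu> (\<lambda>l. (1 / (l + of_real a)) \<odot> h l)"
    unfolding V_def ocalc_resolvent(1)[OF nu h a] by (simp add: scale_minus_right)
  also have "\<dots> = ocalc \<nu> (\<lambda>l. of_real a \<odot> (1 / (l + of_real a)) \<odot> h l)"
    by (rule ocalc_scale[OF nu ocalc_resolvent(2)[OF nu h a]])
  finally show "V a (ocalc \<nu> h) = ocalc \<nu> (\<lambda>l. (of_real a / (of_real a + l)) \<odot> h l)"
    by (simp add: scale_scale add.commute)
qed

definition W :: "real \<Rightarrow> real \<Rightarrow> 'a \<Rightarrow> 'a" where
  "W a b x = V a x - V b x"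

lemma W_clinear: "a > 0 \<Longrightarrow> b > 0 \<Longrightarrow> clinear (W a b)"
  unfolding clinear_def W_def[abs_def]
  using bounded_linear_sub[OF clinear_bounded_linear[OF V_clinear] clinear_bounded_linear[OF V_clinear], of a b]
  by (simp add: clinear_apply_scale[OF V_clinear] scale_diff_right)

lemma W_commute:
  assumes "a > 0" "b > 0" "clinear S" "\<And>l x. l \<in> outer om \<Longrightarrow> S (R l x) = R l (S x)"
  shows "S (W a b x) = W a b (S x)"
  unfolding W_def using V_commute[OF assms(1,3,4)] V_commute[OF assms(2,3,4)] by (simp add: clinear_diff[OF assms(3)])

lemma W_R_commute: "a > 0 \<Longrightarrow> b > 0 \<Longrightarrow> l \<in> outer om \<Longrightarrow> W a b (R l x) = R l (W a b x)"
  using W_commute[OF _ _ R_clinear R_commute] by simp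

lemma W_ocalc:
  assumes nu: "om < \<nu>" "\<nu> < s" "s < pi" and h: "decaying s h" and ab: "a > 0" "b > 0"
  shows "W a b (ocalc \<nu> h) = ocalc \<nu> (\<lambda>l. wfun a b l \<odot> h l)"
    and "decaying s (\<lambda>l. wfun a b l \<odot> h l)"
proof -
  note A = V_ocalc[OF nu h ab(1)] and B = V_ocalc[OF nu h ab(2)]
  have eq: "wfun a b l \<odot> h l = (of_real a / (of_real a + l)) \<odot> h l + (- 1) \<odot> ((of_real b / (of_real b + l)) \<odot> h l)" for l
    by (simp add: wfun_def scale_scale scale_diff_left scale_minus_left)
  have gB: "decaying s (\<lambda>l. (- 1) \<odot> ((of_real b / (of_real b + l)) \<odot> h l))"
    by (rule decaying_mult[OF B(2), of "\<lambda>_. - 1" 1]) auto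
  show "decaying s (\<lambda>l. wfun a b l \<odot> h l)" unfolding eq by (rule decaying_add[OF A(2) gB])
  show "W a b (ocalc \<nu> h) = ocalc \<nu> (\<lambda>l. wfun a b l \<odot> h l)"
    unfolding eq ocalc_add[OF nu A(2) gB] ocalc_scale[OF nu B(2), symmetric] W_def A(1) B(1)
    by (simp add: scale_minus_left)
qed

lemma fcalc_eq_ocalc:
  assumes "om < s"
  shows "fcalc J D A s g x = ocalc (nu_of J D A s) (\<lambda>l. g l \<odot> x)"
proof -
  define \<nu> where "\<nu> = nu_of J D A s"
  have nu: "om < \<nu>" "\<nu> < pi" using assms om unfolding \<nu>_def nu_of_def by (auto simp: min_def)
  have "bnd_int J \<nu> (\<lambda>l. g l \<odot> R l x) = bnd_int J \<nu> (\<lambda>l. R l (g l \<odot> x))"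
    using clinear_apply_scale[OF R_clinear] ray_outer(1,2)[OF nu] by (intro bnd_int_cong) auto
  then show ?thesis unfolding fcalc_def ocalc_def \<nu>_def by simp
qed

text \<open>The two memberships of \<open>y\<close> act at opposite ends. From
  \<open>y = A z\<close> comes \<open>R l y = l R l z - z\<close>, bounded near 0; from
  \<open>y \<in> D\<close> comes \<open>R l y = (y + R l (A y)) / l\<close>, whose leading term
  cancels against \<open>y / (l - 1)\<close> up to order |l|^-2. Adding the bounds \<open>C1\<close>
  and \<open>C2 / r^2\<close> gives the majorant.\<close>

lemma R_log_kernel_bound:
  assumes nu: "om < \<nu>" "\<nu> < pi" and y: "y \<in> D" "y = A z" "z \<in> D"
  shows "\<exists>C\<ge>0. \<forall>l. l \<noteq> 0 \<longrightarrow> Re l \<le> cos \<nu> * cmod l \<longrightarrow>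
      norm (R l y - (1 / (l - 1)) \<odot> y) \<le> C / (1 + (cmod l)^2)"
proof -
  obtain M where M: "M \<ge> 0" "\<And>l x. l \<noteq> 0 \<Longrightarrow> Re l \<le> cos \<nu> * cmod l \<Longrightarrow> norm (R l x) \<le> M * norm x / cmod l"
    using R_bound[OF nu] by metis
  have nu0: "0 < \<nu>" using nu om by simp
  define k where "k = sqrt ((1 - cos \<nu>) / 2)"
  have k: "k > 0" using cos_mono_less_eq[of \<nu> 0] nu nu0 unfolding k_def by auto
  define C1 where "C1 = M * norm z + norm z + norm y / k"
  define C2 where "C2 = M * norm (A y) + norm y / k"
  have C0: "C1 \<ge> 0" "C2 \<ge> 0" unfolding C1_def C2_def using M k by auto
  have "norm (R l y - (1 / (l - 1)) \<odot> y) \<le> (C1 + C2) / (1 + (cmod l)^2)"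
    if l: "l \<noteq> 0" "Re l \<le> cos \<nu> * cmod l" for l
  proof -
    define r where "r = cmod l"
    have r: "r > 0" unfolding r_def using l by simp
    have lo: "l \<in> outer om" by (rule in_outer[OF nu l])
    have b: "k * (r + 1) \<le> cmod (l - 1)" using cmod_outer_diff_ge[of \<nu> l 1] nu0 nu l unfolding k_def r_def by simp
    have kr: "k * (r + 1) > 0" using k r by simp
    then have l1: "l - 1 \<noteq> 0" using b by auto
    have n1: "cmod (1 / (l - 1)) \<le> 1 / (k * (r + 1))" using b kr l1 by (simp add: norm_divide frac_le)
    have "R l y = l \<odot> R l z - z"
    proof -
      have "R l (l \<odot> z - A z) = z" by (rule R_left[OF lo y(3)])
      then have "l \<odot> R l z - R l y = z"
        unfolding y(2) by (simp add: clinear_diff[OF R_clinear[OF lo]] clinear_apply_scale[OF R_clinear[OF lo]])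
      then show ?thesis by (simp add: algebra_simps)
    qed
    then have "norm (R l y) \<le> cmod l * norm (R l z) + norm z" using norm_triangle_ineq4[of "l \<odot> R l z" z] by simp
    also have "cmod l * norm (R l z) \<le> cmod l * (M * norm z / cmod l)" using M(2)[OF l] by (intro mult_left_mono) auto
    also have "\<dots> = M * norm z" using l by simp
    finally have 1: "norm (R l y) \<le> M * norm z + norm z" by simp
    have "cmod (1 / (l - 1)) * norm y \<le> 1 / k * norm y"
    proof (rule mult_right_mono[OF order_trans[OF n1]])
      have "k * 1 \<le> k * (r + 1)" using k r by (intro mult_left_mono) auto
      then show "1 / (k * (r + 1)) \<le> 1 / k" using k by (intro frac_le) auto
    qed simp
    then have small: "norm (R l y - (1 / (l - 1)) \<odot> y) \<le> C1"
      using 1 norm_triangle_ineq4[of "R l y" "(1 / (l - 1)) \<odot> y"] unfolding C1_def by simp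
    have "R l (l \<odot> y - A y) = y" by (rule R_left[OF lo y(1)])
    then have "l \<odot> R l y = y + R l (A y)"
      by (simp add: clinear_diff[OF R_clinear[OF lo]] clinear_apply_scale[OF R_clinear[OF lo]] algebra_simps)
    then have "(1 / l) \<odot> l \<odot> R l y = (1 / l) \<odot> (y + R l (A y))" by simp
    then have "R l y = (1 / l) \<odot> y + (1 / l) \<odot> R l (A y)" using l by (simp add: scale_scale scale_add_right)
    then have "R l y - (1 / (l - 1)) \<odot> y = (1 / l) \<odot> R l (A y) + (1 / l - 1 / (l - 1)) \<odot> y"
      by (simp add: scale_diff_left)
    also have "1 / l - 1 / (l - 1) = - (1 / l) * (1 / (l - 1))" using l l1 by (simp add: field_simps)
    finally have eq: "R l y - (1 / (l - 1)) \<odot> y = (1 / l) \<odot> R l (A y) + (- (1 / l) * (1 / (l - 1))) \<odot> y" .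
    have "norm (R l y - (1 / (l - 1)) \<odot> y) \<le> 1 / r * norm (R l (A y)) + 1 / r * cmod (1 / (l - 1)) * norm y"
      unfolding eq using norm_triangle_ineq[of "(1 / l) \<odot> R l (A y)" "(- (1 / l) * (1 / (l - 1))) \<odot> y"]
      by (simp add: norm_mult norm_divide r_def)
    also have "\<dots> \<le> 1 / r * (M * norm (A y) / r) + 1 / r * (1 / (k * r)) * norm y"
    proof (intro add_mono mult_left_mono mult_right_mono)
      show "norm (R l (A y)) \<le> M * norm (A y) / r" using M(2)[OF l] unfolding r_def .
      have "k * r \<le> k * (r + 1)" using k by (intro mult_left_mono) auto
      then have "1 / (k * (r + 1)) \<le> 1 / (k * r)" using k r by (intro frac_le) auto
      then show "cmod (1 / (l - 1)) \<le> 1 / (k * r)" using n1 by linarith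
    qed (use r in auto)
    also have "\<dots> = C2 / r^2" unfolding C2_def using r k by (simp add: power2_eq_square add_divide_distrib)
    finally have "norm (R l y - (1 / (l - 1)) \<odot> y) * r^2 \<le> C2" using r by (simp add: field_simps)
    then have "norm (R l y - (1 / (l - 1)) \<odot> y) * (1 + r^2) \<le> C1 + C2" using small by (simp add: algebra_simps)
    moreover have "1 + r^2 > 0" by (simp add: add_pos_nonneg)
    ultimately show ?thesis unfolding r_def[symmetric] by (simp add: field_simps)
  qed
  then show ?thesis using C0 by (intro exI[of _ "C1 + C2"]) auto
qed

text \<open>The difference \<open>wfun a b\<close> has two simple poles \<open>-a\<close>, \<open>-b\<close> outside the sector. Splitting
  \<open>wfun a b l \<odot> R l x\<close> by the resolvent identity leaves a remainder that is analytic and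
  integrable outside the contour, plus multiples of scalar logarithmic kernels.\<close>
lemma ocalc_wfun:
  assumes nu: "om < \<nu>" "\<nu> < pi" and ab: "a > 0" "b > 0"
  shows "ocalc \<nu> (\<lambda>l. wfun a b l \<odot> x) = W a b x"
proof -
  have na: "- of_real a \<in> outer om" and nb: "- of_real b \<in> outer om" using neg_in_outer ab by auto
  have nu0: "0 < \<nu>" using nu om by simp
  have one: "1 \<notin> outer om" by (simp add: outer_def cone_def not_less)
  define u where "u = R (- of_real a) x"
  define v where "v = R (- of_real b) x"
  \<comment> \<open>The sum of the residues of \<open>wfun a b l \<odot> R l x\<close> at its two
    poles. Being \<open>A (v - u)\<close> with \<open>u\<close> and \<open>v\<close> in the domain,
    it lies both in the domain and in the range of \<open>A\<close>, as the integrability of the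
    remainder requires.\<close>
  define y where "y = of_real a \<odot> u - of_real b \<odot> v"
  have uv: "u \<in> D" "v \<in> D" unfolding u_def v_def using R_domain na nb by auto
  have Au: "A u = - (of_real a \<odot> u) - x" using R_right[OF na, of x] unfolding u_def
    by (simp add: scale_minus_left algebra_simps)
  have Av: "A v = - (of_real b \<odot> v) - x" using R_right[OF nb, of x] unfolding v_def
    by (simp add: scale_minus_left algebra_simps)
  have yD: "y \<in> D" unfolding y_def using uv D_scale D_diff by blast
  have yA: "y = A (v - u)" unfolding A_diff[OF uv(2,1)] Au Av y_def by simp
  obtain C where C: "C \<ge> 0" "\<And>l. l \<noteq> 0 \<Longrightarrow> Re l \<le> cos \<nu> * cmod l \<Longrightarrow>
      norm (R l y - (1 / (l - 1)) \<odot> y) \<le> C / (1 + (cmod l)^2)"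
    using R_log_kernel_bound[OF nu yD yA D_diff[OF uv(2,1)]] by blast
  obtain s where s: "\<nu> < s" "s < pi" using dense[OF nu(2)] by blast
  have s0: "0 \<le> s" using s nu0 by simp
  obtain E where E: "E \<ge> 0" "\<And>z. z \<in> sector s \<Longrightarrow> cmod (wfun a b z) \<le> E * cmod z / (1 + (cmod z)^2)"
    using wfun_decay[OF s0 s(2) ab] by blast
  have decaying: "decaying s (\<lambda>l. wfun a b l \<odot> x)" by (rule decaying_const[OF wfun_holomorphic[OF s0 s(2) ab] E(2,1)])
  have t: "tame2 \<nu> (\<lambda>l. R l (wfun a b l \<odot> x))" by (rule tame2_R[OF nu(1) s decaying])
  define k where "k a l = 1 / (l + of_real a) - 1 / (l - 1)" for a :: real and l :: complex
  have "bnd_int J \<nu> (\<lambda>l. R l (wfun a b l \<odot> x)) = (2 * pi * \<i>) \<odot> W a b x"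
  proof (rule cfun_eqI)
    fix q assume q: "cfun q"
    obtain K where K: "K \<ge> 0" "\<And>x. cmod (q x) \<le> K * norm x" using cfun_bound[OF q] by blast
    define g where "g l = q (R l y - (1 / (l - 1)) \<odot> y)" for l
    have ghol: "g holomorphic_on outer om"
    proof -
      have "\<And>l. l \<in> outer om \<Longrightarrow> l - 1 \<noteq> 0" using one by auto
      then show ?thesis unfolding g_def cfun_diff[OF q] cfun_scale[OF q]
        by (intro holomorphic_on_diff R_holomorphic[OF q] holomorphic_intros) auto
    qed
    have gbd: "cmod (g l) \<le> K * C / (1 + (cmod l)^2)" if l: "l \<noteq> 0" "Re l \<le> cos \<nu> * cmod l" for l
    proof -
      have "cmod (g l) \<le> K * norm (R l y - (1 / (l - 1)) \<odot> y)" unfolding g_def by (rule K(2))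
      also have "\<dots> \<le> K * (C / (1 + (cmod l)^2))" using C(2)[OF l] K(1) by (rule mult_left_mono)
      finally show ?thesis by simp
    qed
    have g: "tame2 \<nu> g" "cbnd_int \<nu> g = 0"
      using cbnd_int_outer_zero[OF ghol om(1) nu gbd] by blast+
    note ka = tame2_log_kernel[OF ab(1) nu0 nu(2), folded k_def] and kb = tame2_log_kernel[OF ab(2) nu0 nu(2), folded k_def]
    have ta: "tame2 \<nu> (\<lambda>l. of_real a * q u * k a l)" by (rule tame2_bounded_linear[OF ka bounded_linear_mult_right])
    have tb: "tame2 \<nu> (\<lambda>l. of_real b * q v * k b l)" by (rule tame2_bounded_linear[OF kb bounded_linear_mult_right])
    have pt: "q (R l (wfun a b l \<odot> x)) = (of_real a * q u * k a l - of_real b * q v * k b l) - g l"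
      if l: "l \<in> outer om" "l \<in> sector s" for l
    proof -
      have na0: "of_real a + l \<noteq> 0" and nb0: "of_real b + l \<noteq> 0" using cmod_add_sector(2)[OF s0 s(2) l(2)] ab by auto
      have "l \<noteq> 1" using l(1) one by auto
      then have l1: "l - 1 \<noteq> 0" by simp
      have id: "q (R l x) = q (R (- of_real c) x) - (of_real c + l) * q (R l (R (- of_real c) x))"
        if c: "- of_real c \<in> outer om" for c
      proof -
        have "q (R l x) = q (R (- of_real c) x) + (- of_real c - l) * q (R (- of_real c) (R l x))"
          using arg_cong[OF resolvent_identity[OF c l(1), of x], of q] unfolding cfun_add[OF q] cfun_scale[OF q] .
        then show ?thesis unfolding R_commute[OF c l(1)] by (simp add: algebra_simps)
      qed
      have "q (R l (wfun a b l \<odot> x)) = wfun a b l * q (R l x)"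
        unfolding clinear_apply_scale[OF R_clinear[OF l(1)]] cfun_scale[OF q] ..
      also have "\<dots> = of_real a / (of_real a + l) * q (R l x) - of_real b / (of_real b + l) * q (R l x)"
        unfolding wfun_def by (simp add: algebra_simps)
      also have "of_real a / (of_real a + l) * q (R l x) = of_real a / (of_real a + l) * q u - of_real a * q (R l u)"
        unfolding id[OF na] u_def[symmetric] using na0 by (simp add: right_diff_distrib)
      also have "of_real b / (of_real b + l) * q (R l x) = of_real b / (of_real b + l) * q v - of_real b * q (R l v)"
        unfolding id[OF nb] v_def[symmetric] using nb0 by (simp add: right_diff_distrib)
      finally have 1: "q (R l (wfun a b l \<odot> x)) = of_real a / (of_real a + l) * q u - of_real a * q (R l u)
         - (of_real b / (of_real b + l) * q v - of_real b * q (R l v))" .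
      have "q y = of_real a * q u - of_real b * q v" unfolding y_def cfun_diff[OF q] cfun_scale[OF q] ..
      moreover have "q (R l y) = of_real a * q (R l u) - of_real b * q (R l v)"
        unfolding y_def clinear_diff[OF R_clinear[OF l(1)]] clinear_apply_scale[OF R_clinear[OF l(1)]]
          cfun_diff[OF q] cfun_scale[OF q] ..
      ultimately have 2: "g l = of_real a * q (R l u) - of_real b * q (R l v) - 1 / (l - 1) * (of_real a * q u - of_real b * q v)"
        unfolding g_def cfun_diff[OF q] cfun_scale[OF q] by simp
      show ?thesis unfolding 1 2 k_def by (simp add: algebra_simps)
    qed
    have "q (bnd_int J \<nu> (\<lambda>l. R l (wfun a b l \<odot> x))) = cbnd_int \<nu> (\<lambda>l. q (R l (wfun a b l \<odot> x)))"
      by (rule cfun_bnd_int[OF q t])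
    also have "\<dots> = cbnd_int \<nu> (\<lambda>l. (of_real a * q u * k a l - of_real b * q v * k b l) - g l)"
    proof -
      have "integral {0..} (\<lambda>t. q (R (ray t \<theta>) (wfun a b (ray t \<theta>) \<odot> x)))
         = integral {0..} (\<lambda>t. (of_real a * q u * k a (ray t \<theta>) - of_real b * q v * k b (ray t \<theta>)) - g (ray t \<theta>))"
        if "\<theta> = \<nu> \<or> \<theta> = - \<nu>" for \<theta>
        using that rays[OF nu(1) s] by (intro integral_cong_pos pt) auto
      then show ?thesis unfolding cbnd_int_def by simp
    qed
    also have "\<dots> = of_real a * q u * (- (2 * pi * \<i>)) - of_real b * q v * (- (2 * pi * \<i>)) - 0"
    proof -
      have 1: "cbnd_int \<nu> (\<lambda>l. (of_real a * q u * k a l - of_real b * q v * k b l) - g l)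
         = cbnd_int \<nu> (\<lambda>l. of_real a * q u * k a l - of_real b * q v * k b l) - cbnd_int \<nu> g"
        by (rule cbnd_int_diff[OF tame2_diff[OF ta tb] g(1)])
      have 2: "cbnd_int \<nu> (\<lambda>l. of_real a * q u * k a l - of_real b * q v * k b l)
         = of_real a * q u * cbnd_int \<nu> (k a) - of_real b * q v * cbnd_int \<nu> (k b)"
        unfolding cbnd_int_diff[OF ta tb] cbnd_int_mult ..
      have 3: "cbnd_int \<nu> (k c) = - (2 * pi * \<i>)" if "c > 0" for c
        using cbnd_int_log_kernel[OF that nu0 nu(2)] unfolding k_def[abs_def] .
      show ?thesis unfolding 1 2 3[OF ab(1)] 3[OF ab(2)] g(2) ..
    qed
    also have "\<dots> = q ((2 * pi * \<i>) \<odot> W a b x)"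
    proof -
      have "W a b x = of_real b \<odot> v - of_real a \<odot> u" unfolding W_def V_def u_def v_def by simp
      then have "q (W a b x) = of_real b * q v - of_real a * q u" by (simp only: cfun_diff[OF q] cfun_scale[OF q])
      then show ?thesis unfolding cfun_scale[OF q] by (simp only:) (simp add: algebra_simps)
    qed
    finally show "q (bnd_int J \<nu> (\<lambda>l. R l (wfun a b l \<odot> x))) = q ((2 * pi * \<i>) \<odot> W a b x)" .
  qed
  then show ?thesis unfolding ocalc_def by (simp add: scale_scale)
qed

end

section \<open>Approximate identities and the strong limit g(A)\<close>

lemma dense_strong_limit_zero:
  fixes S :: "nat \<Rightarrow> 'b::real_normed_vector \<Rightarrow> 'c::real_normed_vector"
  assumes X: "closure X = UNIV" and lip: "\<And>n x y. norm (S n x - S n y) \<le> M * norm (x - y)"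
    and lim: "\<And>x. x \<in> X \<Longrightarrow> (\<lambda>n. S n x) \<longlonglongrightarrow> 0"
  shows "(\<lambda>n. S n x) \<longlonglongrightarrow> 0"
proof (rule LIMSEQ_I)
  fix e :: real assume e: "e > 0"
  define c where "c = \<bar>M\<bar> + 1"
  have c: "c > 0" unfolding c_def by simp
  define d where "d = e / (2 * c)"
  have d: "d > 0" unfolding d_def using e c by simp
  obtain y where y: "y \<in> X" "dist y x < d" using X d closure_approachable[of x X] by auto
  obtain N where N: "\<And>n. n \<ge> N \<Longrightarrow> norm (S n y - 0) < e / 2" using LIMSEQ_D[OF lim[OF y(1)], of "e / 2"] e by auto
  have "norm (S n x - 0) < e" if n: "n \<ge> N" for n
  proof -
    have "norm (S n x - S n y) \<le> M * norm (x - y)" by (rule lip)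
    also have "\<dots> \<le> c * d" using y(2) c by (intro mult_mono) (auto simp: c_def dist_norm norm_minus_commute)
    also have "\<dots> = e / 2" unfolding d_def using c by simp
    finally have "norm (S n x - S n y) \<le> e / 2" .
    moreover have "norm (S n y) < e / 2" using N[OF n] by simp
    moreover have "norm (S n x) \<le> norm (S n x - S n y) + norm (S n y)"
      using norm_triangle_ineq[of "S n x - S n y" "S n y"] by simp
    ultimately show ?thesis by simp
  qed
  then show "\<exists>N. \<forall>n\<ge>N. norm (S n x - 0) < e" by blast
qed

context sectorial_op
begin

text \<open>On the domain \<open>V a x - x = - V a (A x) / a\<close>, which is O(1/a); the uniform
  bound on \<open>V a\<close> extends the limit from the dense domain.\<close>

lemma V_tendsto_id: "(\<lambda>n. V (real (Suc n)) x) \<longlonglongrightarrow> x"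
proof -
  obtain M where M: "M \<ge> 0" "\<And>a x. a > 0 \<Longrightarrow> norm (V a x) \<le> M * norm x" using V_bound by auto
  have "(\<lambda>n. V (real (Suc n)) x - x) \<longlonglongrightarrow> 0"
  proof (rule dense_strong_limit_zero[OF dense_domain])
    fix n x y
    have V: "V (real (Suc n)) x - V (real (Suc n)) y = V (real (Suc n)) (x - y)"
      using clinear_diff[OF V_clinear] by simp
    have "norm (V (real (Suc n)) (x - y)) \<le> M * norm (x - y)" by (rule M(2)) simp
    moreover have "(M + 1) * norm (x - y) = M * norm (x - y) + norm (x - y)" by (simp add: distrib_right)
    ultimately have "norm (V (real (Suc n)) (x - y) - (x - y)) \<le> (M + 1) * norm (x - y)"
      using norm_triangle_ineq4[of "V (real (Suc n)) (x - y)" "x - y"] by linarith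
    moreover have "(V (real (Suc n)) x - x) - (V (real (Suc n)) y - y) = V (real (Suc n)) (x - y) - (x - y)"
      unfolding V[symmetric] by simp
    ultimately show "norm ((V (real (Suc n)) x - x) - (V (real (Suc n)) y - y)) \<le> (M + 1) * norm (x - y)" by metis
  next
    fix x assume x: "x \<in> D"
    have "norm (V (real (Suc n)) x - x) \<le> M * norm (A x) * inverse (real (Suc n))" for n
    proof -
      define a where "a = real (Suc n)"
      have a: "a > 0" unfolding a_def by simp
      note o = neg_in_outer[OF a]
      have "R (- of_real a) (- of_real a \<odot> x - A x) = x" by (rule R_left[OF o x])
      then have "V a x - x = R (- of_real a) (A x)"
        unfolding V_def by (simp add: clinear_diff[OF R_clinear[OF o]] clinear_apply_scale[OF R_clinear[OF o]]
            scale_minus_left clinear_minus[OF R_clinear[OF o]] algebra_simps)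
      then have "V a (A x) = - (of_real a \<odot> (V a x - x))" unfolding V_def by simp
      then have "a * norm (V a x - x) \<le> M * norm (A x)" using M(2)[OF a, of "A x"] a by simp
      then show ?thesis unfolding a_def[symmetric] using a by (simp add: field_simps)
    qed
    moreover have "(\<lambda>n. M * norm (A x) * inverse (real (Suc n))) \<longlonglongrightarrow> 0"
      using tendsto_mult_right_zero[OF LIMSEQ_inverse_real_of_nat] .
    ultimately show "(\<lambda>n. V (real (Suc n)) x - x) \<longlonglongrightarrow> 0"
      by (rule Lim_null_comparison[OF always_eventually[OF allI]])
  qed
  then show ?thesis by (rule LIM_zero_cancel)
qed

text \<open>The same identity read on the dense range: \<open>V a (A y) = - a (V a y - y)\<close> is
  O(a) as \<open>a\<close> tends to 0.\<close>

lemma V_tendsto_zero: "(\<lambda>n. V (1 / real (Suc n)) x) \<longlonglongrightarrow> 0"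
proof -
  obtain M where M: "M \<ge> 0" "\<And>a x. a > 0 \<Longrightarrow> norm (V a x) \<le> M * norm x" using V_bound by auto
  show ?thesis
  proof (rule dense_strong_limit_zero[OF dense_range])
    fix n x y
    have "V (1 / real (Suc n)) x - V (1 / real (Suc n)) y = V (1 / real (Suc n)) (x - y)"
      using clinear_diff[OF V_clinear] by simp
    then show "norm (V (1 / real (Suc n)) x - V (1 / real (Suc n)) y) \<le> M * norm (x - y)"
      using M(2)[of "1 / real (Suc n)" "x - y"] by simp
  next
    fix x assume "x \<in> A ` D"
    then obtain y where y: "y \<in> D" "x = A y" by blast
    have "norm (V (1 / real (Suc n)) x) \<le> (M + 1) * norm y * inverse (real (Suc n))" for n
    proof -
      define a where "a = 1 / real (Suc n)"
      have a: "a > 0" unfolding a_def by simp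
      note o = neg_in_outer[OF a]
      have "R (- of_real a) (- of_real a \<odot> y - A y) = y" by (rule R_left[OF o y(1)])
      then have "V a y - y = R (- of_real a) (A y)"
        unfolding V_def by (simp add: clinear_diff[OF R_clinear[OF o]] clinear_apply_scale[OF R_clinear[OF o]]
            scale_minus_left clinear_minus[OF R_clinear[OF o]] algebra_simps)
      then have "V a x = - (of_real a \<odot> (V a y - y))" unfolding y(2) V_def by simp
      then have "norm (V a x) = a * norm (V a y - y)" using a by simp
      also have "\<dots> \<le> a * ((M + 1) * norm y)"
        using M(2)[OF a, of y] norm_triangle_ineq4[of "V a y" y] a by (intro mult_left_mono) (auto simp: distrib_right)
      finally show ?thesis unfolding a_def by (simp add: field_simps)
    qed
    moreover have "(\<lambda>n. (M + 1) * norm y * inverse (real (Suc n))) \<longlonglongrightarrow> 0"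
      using tendsto_mult_right_zero[OF LIMSEQ_inverse_real_of_nat] .
    ultimately show "(\<lambda>n. V (1 / real (Suc n)) x) \<longlonglongrightarrow> 0"
      by (rule Lim_null_comparison[OF always_eventually[OF allI]])
  qed
qed

text \<open>For \<open>n \<ge> 1\<close> this is phi_n(A) by \<open>phi_wfun\<close> and
  \<open>ocalc_wfun\<close>, written without a contour.\<close>

definition Phi :: "nat \<Rightarrow> 'a \<Rightarrow> 'a" where
  "Phi n = W (real n) (1 / real n)"

lemma Phi_clinear: "n \<ge> 1 \<Longrightarrow> clinear (Phi n)"
  unfolding Phi_def by (rule W_clinear) auto

lemma Phi_tendsto: "(\<lambda>n. Phi (Suc n) x) \<longlonglongrightarrow> x"
  using tendsto_diff[OF V_tendsto_id V_tendsto_zero] unfolding Phi_def W_def by simp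

lemma Phi_bound: "\<exists>M\<ge>0. \<forall>n\<ge>1. \<forall>x. norm (Phi n x) \<le> M * norm x"
proof -
  obtain M where M: "M \<ge> 0" "\<And>a x. a > 0 \<Longrightarrow> norm (V a x) \<le> M * norm x" using V_bound by auto
  have "norm (Phi n x) \<le> (2 * M) * norm x" if "n \<ge> 1" for n x
    unfolding Phi_def W_def
    using M(2)[of "real n" x] M(2)[of "1 / real n" x] norm_triangle_ineq4[of "V (real n) x" "V (1 / real n) x"] that by simp
  then show ?thesis using M(1) by (intro exI[of _ "2 * M"]) auto
qed

lemma Phi_ocalc:
  assumes "om < \<nu>" "\<nu> < s" "s < pi" "decaying s h" "n \<ge> 1"
  shows "Phi n (ocalc \<nu> h) = ocalc \<nu> (\<lambda>l. phi n l \<odot> h l)"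
  using W_ocalc(1)[OF assms(1-4), of "real n" "1 / real n"] assms(5) unfolding Phi_def phi_wfun[OF assms(5)] by simp

lemma phi_decay:
  assumes "0 \<le> s" "s < pi" "n \<ge> 1"
  shows "\<exists>C\<ge>0. \<forall>z\<in>sector s. cmod (phi n z) \<le> C * cmod z / (1 + (cmod z)^2)"
  unfolding phi_wfun[OF assms(3)] using assms by (intro wfun_decay) auto

lemma phi_holomorphic:
  assumes "0 \<le> s" "s < pi" "n \<ge> 1"
  shows "phi n holomorphic_on sector s"
  unfolding phi_wfun[OF assms(3)] using assms by (intro wfun_holomorphic) auto

lemma decaying_phi:
  assumes "0 \<le> s" "s < pi" "n \<ge> 1" and g: "g holomorphic_on sector s" "\<And>z. z \<in> sector s \<Longrightarrow> cmod (g z) \<le> K"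
  shows "decaying s (\<lambda>z. (phi n z * g z) \<odot> x)"
proof -
  obtain C where C: "C \<ge> 0" "\<And>z. z \<in> sector s \<Longrightarrow> cmod (phi n z) \<le> C * cmod z / (1 + (cmod z)^2)"
    using phi_decay[OF assms(1-3)] by blast
  have "decaying s (\<lambda>z. g z \<odot> (phi n z \<odot> x))"
    by (rule decaying_mult[OF decaying_const[OF phi_holomorphic[OF assms(1-3)] C(2,1)] g])
  then show ?thesis by (simp add: scale_scale mult.commute)
qed

text \<open>The \<open>min s pi\<close> in \<open>nu_of\<close> keeps the contour below pi even for
  \<open>s > pi\<close>; \<open>s1\<close> is the angle of a sector around the contour on which
  symbols can be estimated.\<close>

lemma nu_of_bounds:
  assumes "om < s"
  obtains s1 where "om < nu_of J D A s" "nu_of J D A s < s1" "s1 < pi" "s1 < s" "0 \<le> s1"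
proof -
  have m: "om < min s pi" using assms om by simp
  have nu: "om < nu_of J D A s" "nu_of J D A s < min s pi" unfolding nu_of_def using m by auto
  then obtain s1 where "nu_of J D A s < s1" "s1 < min s pi" using dense by blast
  then show ?thesis using that[of s1] nu om by auto
qed

text \<open>The symbol phi_m phi_k g is symmetric in m and k, so
  \<open>Phi m (F k x) = Phi k (F m x)\<close>. Hence the approximants converge, first on the
  vectors \<open>Phi m x\<close> and then everywhere by the uniform bound, and letting
  \<open>k\<close> grow identifies \<open>F n x\<close> as \<open>Phi n\<close> of the
  limit.\<close>

lemma fcalc_lim_factor:
  assumes s: "om < s" and g: "g holomorphic_on sector s" "\<And>z. z \<in> sector s \<Longrightarrow> cmod (g z) \<le> K"
    and H: "in_H J D A s g" and n: "n \<ge> 1"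
  shows "fcalc J D A s (\<lambda>z. phi n z * g z) x = Phi n (fcalc_lim J D A s g x)"
proof -
  define \<nu> where "\<nu> = nu_of J D A s"
  obtain s1 where nu: "om < \<nu>" "\<nu> < s1" "s1 < pi" and s1: "s1 < s" "0 \<le> s1"
    using nu_of_bounds[OF s] unfolding \<nu>_def by metis
  have sub: "sector s1 \<subseteq> sector s" using sector_mono s1 by simp
  define F where "F m x = fcalc J D A s (\<lambda>z. phi m z * g z) x" for m x
  have F: "F m x = ocalc \<nu> (\<lambda>l. (phi m l * g l) \<odot> x)" for m x
    unfolding F_def \<nu>_def by (rule fcalc_eq_ocalc[OF s])
  have decaying: "decaying s1 (\<lambda>z. (phi m z * g z) \<odot> x)" if "m \<ge> 1" for m x
    using g sub by (intro decaying_phi[OF s1(2) nu(3) that holomorphic_on_subset[OF g(1) sub]]) auto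
  have swap: "Phi m (F k x) = Phi k (F m x)" if "m \<ge> 1" "k \<ge> 1" for m k x
    unfolding F Phi_ocalc[OF nu decaying[OF that(2)] that(1)] Phi_ocalc[OF nu decaying[OF that(1)] that(2)]
    by (simp add: scale_scale mult_ac)
  have comm: "Phi m (F k x) = F k (Phi m x)" if m: "m \<ge> 1" and k: "k \<ge> 1" for m k x
  proof -
    have "Phi m (ocalc \<nu> (\<lambda>l. (phi k l * g l) \<odot> x)) = ocalc \<nu> (\<lambda>l. Phi m ((phi k l * g l) \<odot> x))"
      using m W_R_commute unfolding Phi_def by (intro ocalc_commute[OF nu decaying[OF k]] W_clinear) auto
    then show ?thesis unfolding F by (simp add: clinear_apply_scale[OF Phi_clinear[OF m]])
  qed
  have diff: "F k (x - y) = F k x - F k y" if k: "k \<ge> 1" for k x y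
  proof -
    have "F k x = F k ((x - y) + y)" by simp
    also have "\<dots> = F k (x - y) + F k y"
      unfolding F scale_add_right by (rule ocalc_add[OF nu decaying[OF k] decaying[OF k]])
    finally show ?thesis by simp
  qed
  obtain M where M: "\<And>k x. k \<ge> 1 \<Longrightarrow> norm (F k x) \<le> M * norm x" using H unfolding in_H_def F_def by auto
  \<comment> \<open>Convergence has to be proved, since only then does \<open>lim\<close> in
    \<open>fcalc_lim\<close> denote the limit. The index is shifted because \<open>phi 0\<close> is
    the constant -1 and has no decay.\<close>
  have conv: "convergent (\<lambda>k. F (Suc k) x)"
  proof (rule Cauchy_convergent, rule metric_CauchyI)
    fix e :: real assume e: "e > 0"
    define c where "c = \<bar>M\<bar> + 1"
    have c: "c > 0" unfolding c_def by simp
    define d where "d = e / (4 * c)"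
    have d: "d > 0" unfolding d_def using e c by simp
    obtain m where m: "norm (Phi (Suc m) x - x) < d" using LIMSEQ_D[OF Phi_tendsto d, of x] by blast
    define y where "y = Phi (Suc m) x"
    have "(\<lambda>k. F (Suc k) y) \<longlonglongrightarrow> F (Suc m) x"
    proof -
      have "F (Suc k) y = Phi (Suc k) (F (Suc m) x)" for k
        unfolding y_def using comm[of "Suc m" "Suc k" x] swap[of "Suc m" "Suc k" x] by simp
      then show ?thesis using Phi_tendsto by simp
    qed
    then have "Cauchy (\<lambda>k. F (Suc k) y)" by (rule LIMSEQ_imp_Cauchy)
    then obtain N where N: "\<And>i j. i \<ge> N \<Longrightarrow> j \<ge> N \<Longrightarrow> dist (F (Suc i) y) (F (Suc j) y) < e / 2"
      using e unfolding Cauchy_def by (meson half_gt_zero)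
    have close: "norm (F (Suc k) x - F (Suc k) y) \<le> e / 4" for k
    proof -
      have "norm (F (Suc k) x - F (Suc k) y) \<le> M * norm (x - y)" using M[of "Suc k" "x - y"] diff[of "Suc k" x y] by simp
      also have "\<dots> \<le> c * d" using m c unfolding y_def by (intro mult_mono) (auto simp: c_def norm_minus_commute)
      also have "\<dots> = e / 4" unfolding d_def using c by simp
      finally show ?thesis .
    qed
    have "dist (F (Suc i) x) (F (Suc j) x) < e" if "i \<ge> N" "j \<ge> N" for i j
    proof -
      have "dist (F (Suc i) x) (F (Suc j) x) \<le> dist (F (Suc i) x) (F (Suc i) y) + dist (F (Suc i) y) (F (Suc j) y) + dist (F (Suc j) y) (F (Suc j) x)"
        using dist_triangle[of "F (Suc i) x" "F (Suc j) x" "F (Suc i) y"] dist_triangle[of "F (Suc i) y" "F (Suc j) x" "F (Suc j) y"] by linarith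
      then show ?thesis using N[OF that] close[of i] close[of j] by (simp add: dist_norm norm_minus_commute)
    qed
    then show "\<exists>N. \<forall>i\<ge>N. \<forall>j\<ge>N. dist (F (Suc i) x) (F (Suc j) x) < e" by blast
  qed
  then have "(\<lambda>k. F (Suc k) x) \<longlonglongrightarrow> lim (\<lambda>k. F (Suc k) x)" by (simp add: convergent_LIMSEQ_iff)
  then have "(\<lambda>k. F k x) \<longlonglongrightarrow> lim (\<lambda>k. F (Suc k) x)" by (rule LIMSEQ_imp_Suc)
  then have L: "(\<lambda>k. F k x) \<longlonglongrightarrow> fcalc_lim J D A s g x"
    unfolding fcalc_lim_def F_def[symmetric] by (metis limI)
  then have "(\<lambda>k. F (Suc k) x) \<longlonglongrightarrow> fcalc_lim J D A s g x" by (rule LIMSEQ_Suc)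
  then have "(\<lambda>k. Phi n (F (Suc k) x)) \<longlonglongrightarrow> Phi n (fcalc_lim J D A s g x)"
    by (rule bounded_linear.tendsto[OF clinear_bounded_linear[OF Phi_clinear[OF n]]])
  moreover have "(\<lambda>k. Phi n (F (Suc k) x)) = (\<lambda>k. Phi (Suc k) (F n x))" using swap n by auto
  ultimately have "(\<lambda>k. Phi (Suc k) (F n x)) \<longlonglongrightarrow> Phi n (fcalc_lim J D A s g x)" by simp
  then show ?thesis using LIMSEQ_unique[OF _ Phi_tendsto] unfolding F_def by metis
qed

end

section \<open>Unconditional families in GT-spaces of cotype 2\<close>

text \<open>Carrier and scalar multiplication are parameters so that the space itself and its dual,
  a set of bounded real-linear maps with multiplication \<open>dual_sm\<close>, are covered by one
  argument.\<close>

definition unconditional ::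
  "'v::real_normed_vector set \<Rightarrow> (complex \<Rightarrow> 'v \<Rightarrow> 'v) \<Rightarrow> nat \<Rightarrow> (nat \<Rightarrow> 'v \<Rightarrow> 'v) \<Rightarrow> real \<Rightarrow> bool" where
  "unconditional V sm n S K \<longleftrightarrow> K \<ge> 0
     \<and> (\<forall>i<n. \<forall>v\<in>V. S i v \<in> V \<and> (\<forall>w\<in>V. S i (v + w) = S i v + S i w) \<and> (\<forall>c. S i (sm c v) = sm c (S i v)))
     \<and> (\<forall>\<alpha> v. (\<forall>i<n. cmod (\<alpha> i) \<le> 1) \<longrightarrow> v \<in> V \<longrightarrow> norm (\<Sum>i<n. sm (\<alpha> i) (S i v)) \<le> K * norm v)"

definition functional_bound ::
  "'v::real_normed_vector set \<Rightarrow> (complex \<Rightarrow> 'v \<Rightarrow> 'v) \<Rightarrow> real \<Rightarrow> ('v \<Rightarrow> complex) \<Rightarrow> bool" where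
  "functional_bound V sm B p \<longleftrightarrow> (\<forall>x\<in>V. \<forall>y\<in>V. p (x + y) = p x + p y)
     \<and> (\<forall>c. \<forall>x\<in>V. p (sm c x) = c * p x) \<and> (\<forall>x\<in>V. cmod (p x) \<le> B * norm x)"

lemma signs_card: "card (signs n) \<le> 2 ^ n"
proof -
  have "inj_on (\<lambda>e. {i. i < n \<and> e i = (1::real)}) (signs n)"
  proof (rule inj_onI, rule ext)
    fix e f i assume e: "e \<in> signs n" and f: "f \<in> signs n"
      and eq: "{i. i < n \<and> e i = (1::real)} = {i. i < n \<and> f i = 1}"
    then have iff: "i < n \<Longrightarrow> e i = 1 \<longleftrightarrow> f i = 1" by blast
    show "e i = f i"
    proof (cases "i < n")
      case True
      then have "e i = 1 \<or> e i = -1" "f i = 1 \<or> f i = -1" using e f unfolding signs_def by auto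
      then show ?thesis using iff[OF True] by metis
    qed (use e f in \<open>auto simp: signs_def\<close>)
  qed
  moreover have "(\<lambda>e. {i. i < n \<and> e i = (1::real)}) ` signs n \<subseteq> Pow {..<n}" by auto
  ultimately have "card (signs n) \<le> card (Pow {..<n})" by (intro card_inj_on_le) auto
  then show ?thesis by (simp add: card_Pow)
qed

lemma functional_sum:
  assumes "functional_bound V sm B p" "0 \<in> V" "\<And>x y. x \<in> V \<Longrightarrow> y \<in> V \<Longrightarrow> x + y \<in> V" "\<And>i. i < n \<Longrightarrow> x i \<in> V"
  shows "(\<Sum>i<(n::nat). x i) \<in> V \<and> p (\<Sum>i<n. x i) = (\<Sum>i<n. p (x i))"
  using assms(4)
proof (induction n)
  case 0
  have "p (0 + 0) = p 0 + p 0" using assms(1,2) unfolding functional_bound_def by blast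
  then show ?case using assms(2) by simp
next
  case (Suc n)
  then have "(\<Sum>i<n. x i) \<in> V" "x n \<in> V" "p (\<Sum>i<n. x i) = (\<Sum>i<n. p (x i))" by auto
  then show ?case using assms(1,3) unfolding functional_bound_def by simp
qed

lemma l2norm_finite_support:
  assumes "\<And>k. k \<ge> n \<Longrightarrow> y k = 0"
  shows "summable (\<lambda>k. cmod (y k) ^ 2)" "l2norm y = sqrt (\<Sum>k<n. cmod (y k) ^ 2)"
proof -
  show "summable (\<lambda>k. cmod (y k) ^ 2)" using assms by (intro summable_finite[of "{..<n}"]) auto
  have "(\<Sum>k. cmod (y k) ^ 2) = (\<Sum>k<n. cmod (y k) ^ 2)" using assms by (intro suminf_finite) auto
  then show "l2norm y = sqrt (\<Sum>k<n. cmod (y k) ^ 2)" unfolding l2norm_def by simp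
qed

text \<open>Cotype 2 makes \<open>v \<mapsto> (p\<^sub>i (S\<^sub>i v))\<^sub>i\<close> bounded into \<open>\<ell>\<^sub>2\<close>, hence absolutely summing, and the
  family \<open>S\<^sub>i y\<close> is weakly summable; the diagonal entries give the claim.\<close>
lemma GT_cotype2_sum:
  fixes V :: "'v::real_normed_vector set"
  assumes GT: "GT_space V sm" and ct: "cotype2 V"
    and V0: "0 \<in> V" and Vadd: "\<And>x y. x \<in> V \<Longrightarrow> y \<in> V \<Longrightarrow> x + y \<in> V"
    and Vsm: "\<And>c x. x \<in> V \<Longrightarrow> sm c x \<in> V" and sm_real: "\<And>r x. x \<in> V \<Longrightarrow> sm (of_real r) x = r *\<^sub>R x"
  shows "\<exists>C\<ge>0. \<forall>n S K B p y. unconditional V sm n S K \<longrightarrow> B \<ge> 0 \<longrightarrow> (\<forall>i<n. functional_bound V sm B (p i)) \<longrightarrow> y \<in> V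
     \<longrightarrow> (\<Sum>i<n. cmod (p i (S i (S i y)))) \<le> C * B * K^2 * norm y"
proof -
  obtain C1 where C1: "\<forall>T. bdd_l2_op V sm T \<longrightarrow> (\<forall>n (x::nat \<Rightarrow> 'v). (\<forall>i<n. x i \<in> V) \<longrightarrow>
      (\<Sum>i<n. l2norm (T (x i))) \<le> C1 * l2_opnorm V T * weak1 V sm x n)"
    using GT unfolding GT_space_def by (elim exE)
  obtain C2 where C2: "\<forall>n (x::nat \<Rightarrow> 'v). (\<forall>i<n. x i \<in> V) \<longrightarrow>
      (\<Sum>i<n. norm (x i) ^ 2) \<le> C2 * ((\<Sum>e\<in>signs n. norm (\<Sum>i<n. e i *\<^sub>R x i) ^ 2) / 2 ^ n)"
    using ct unfolding cotype2_def by (elim exE)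
  have main: "(\<Sum>i<n. cmod (p i (S i (S i y)))) \<le> (\<bar>C1\<bar> * sqrt \<bar>C2\<bar>) * B * K^2 * norm y"
    if S: "unconditional V sm n S K" and B: "B \<ge> 0" and p: "\<And>i. i < n \<Longrightarrow> functional_bound V sm B (p i)" and y: "y \<in> V"
    for n S K B p y
  proof -
    have K: "K \<ge> 0" using S unfolding unconditional_def by blast
    have SV: "S i v \<in> V" if "i < n" "v \<in> V" for i v using S that unfolding unconditional_def by blast
    have Sadd: "S i (v + w) = S i v + S i w" if "i < n" "v \<in> V" "w \<in> V" for i v w
      using S that unfolding unconditional_def by blast
    have Ssm: "S i (sm c v) = sm c (S i v)" if "i < n" "v \<in> V" for i c v
      using S that unfolding unconditional_def by blast
    have SK: "norm (\<Sum>i<n. sm (\<alpha> i) (S i v)) \<le> K * norm v" if "\<And>i. i < n \<Longrightarrow> cmod (\<alpha> i) \<le> 1" "v \<in> V" for \<alpha> v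
      using S that unfolding unconditional_def by blast
    \<comment> \<open>Choosing signs as coefficients of the unconditional family bounds every term
      of the average by \<open>(K * norm v)^2\<close>; cotype 2 converts the average into a sum of
      squares.\<close>
    have square: "(\<Sum>i<n. norm (S i v) ^ 2) \<le> \<bar>C2\<bar> * (K * norm v)^2" if v: "v \<in> V" for v
    proof -
      define X where "X = (\<Sum>e\<in>signs n. norm (\<Sum>i<n. e i *\<^sub>R S i v) ^ 2)"
      have X0: "X \<ge> 0" unfolding X_def by (intro sum_nonneg) auto
      have "X \<le> of_nat (card (signs n)) * (K * norm v)^2"
        unfolding X_def
      proof (rule sum_bounded_above)
        fix e assume e: "e \<in> signs n"
        have "(\<Sum>i<n. e i *\<^sub>R S i v) = (\<Sum>i<n. sm (of_real (e i)) (S i v))"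
          using sm_real SV v by (intro sum.cong) auto
        moreover have "norm (\<Sum>i<n. sm (of_real (e i)) (S i v)) \<le> K * norm v"
          using e by (intro SK v) (auto simp: signs_def)
        ultimately show "norm (\<Sum>i<n. e i *\<^sub>R S i v) ^ 2 \<le> (K * norm v)^2" by (intro power_mono) auto
      qed
      also have "\<dots> \<le> of_nat (2 ^ n) * (K * norm v)^2" using signs_card[of n] by (intro mult_right_mono of_nat_mono) auto
      finally have X: "X / 2 ^ n \<le> (K * norm v)^2" by (simp add: field_simps)
      have "(\<Sum>i<n. norm (S i v) ^ 2) \<le> C2 * (X / 2 ^ n)" unfolding X_def using SV v by (intro C2[rule_format]) auto
      also have "\<dots> \<le> \<bar>C2\<bar> * (X / 2 ^ n)" using X0 by (intro mult_right_mono) auto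
      also have "\<dots> \<le> \<bar>C2\<bar> * (K * norm v)^2" using X by (intro mult_left_mono) auto
      finally show ?thesis .
    qed
    \<comment> \<open>Filled up with zeros beyond \<open>n\<close>, so that the finite family of
      functionals becomes an operator into l2.\<close>
    define T where "T v k = (if k < n then p k (S k v) else 0)" for v k
    have supp: "\<And>k. k \<ge> n \<Longrightarrow> T v k = 0" for v unfolding T_def by simp
    have l2T: "l2norm (T v) = sqrt (\<Sum>k<n. cmod (T v k) ^ 2)" for v
      by (rule l2norm_finite_support(2)[OF supp])
    \<comment> \<open>\<open>B\<close> comes from the functionals, the square root from the cotype
      constant, \<open>K\<close> from unconditionality. Absolute values are taken of
      \<open>C1\<close> and \<open>C2\<close> because the definitions do not prescribe their
      signs.\<close>
    define N where "N = B * sqrt \<bar>C2\<bar> * K"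
    have N0: "N \<ge> 0" unfolding N_def using B K by simp
    have Tb: "l2norm (T v) \<le> N * norm v" if v: "v \<in> V" for v
    proof -
      have "(\<Sum>k<n. cmod (T v k) ^ 2) \<le> (\<Sum>k<n. B^2 * norm (S k v) ^ 2)"
      proof (rule sum_mono)
        fix k assume "k \<in> {..<n}"
        then have "cmod (T v k) \<le> B * norm (S k v)" using p SV v unfolding T_def functional_bound_def by simp
        then show "cmod (T v k) ^ 2 \<le> B^2 * norm (S k v) ^ 2" by (metis norm_ge_zero power_mono power_mult_distrib)
      qed
      also have "\<dots> = B^2 * (\<Sum>k<n. norm (S k v) ^ 2)" by (simp add: sum_distrib_left)
      also have "\<dots> \<le> B^2 * (\<bar>C2\<bar> * (K * norm v)^2)" using square[OF v] by (intro mult_left_mono) auto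
      also have "\<dots> = (N * norm v)^2" unfolding N_def by (simp add: power_mult_distrib)
      finally have "sqrt (\<Sum>k<n. cmod (T v k) ^ 2) \<le> N * norm v" using N0 by (intro real_le_lsqrt) (auto intro: sum_nonneg)
      then show ?thesis unfolding l2T .
    qed
    have bdd: "bdd_l2_op V sm T"
      unfolding bdd_l2_op_def
    proof (intro conjI ballI allI)
      show "summable (\<lambda>k. cmod (T x k) ^ 2)" for x by (rule l2norm_finite_support(1)[OF supp])
      show "T (x + z) = (\<lambda>k. T x k + T z k)" if "x \<in> V" "z \<in> V" for x z
        using p Sadd SV that unfolding T_def functional_bound_def by (intro ext) simp
      show "T (sm c x) = (\<lambda>k. c * T x k)" if "x \<in> V" for c x
        using p Ssm SV that unfolding T_def functional_bound_def by (intro ext) simp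
      show "\<exists>M. \<forall>x\<in>V. l2norm (T x) \<le> M * norm x" using Tb by blast
    qed
    have op: "0 \<le> l2_opnorm V T" "l2_opnorm V T \<le> N"
      unfolding l2_opnorm_def using Tb N0 by (intro cInf_greatest cInf_lower; auto intro: bdd_belowI[of _ 0])+
    have wk: "(\<Sum>i<n. cmod (r (S i y))) \<le> K * norm y" if r: "r \<in> dual_ball V sm" for r
    proof -
      have r1: "functional_bound V sm 1 r" using r unfolding dual_ball_def functional_bound_def by simp
      \<comment> \<open>Phases that turn the sum of moduli into the value of \<open>r\<close> at a
        single vector, of the form bounded by unconditionality.\<close>
      define \<alpha> where "\<alpha> i = (if r (S i y) = 0 then 0 else cnj (r (S i y)) / cmod (r (S i y)))" for i
      have \<alpha>: "cmod (\<alpha> i) \<le> 1" "\<alpha> i * r (S i y) = cmod (r (S i y))" for i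
        unfolding \<alpha>_def by (auto simp: norm_divide complex_norm_square[symmetric] power2_eq_square mult.commute)
      have "of_real (\<Sum>i<n. cmod (r (S i y))) = (\<Sum>i<n. r (sm (\<alpha> i) (S i y)))"
        using r1 SV y \<alpha>(2) unfolding functional_bound_def by simp
      also have "\<dots> = r (\<Sum>i<n. sm (\<alpha> i) (S i y))"
        using functional_sum[OF r1 V0 Vadd, of n "\<lambda>i. sm (\<alpha> i) (S i y)"] SV y Vsm by simp
      finally have "of_real (\<Sum>i<n. cmod (r (S i y))) = r (\<Sum>i<n. sm (\<alpha> i) (S i y))" .
      then have "\<bar>\<Sum>i<n. cmod (r (S i y))\<bar> = cmod (r (\<Sum>i<n. sm (\<alpha> i) (S i y)))" by (metis norm_of_real)
      also have "\<dots> \<le> 1 * norm (\<Sum>i<n. sm (\<alpha> i) (S i y))"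
      proof -
        have "(\<Sum>i<n. sm (\<alpha> i) (S i y)) \<in> V"
          using functional_sum[OF r1 V0 Vadd, of n "\<lambda>i. sm (\<alpha> i) (S i y)"] SV y Vsm by simp
        then show ?thesis using r1 unfolding functional_bound_def by blast
      qed
      also have "\<dots> \<le> K * norm y" using SK[OF \<alpha>(1) y] by simp
      finally show ?thesis by simp
    qed
    have zero: "(\<lambda>_. 0) \<in> dual_ball V sm" unfolding dual_ball_def by simp
    have bw: "bdd_above ((\<lambda>r. \<Sum>i<n. cmod (r (S i y))) ` dual_ball V sm)" using wk by (intro bdd_aboveI2)
    have w: "0 \<le> weak1 V sm (\<lambda>i. S i y) n" "weak1 V sm (\<lambda>i. S i y) n \<le> K * norm y"
      unfolding weak1_def using cSUP_upper[OF zero bw] wk zero by (auto intro!: cSUP_least)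
    have "(\<Sum>i<n. cmod (p i (S i (S i y)))) \<le> (\<Sum>i<n. l2norm (T (S i y)))"
    proof (rule sum_mono)
      fix i assume i: "i \<in> {..<n}"
      have "cmod (p i (S i (S i y))) ^ 2 \<le> (\<Sum>k<n. cmod (T (S i y) k) ^ 2)"
        using member_le_sum[of i "{..<n}" "\<lambda>k. cmod (T (S i y) k) ^ 2"] i unfolding T_def by simp
      then show "cmod (p i (S i (S i y))) \<le> l2norm (T (S i y))"
        unfolding l2T by (rule real_le_rsqrt)
    qed
    also have "\<dots> \<le> C1 * l2_opnorm V T * weak1 V sm (\<lambda>i. S i y) n" using SV y by (intro C1[rule_format, OF bdd]) auto
    also have "\<dots> \<le> \<bar>C1\<bar> * N * (K * norm y)"
      using op w N0 by (intro mult_mono) auto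
    also have "\<dots> = (\<bar>C1\<bar> * sqrt \<bar>C2\<bar>) * B * K^2 * norm y" unfolding N_def by (simp add: power2_eq_square)
    finally show ?thesis .
  qed
  then show ?thesis by (intro exI[of _ "\<bar>C1\<bar> * sqrt \<bar>C2\<bar>"]) auto
qed

context complex_structure
begin

lemma dualsp_cfun: "r \<in> dualsp J \<longleftrightarrow> cfun (blinfun_apply r)"
  unfolding dualsp_def cfun_def by (simp add: blinfun.bounded_linear_right)

lemma dual_sm_apply: "blinfun_apply (dual_sm c r) x = c * blinfun_apply r x"
  unfolding dual_sm_def
  by (simp add: bounded_linear_Blinfun_apply bounded_linear_const_mult blinfun.bounded_linear_right)

text \<open>The constant is fixed before the number of operators and the families are, so the
  estimate survives an unlimited extension of the range of scales. \<open>K\<close> enters squared: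
  once through the norm of the l2 operator, once through weak summability.\<close>

lemma GT_sum:
  assumes "(GT_space (UNIV :: 'a set) (cscale J) \<and> cotype2 (UNIV :: 'a set))
         \<or> (GT_space (dualsp J) dual_sm \<and> cotype2 (dualsp J))"
  shows "\<exists>C\<ge>0. \<forall>(n::nat) S T K M q x. (\<forall>i<n. clinear (S i)) \<longrightarrow> (\<forall>i<n. clinear (T i)) \<longrightarrow>
     (\<forall>i<n. \<forall>x. S i (T i x) = T i (S i x)) \<longrightarrow> K \<ge> 0 \<longrightarrow> M \<ge> 0 \<longrightarrow>
     (\<forall>\<alpha> x. (\<forall>i<n. cmod (\<alpha> i) \<le> 1) \<longrightarrow> norm (\<Sum>i<n. \<alpha> i \<odot> S i x) \<le> K * norm x) \<longrightarrow>
     (\<forall>i<n. \<forall>x. norm (T i x) \<le> M * norm x) \<longrightarrow> cfun q \<longrightarrow> (\<forall>x. cmod (q x) \<le> norm x) \<longrightarrow>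
     (\<Sum>i<n. cmod (q (S i (S i (T i x))))) \<le> C * M * K^2 * norm x"
  using assms
proof
  assume "GT_space (UNIV :: 'a set) (cscale J) \<and> cotype2 (UNIV :: 'a set)"
  then have "\<exists>C\<ge>0. \<forall>n S K B p y. unconditional UNIV (cscale J) n S K \<longrightarrow> B \<ge> 0 \<longrightarrow>
      (\<forall>i<n. functional_bound UNIV (cscale J) B (p i)) \<longrightarrow> y \<in> UNIV \<longrightarrow>
      (\<Sum>i<n. cmod (p i (S i (S i (y::'a))))) \<le> C * B * K^2 * norm y"
    by (intro GT_cotype2_sum) (auto simp: scale_of_real)
  then obtain C where C: "C \<ge> 0" "\<forall>n S K B p y. unconditional UNIV (cscale J) n S K \<longrightarrow> B \<ge> 0 \<longrightarrow>
      (\<forall>i<n. functional_bound UNIV (cscale J) B (p i)) \<longrightarrow> y \<in> UNIV \<longrightarrow>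
      (\<Sum>i<n. cmod (p i (S i (S i (y::'a))))) \<le> C * B * K^2 * norm y" by (elim exE conjE)
  show ?thesis
  proof (intro exI[of _ C] conjI allI impI C(1))
    fix n :: nat and S T :: "nat \<Rightarrow> 'a \<Rightarrow> 'a" and K M :: real and q :: "'a \<Rightarrow> complex" and x
    assume S: "\<forall>i<n. clinear (S i)" and T: "\<forall>i<n. clinear (T i)" and comm: "\<forall>i<n. \<forall>x. S i (T i x) = T i (S i x)"
      and K: "0 \<le> K" and M: "0 \<le> M" and unc: "\<forall>\<alpha> x. (\<forall>i<n. cmod (\<alpha> i) \<le> 1) \<longrightarrow> norm (\<Sum>i<n. \<alpha> i \<odot> S i x) \<le> K * norm x"
      and TM: "\<forall>i<n. \<forall>x. norm (T i x) \<le> M * norm x" and q: "cfun q" "\<forall>x. cmod (q x) \<le> norm x"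
    have u: "unconditional UNIV (cscale J) n S K"
      unfolding unconditional_def using S K unc by (simp add: clinear_add clinear_apply_scale)
    have "functional_bound UNIV (cscale J) M (\<lambda>x. q (T i x))" if i: "i < n" for i
    proof -
      have "cmod (q (T i x)) \<le> M * norm x" for x using order_trans[OF q(2)[rule_format, of "T i x"]] TM i by blast
      then show ?thesis unfolding functional_bound_def using T i
        by (simp add: clinear_add clinear_apply_scale cfun_add[OF q(1)] cfun_scale[OF q(1)])
    qed
    then have "(\<Sum>i<n. cmod (q (T i (S i (S i x))))) \<le> C * M * K^2 * norm x"
      using C(2)[rule_format, OF u M, of "\<lambda>i x. q (T i x)" x] by simp
    then show "(\<Sum>i<n. cmod (q (S i (S i (T i x))))) \<le> C * M * K^2 * norm x" using comm by simp
  qed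
next
  assume "GT_space (dualsp J) dual_sm \<and> cotype2 (dualsp J)"
  then have G: "GT_space (dualsp J) dual_sm" "cotype2 (dualsp J)" by auto
  have d0: "0 \<in> dualsp J" unfolding dualsp_def by simp
  have d1: "x + y \<in> dualsp J" if "x \<in> dualsp J" "y \<in> dualsp J" for x y
    using that unfolding dualsp_def by (simp add: blinfun.add_left distrib_left)
  have d2: "dual_sm c x \<in> dualsp J" if "x \<in> dualsp J" for c x
    using that unfolding dualsp_def by (simp add: dual_sm_apply)
  have d3: "dual_sm (of_real r) x = r *\<^sub>R x" if "x \<in> dualsp J" for r x
    by (rule blinfun_eqI) (simp add: dual_sm_apply blinfun.scaleR_left scaleR_conv_of_real)
  have "\<exists>C\<ge>0. \<forall>n S K B p y. unconditional (dualsp J) dual_sm n S K \<longrightarrow> B \<ge> 0 \<longrightarrow>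
      (\<forall>i<n. functional_bound (dualsp J) dual_sm B (p i)) \<longrightarrow> y \<in> dualsp J \<longrightarrow>
      (\<Sum>i<n. cmod (p i (S i (S i y)))) \<le> C * B * K^2 * norm y"
    by (rule GT_cotype2_sum[OF G d0]) (use d1 d2 d3 in auto)
  then obtain C where C: "C \<ge> 0" "\<forall>n S K B p y. unconditional (dualsp J) dual_sm n S K \<longrightarrow> B \<ge> 0 \<longrightarrow>
      (\<forall>i<n. functional_bound (dualsp J) dual_sm B (p i)) \<longrightarrow> y \<in> dualsp J \<longrightarrow>
      (\<Sum>i<n. cmod (p i (S i (S i y)))) \<le> C * B * K^2 * norm y" by (elim exE conjE)
  show ?thesis
  proof (intro exI[of _ C] conjI allI impI C(1))
    fix n :: nat and S T :: "nat \<Rightarrow> 'a \<Rightarrow> 'a" and K M :: real and q :: "'a \<Rightarrow> complex" and x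
    assume S: "\<forall>i<n. clinear (S i)" and T: "\<forall>i<n. clinear (T i)" and comm: "\<forall>i<n. \<forall>x. S i (T i x) = T i (S i x)"
      and K: "0 \<le> K" and M: "0 \<le> M" and unc: "\<forall>\<alpha> x. (\<forall>i<n. cmod (\<alpha> i) \<le> 1) \<longrightarrow> norm (\<Sum>i<n. \<alpha> i \<odot> S i x) \<le> K * norm x"
      and TM: "\<forall>i<n. \<forall>x. norm (T i x) \<le> M * norm x" and q: "cfun q" "\<forall>x. cmod (q x) \<le> norm x"
    \<comment> \<open>Adjoints. In this case \<open>q\<close> takes the part of the vector, and
      \<open>x\<close> moves into the functionals, whose bound becomes
      \<open>M * norm x\<close>.\<close>
    define S' where "S' i r = Blinfun (\<lambda>x. blinfun_apply r (S i x))" for i and r :: "'a \<Rightarrow>\<^sub>L complex"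
    have S': "blinfun_apply (S' i r) z = blinfun_apply r (S i z)" if "i < n" for i r z
      unfolding S'_def using S that
      by (subst bounded_linear_Blinfun_apply) (auto intro!: blinfun.bounded_linear_right bounded_linear_compose[OF blinfun.bounded_linear_right] clinear_bounded_linear)
    have u: "unconditional (dualsp J) dual_sm n S' K"
      unfolding unconditional_def
    proof (intro conjI allI impI ballI K)
      fix i r assume i: "i < n" and r: "r \<in> dualsp J"
      have "clinear (S i)" using S i by blast
      then show "S' i r \<in> dualsp J" using r i unfolding dualsp_def by (simp add: S' clinear_apply_scale)
      show "S' i (r + w) = S' i r + S' i w" for w
        by (rule blinfun_eqI) (simp add: S'[OF i] blinfun.add_left)
      show "S' i (dual_sm c r) = dual_sm c (S' i r)" for c
        by (rule blinfun_eqI) (simp add: S'[OF i] dual_sm_apply)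
    next
      fix \<alpha> r assume \<alpha>: "\<forall>i<n. cmod (\<alpha> i) \<le> 1" and r: "r \<in> dualsp J"
      show "norm (\<Sum>i<n. dual_sm (\<alpha> i) (S' i r)) \<le> K * norm r"
      proof (rule norm_blinfun_bound)
        fix z
        have cr: "cfun (blinfun_apply r)" using r dualsp_cfun by blast
        have "blinfun_apply (\<Sum>i<n. dual_sm (\<alpha> i) (S' i r)) z = blinfun_apply r (\<Sum>i<n. \<alpha> i \<odot> S i z)"
          by (simp add: blinfun.sum_left dual_sm_apply S' cfun_sum[OF cr] cfun_scale[OF cr])
        also have "norm \<dots> \<le> norm r * (K * norm z)"
          using unc \<alpha> by (intro order_trans[OF norm_blinfun] mult_left_mono) auto
        finally show "norm (blinfun_apply (\<Sum>i<n. dual_sm (\<alpha> i) (S' i r)) z) \<le> K * norm r * norm z" by (simp add: mult_ac)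
      qed (use K in simp)
    qed
    have f: "functional_bound (dualsp J) dual_sm (M * norm x) (\<lambda>r. blinfun_apply r (T i x))" if i: "i < n" for i
      unfolding functional_bound_def
    proof (intro conjI ballI allI)
      fix r :: "'a \<Rightarrow>\<^sub>L complex"
      have "norm (blinfun_apply r (T i x)) \<le> norm r * (M * norm x)"
        using TM i by (intro order_trans[OF norm_blinfun] mult_left_mono) auto
      then show "cmod (blinfun_apply r (T i x)) \<le> M * norm x * norm r" by (simp add: mult_ac)
    qed (simp_all add: blinfun.add_left dual_sm_apply)
    define Q where "Q = Blinfun q"
    have Q: "blinfun_apply Q = q" unfolding Q_def using q(1) bounded_linear_Blinfun_apply cfun_bounded_linear by blast
    have QJ: "Q \<in> dualsp J" using q(1) unfolding dualsp_cfun Q .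
    have Qn: "norm Q \<le> 1" using q(2) by (intro norm_blinfun_bound) (auto simp: Q)
    have "(\<Sum>i<n. cmod (blinfun_apply (S' i (S' i Q)) (T i x))) \<le> C * (M * norm x) * K^2 * norm Q"
      using f M by (intro C(2)[rule_format, OF u _ _ QJ]) auto
    also have "\<dots> \<le> C * (M * norm x) * K^2 * 1" using Qn C(1) M by (intro mult_left_mono) auto
    finally show "(\<Sum>i<n. cmod (q (S i (S i (T i x))))) \<le> C * M * K^2 * norm x" by (simp add: S' Q mult_ac)
  qed
qed

end

section \<open>Boundedness of the operator-valued functional calculus\<close>

lemma tame_dominated:
  fixes f :: "nat \<Rightarrow> real \<Rightarrow> complex"
  assumes "\<And>n. tame (f n)" "\<And>n t. t > 0 \<Longrightarrow> cmod (f n t) \<le> C / (1 + t^2)"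
    and "\<And>t. t > 0 \<Longrightarrow> (\<lambda>n. f n t) \<longlonglongrightarrow> g t"
  shows "(\<lambda>n. integral {0..} (f n)) \<longlonglongrightarrow> integral {0..} g"
proof -
  define f0 where "f0 n t = (if t = 0 then 0 else f n t)" for n t
  define g0 where "g0 t = (if t = 0 then 0 else g t)" for t
  have C0: "C \<ge> 0" using order_trans[OF norm_ge_zero assms(2)[of 1]] by simp
  have eq: "integral {0..} (f n) = integral {0..} (f0 n)" "integral {0..} g = integral {0..} g0" for n
    by (auto intro!: integral_cong_pos simp: f0_def g0_def)
  have "(\<lambda>n. integral {0..} (f0 n)) \<longlonglongrightarrow> integral {0..} g0"
  proof (rule dominated_convergence(2))
    show "f0 n integrable_on {0..}" for n
    proof (rule integrable_spike[OF tame_integrable[OF assms(1)[of n]], of "{0}"])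
    qed (auto simp: f0_def)
    show "(\<lambda>t. C * (1 / (1 + t^2))) integrable_on {0..}"
      using integrable_cmul[OF arctan_kernel(1), of C] by simp
    show "norm (f0 n t) \<le> C * (1 / (1 + t^2))" if "t \<in> {0..}" for n t
      using assms(2)[of t n] that C0 by (cases "t = 0") (auto simp: f0_def)
    show "(\<lambda>n. f0 n t) \<longlonglongrightarrow> g0 t" if "t \<in> {0..}" for t
      using assms(3)[of t] that by (cases "t = 0") (auto simp: f0_def g0_def)
  qed
  then show ?thesis unfolding eq .
qed

lemma cbnd_int_dominated:
  assumes "\<And>n. tame2 \<nu> (f n)"
    and "\<And>n t \<theta>. t > 0 \<Longrightarrow> \<theta> = \<nu> \<or> \<theta> = - \<nu> \<Longrightarrow> cmod (f n (ray t \<theta>)) \<le> C / (1 + t^2)"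
    and "\<And>t \<theta>. t > 0 \<Longrightarrow> \<theta> = \<nu> \<or> \<theta> = - \<nu> \<Longrightarrow> (\<lambda>n. f n (ray t \<theta>)) \<longlonglongrightarrow> g (ray t \<theta>)"
  shows "(\<lambda>n. cbnd_int \<nu> (f n)) \<longlonglongrightarrow> cbnd_int \<nu> g"
proof -
  have "(\<lambda>n. integral {0..} (\<lambda>t. f n (ray t \<theta>))) \<longlonglongrightarrow> integral {0..} (\<lambda>t. g (ray t \<theta>))"
    if th: "\<theta> = \<nu> \<or> \<theta> = - \<nu>" for \<theta>
  proof (rule tame_dominated[OF _ assms(2)[OF _ th] assms(3)[OF _ th]])
    show "tame (\<lambda>t. f n (ray t \<theta>))" for n using assms(1)[of n] th unfolding tame2_def by blast
  qed
  then show ?thesis unfolding cbnd_int_def by (intro tendsto_add tendsto_mult tendsto_const) auto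
qed

text \<open>With \<open>r = cmod z\<close>, each term is at most a constant times the increment of
  \<open>\<tau> i / (r + \<tau> i)\<close>. These increments telescope inside [0, 1], so the bound
  depends neither on the number of scales nor on \<open>z\<close>.\<close>

lemma wfun_sum_bound:
  assumes s: "0 \<le> s" "s < pi" and z: "z \<in> sector s" and \<tau>: "\<And>i. \<tau> i > 0" "\<And>i. \<tau> i \<le> \<tau> (Suc i)"
  shows "(\<Sum>i<n. cmod (wfun (\<tau> (Suc i)) (\<tau> i) z)) \<le> 1 / (angle_const s)^2"
proof -
  note k = angle_const_pos[OF s]
  define r where "r = cmod z"
  have r: "r > 0" unfolding r_def using z sector_pos by simp
  define u where "u i = \<tau> i / (r + \<tau> i)" for i
  have "cmod (wfun (\<tau> (Suc i)) (\<tau> i) z) \<le> 1 / (angle_const s)^2 * (u (Suc i) - u i)" for i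
  proof -
    have p: "r + \<tau> i > 0" "r + \<tau> (Suc i) > 0" using r \<tau>(1)[of i] \<tau>(1)[of "Suc i"] by linarith+
    have "u (Suc i) - u i = (\<tau> (Suc i) - \<tau> i) * r / ((r + \<tau> (Suc i)) * (r + \<tau> i))"
      unfolding u_def using p by (simp add: field_simps)
    moreover have "\<bar>\<tau> (Suc i) - \<tau> i\<bar> = \<tau> (Suc i) - \<tau> i" using \<tau>(2)[of i] by simp
    ultimately show ?thesis using wfun_bound[OF s z \<tau>(1)[of "Suc i"] \<tau>(1)[of i]] unfolding r_def by simp
  qed
  then have "(\<Sum>i<n. cmod (wfun (\<tau> (Suc i)) (\<tau> i) z)) \<le> (\<Sum>i<n. 1 / (angle_const s)^2 * (u (Suc i) - u i))"
    by (intro sum_mono)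
  also have "\<dots> = 1 / (angle_const s)^2 * (u n - u 0)"
    unfolding sum_distrib_left[symmetric] sum_lessThan_telescope ..
  also have "\<dots> \<le> 1 / (angle_const s)^2 * 1"
  proof (rule mult_left_mono)
    have "u n \<le> 1" "u 0 \<ge> 0" unfolding u_def using r \<tau>(1)[of n] \<tau>(1)[of 0] by (auto simp: divide_le_eq_1)
    then show "u n - u 0 \<le> 1" by linarith
  qed simp
  finally show ?thesis by simp
qed

section \<open>A polynomial partition of unity over dyadic scales\<close>

definition smoothstep :: "complex \<Rightarrow> complex" where
  "smoothstep v = v^3 * (10 - 15 * v + 6 * v^2)"

text \<open>With \<open>x = v + t * w\<close> and \<open>w * (1 + v) = v * (1 - v)\<close> one has
  \<open>x * (1 - x) = w * ((1 + v) + t * (1 - 2 * v) - t^2 * w)\<close>. The coefficients arise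
  from integrating 30 times the square of the bracket over t in [0, 1].\<close>

definition smoothstep_quot :: "complex \<Rightarrow> complex \<Rightarrow> complex" where
  "smoothstep_quot v w = 30 * (1 + v)^2 + 10 * (1 - 2 * v)^2 + 6 * w^2 + 30 * ((1 + v) * (1 - 2 * v))
     - 20 * (w * (1 + v)) - 15 * (w * (1 - 2 * v))"

text \<open>\<open>smoothstep\<close> is the primitive of \<open>30 v\<^sup>2 (1 - v)\<^sup>2\<close>, and \<open>w (1 + v) = v (1 - v)\<close> makes
  \<open>x (1 - x)\<close> divisible by \<open>w\<close> for every \<open>x\<close> between \<open>v\<close> and \<open>v + w\<close>.\<close>
lemma smoothstep_diff:
  assumes "w * (1 + v) = v * (1 - v)"
  shows "smoothstep (v + w) - smoothstep v = w * (w * (w * smoothstep_quot v w))"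
proof -
  have id: "smoothstep (v + w) - smoothstep v - w * (w * (w * smoothstep_quot v w))
     = (v * (1 - v) - w * (1 + v)) * (30 * w * (v * (1 - v)) + 30 * w^2 * (1 + v) + 30 * w^2 * (1 - 2 * v) - 20 * w^3)"
    unfolding smoothstep_def smoothstep_quot_def by algebra
  show ?thesis using id assms by simp
qed

text \<open>With \<open>v = a / (a + z)\<close> and ratio 2 between the scales one has
  \<open>2 * a / (2 * a + z) * (1 + v) = 2 * v\<close>; subtracting \<open>v * (1 + v)\<close> gives
  the relation. This is why the scales are dyadic.\<close>

lemma vfun_wfun_relation:
  assumes "a + z \<noteq> 0" "2 * a + z \<noteq> (0::complex)"
  shows "(2 * a / (2 * a + z) - a / (a + z)) * (1 + a / (a + z)) = a / (a + z) * (1 - a / (a + z))"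
proof -
  define v where "v = a / (a + z)"
  have "2 * a / (2 * a + z) * (1 + v) = 2 * v"
  proof -
    have "1 + v = (2 * a + z) / (a + z)" unfolding v_def using assms(1) by (simp add: field_simps)
    then show ?thesis unfolding v_def using assms(2) by simp
  qed
  then show ?thesis unfolding v_def[symmetric] by algebra
qed

lemma smoothstep_quot_bound:
  assumes "cmod v \<le> c" "cmod w \<le> c"
  shows "cmod (smoothstep_quot v w) \<le> 30 * (1 + c)^2 + 10 * (1 + 2 * c)^2 + 6 * c^2 + 30 * ((1 + c) * (1 + 2 * c))
     + 20 * (c * (1 + c)) + 15 * (c * (1 + 2 * c))"
proof -
  have c0: "0 \<le> c" using order_trans[OF norm_ge_zero assms(1)] .
  have a: "cmod (1 + v) \<le> 1 + c" using norm_triangle_ineq[of 1 v] assms by simp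
  have b: "cmod (1 - 2 * v) \<le> 1 + 2 * c" using norm_triangle_ineq4[of 1 "2 * v"] assms by (simp add: norm_mult)
  have 1: "cmod (30 * (1 + v)^2) \<le> 30 * (1 + c)^2" using power_mono[OF a norm_ge_zero, of 2] by (simp add: norm_mult norm_power)
  have 2: "cmod (10 * (1 - 2 * v)^2) \<le> 10 * (1 + 2 * c)^2" using power_mono[OF b norm_ge_zero, of 2] by (simp add: norm_mult norm_power)
  have 3: "cmod (6 * w^2) \<le> 6 * c^2" using power_mono[OF assms(2) norm_ge_zero, of 2] by (simp add: norm_mult norm_power)
  have 4: "cmod (30 * ((1 + v) * (1 - 2 * v))) \<le> 30 * ((1 + c) * (1 + 2 * c))"
    using mult_mono[OF a b] c0 by (simp add: norm_mult)
  have 5: "cmod (20 * (w * (1 + v))) \<le> 20 * (c * (1 + c))" using mult_mono[OF assms(2) a] c0 by (simp add: norm_mult)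
  have 6: "cmod (15 * (w * (1 - 2 * v))) \<le> 15 * (c * (1 + 2 * c))" using mult_mono[OF assms(2) b] c0 by (simp add: norm_mult)
  have "cmod (A + B + D + E - F - G) \<le> cmod A + cmod B + cmod D + cmod E + cmod F + cmod G" for A B D E F G :: complex
    using norm_triangle_ineq4[of "A + B + D + E - F" G] norm_triangle_ineq4[of "A + B + D + E" F]
      norm_triangle_ineq[of "A + B + D" E] norm_triangle_ineq[of "A + B" D] norm_triangle_ineq[of A B] by linarith
  from this[of "30 * (1 + v)^2" "10 * (1 - 2 * v)^2" "6 * w^2" "30 * ((1 + v) * (1 - 2 * v))" "20 * (w * (1 + v))" "15 * (w * (1 - 2 * v))"]
  show ?thesis unfolding smoothstep_quot_def using 1 2 3 4 5 6 by linarith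
qed

lemma smoothstep_bound:
  assumes "cmod v \<le> c"
  shows "cmod (smoothstep v) \<le> c^3 * (10 + 15 * c + 6 * c^2)"
proof -
  have c0: "0 \<le> c" using order_trans[OF norm_ge_zero assms] .
  have "cmod (10 - 15 * v + 6 * v^2) \<le> cmod (10 - 15 * v) + cmod (6 * v^2)" by (rule norm_triangle_ineq)
  also have "cmod (10 - 15 * v) \<le> 10 + 15 * cmod v" using norm_triangle_ineq4[of 10 "15 * v"] by (simp add: norm_mult)
  finally have "cmod (10 - 15 * v + 6 * v^2) \<le> 10 + 15 * cmod v + 6 * cmod v ^ 2" by (simp add: norm_mult norm_power)
  also have "\<dots> \<le> 10 + 15 * c + 6 * c^2" using assms power_mono[OF assms norm_ge_zero, of 2] by linarith
  finally have "cmod (10 - 15 * v + 6 * v^2) \<le> 10 + 15 * c + 6 * c^2" .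
  moreover have "cmod v ^ 3 \<le> c^3" using assms by (intro power_mono) auto
  ultimately show ?thesis unfolding smoothstep_def norm_mult norm_power using c0 by (intro mult_mono) auto
qed

section \<open>Uniform bounds for the calculus of a sectorial operator\<close>

context sectorial_op
begin

lemma one_in_sector: "s > 0 \<Longrightarrow> 1 \<in> sector s"
  by (simp add: sector_def)

text \<open>The calculus is applied to a single scalar function, the combination of the
  \<open>wfun\<close> with coefficients \<open>\<alpha>\<close>; its supremum is at most
  \<open>1 / k^2\<close> however many scales occur. The conclusion speaks of \<open>W\<close> alone,
  so the contour attached to \<open>s\<close> has disappeared from it and the estimate can be
  combined with another contour.\<close>

lemma Hinf_family:
  assumes H: "Hinf_calc J D A s" and s: "s < pi"
  shows "\<exists>K\<ge>0. \<forall>n \<tau>. (\<forall>i. \<tau> i > 0 \<and> \<tau> i \<le> \<tau> (Suc i)) \<longrightarrow> (\<forall>\<alpha> x. (\<forall>i<(n::nat). cmod (\<alpha> i) \<le> 1) \<longrightarrow>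
     norm (\<Sum>i<n. \<alpha> i \<odot> W (\<tau> (Suc i)) (\<tau> i) x) \<le> K * norm x)"
proof -
  have oms: "om < s" using H unfolding Hinf_calc_def by blast
  have s0: "0 \<le> s" "s > 0" using oms om by auto
  obtain C where C: "\<forall>g. admissible s g \<longrightarrow>
      (\<forall>x. norm (fcalc J D A s g x) \<le> C * (SUP z\<in>sector s. cmod (g z)) * norm x)"
    using H unfolding Hinf_calc_def by (elim conjE exE)
  define k where "k = angle_const s"
  have k: "k > 0" unfolding k_def by (rule angle_const_pos[OF s0(1) s])
  define \<nu> where "\<nu> = nu_of J D A s"
  obtain s1 where nu: "om < \<nu>" "\<nu> < s1" "s1 < pi" and s1: "s1 < s" "0 \<le> s1"
    using nu_of_bounds[OF oms] unfolding \<nu>_def by metis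
  have nupi: "\<nu> < pi" using nu by simp
  have main: "norm (\<Sum>i<n. \<alpha> i \<odot> W (\<tau> (Suc i)) (\<tau> i) x) \<le> (\<bar>C\<bar> * (1 / k^2)) * norm x"
    if \<tau>: "\<And>i. \<tau> i > 0" "\<And>i. \<tau> i \<le> \<tau> (Suc i)" and \<alpha>: "\<And>i. i < n \<Longrightarrow> cmod (\<alpha> i) \<le> 1"
    for n :: nat and \<tau> \<alpha> x
  proof -
    define w where "w i = wfun (\<tau> (Suc i)) (\<tau> i)" for i
    define g where "g z = (\<Sum>i<n. \<alpha> i * w i z)" for z
    have "\<exists>E\<ge>0. \<forall>z\<in>sector s. cmod (w i z) \<le> E * cmod z / (1 + (cmod z)^2)" for i
      unfolding w_def by (rule wfun_decay[OF s0(1) s \<tau>(1) \<tau>(1)])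
    then obtain E where E: "\<And>i. E i \<ge> 0" "\<And>i z. z \<in> sector s \<Longrightarrow> cmod (w i z) \<le> E i * cmod z / (1 + (cmod z)^2)"
      by metis
    have hol: "w i holomorphic_on sector s" for i unfolding w_def by (rule wfun_holomorphic[OF s0(1) s \<tau>(1) \<tau>(1)])
    have gle: "cmod (g z) \<le> (\<Sum>i<n. cmod (w i z))" for z
    proof -
      have "cmod (\<alpha> i * w i z) \<le> cmod (w i z)" if "i < n" for i
        using mult_right_mono[OF \<alpha>[OF that] norm_ge_zero[of "w i z"]] by (simp add: norm_mult)
      then show ?thesis unfolding g_def by (intro sum_norm_le) auto
    qed
    have gb: "cmod (g z) \<le> 1 / k^2" if z: "z \<in> sector s" for z
      using order_trans[OF gle wfun_sum_bound[OF s0(1) s z, of \<tau> n, OF \<tau>, folded w_def k_def]] .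
    have adm: "admissible s g"
      unfolding admissible_def
    proof (intro conjI)
      show "g holomorphic_on sector s" unfolding g_def[abs_def] using hol by (intro holomorphic_intros) auto
      show "bounded (g ` sector s)" using gb by (intro boundedI[of _ "1 / k^2"]) auto
      have "cmod (g z) \<le> (\<Sum>i<n. E i) * (cmod z / (1 + cmod z ^ 2)) powr 1" if z: "z \<in> sector s" for z
      proof -
        have "(\<Sum>i<n. cmod (w i z)) \<le> (\<Sum>i<n. E i * cmod z / (1 + (cmod z)^2))" using E(2)[OF z] by (intro sum_mono)
        also have "\<dots> = (\<Sum>i<n. E i) * (cmod z / (1 + cmod z ^ 2))"
          unfolding times_divide_eq_right[symmetric] sum_distrib_right ..
        also have "cmod z / (1 + cmod z ^ 2) = (cmod z / (1 + cmod z ^ 2)) powr 1"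
          by (simp add: add_nonneg_nonneg)
        finally show ?thesis using gle[of z] by linarith
      qed
      then show "\<exists>C e. e > 0 \<and> (\<forall>z\<in>sector s. cmod (g z) \<le> C * (cmod z / (1 + cmod z ^ 2)) powr e)"
        by (intro exI[of _ "\<Sum>i<n. E i"] exI[of _ 1]) auto
    qed
    have one: "1 \<in> sector s" by (rule one_in_sector[OF s0(2)])
    have S1: "(SUP z\<in>sector s. cmod (g z)) \<le> 1 / k^2" using one gb by (intro cSUP_least) auto
    have "bdd_above ((\<lambda>z. cmod (g z)) ` sector s)" using gb by (intro bdd_aboveI2)
    then have S0: "0 \<le> (SUP z\<in>sector s. cmod (g z))" using cSUP_upper[OF one] by (meson norm_ge_zero order_trans)
    have decaying: "decaying s1 (\<lambda>l. w i l \<odot> x)" for i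
      using sector_mono[of s1 s] s1 holomorphic_on_subset[OF hol] E by (intro decaying_const[of _ _ "E i"]) auto
    have "fcalc J D A s g x = ocalc \<nu> (\<lambda>l. \<Sum>i<n. \<alpha> i \<odot> w i l \<odot> x)"
      unfolding fcalc_eq_ocalc[OF oms] \<nu>_def[symmetric] g_def by (simp add: scale_sum_left scale_scale)
    also have "\<dots> = (\<Sum>i<n. ocalc \<nu> (\<lambda>l. \<alpha> i \<odot> w i l \<odot> x))"
    proof -
      have "decaying s1 (\<lambda>l. \<alpha> i \<odot> w i l \<odot> x)" for i
        by (rule decaying_mult[OF decaying holomorphic_on_const order_refl])
      then show ?thesis using ocalc_sum[OF nu, of n "\<lambda>i l. \<alpha> i \<odot> w i l \<odot> x"] by simp
    qed
    also have "\<dots> = (\<Sum>i<n. \<alpha> i \<odot> W (\<tau> (Suc i)) (\<tau> i) x)"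
      unfolding ocalc_scale[OF nu decaying, symmetric] unfolding w_def
      by (simp add: ocalc_wfun[OF nu(1) nupi \<tau>(1) \<tau>(1)])
    finally have "(\<Sum>i<n. \<alpha> i \<odot> W (\<tau> (Suc i)) (\<tau> i) x) = fcalc J D A s g x" by simp
    then have "norm (\<Sum>i<n. \<alpha> i \<odot> W (\<tau> (Suc i)) (\<tau> i) x) \<le> C * (SUP z\<in>sector s. cmod (g z)) * norm x"
      using C adm by simp
    also have "\<dots> \<le> (\<bar>C\<bar> * (1 / k^2)) * norm x" using S0 S1 by (intro mult_right_mono mult_mono) auto
    finally show ?thesis .
  qed
  show ?thesis by (rule exI[of _ "\<bar>C\<bar> * (1 / k^2)"]) (use main in simp)
qed

text \<open>Linear dependence on the decay constant is the point: applied to differences of symbols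
  it yields continuity in a parameter.\<close>

lemma norm_ocalc_le:
  assumes nu: "om < \<nu>" "\<nu> < s" "s < pi"
  shows "\<exists>M\<ge>0. \<forall>h E. decaying s h \<longrightarrow> (\<forall>z\<in>sector s. norm (h z) \<le> E * cmod z / (1 + (cmod z)^2)) \<longrightarrow>
    norm (ocalc \<nu> h) \<le> M * E"
proof -
  have nupi: "\<nu> < pi" using nu by simp
  obtain M where M: "M \<ge> 0" "\<And>l x. l \<noteq> 0 \<Longrightarrow> Re l \<le> cos \<nu> * cmod l \<Longrightarrow> norm (R l x) \<le> M * norm x / cmod l"
    using R_bound[OF nu(1) nupi] by metis
  have "norm (ocalc \<nu> h) \<le> M * E"
    if h: "decaying s h" and E: "\<And>z. z \<in> sector s \<Longrightarrow> norm (h z) \<le> E * cmod z / (1 + (cmod z)^2)" for h E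
  proof -
    have bd: "norm (R l (h l)) \<le> M * E / (1 + (cmod l)^2)"
      if l: "l \<in> sector s" "Re l \<le> cos \<nu> * cmod l" for l
    proof -
      have l0: "cmod l > 0" using l sector_pos by simp
      have "norm (R l (h l)) \<le> M * norm (h l) / cmod l" using M(2)[of l "h l"] l l0 by simp
      also have "\<dots> \<le> M * (E * cmod l / (1 + (cmod l)^2)) / cmod l"
        using E[OF l(1)] M(1) l0 by (intro divide_right_mono mult_left_mono) auto
      also have "\<dots> = M * E / (1 + (cmod l)^2)" using l0 by simp
      finally show ?thesis .
    qed
    have "norm (bnd_int J \<nu> (\<lambda>l. R l (h l))) \<le> (M * E) * pi"
    proof (rule norm_bnd_int_le[OF tame2_R[OF nu h]])
      fix t :: real assume t: "t > 0"
      show "norm (R (ray t \<nu>) (h (ray t \<nu>))) \<le> M * E / (1 + t^2)"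
        using bd[OF rays(3)[OF nu t] ray_outer(3)[OF nu(1) nupi t]] t by (simp add: norm_mult)
      show "norm (R (ray t (- \<nu>)) (h (ray t (- \<nu>)))) \<le> M * E / (1 + t^2)"
        using bd[OF rays(4)[OF nu t] ray_outer(4)[OF nu(1) nupi t]] t by (simp add: norm_mult)
    qed
    then have "1 / (2 * pi) * norm (bnd_int J \<nu> (\<lambda>l. R l (h l))) \<le> 1 / (2 * pi) * ((M * E) * pi)"
      by (intro mult_left_mono) auto
    moreover have "M * E \<ge> 0"
    proof -
      have s0: "s > 0" using nu om by simp
      have "E \<ge> 0" using order_trans[OF norm_ge_zero E[OF one_in_sector[OF s0]]] by simp
      then show ?thesis using M by simp
    qed
    ultimately show ?thesis unfolding ocalc_def by (simp add: norm_divide norm_mult)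
  qed
  then show ?thesis using M(1) by blast
qed

text \<open>The kernel \<open>\<tau> / ((t + \<tau>) (t + 2 \<tau>))\<close> has integral \<open>ln 2\<close> for every \<open>\<tau>\<close>, which
  makes the bound uniform over the dyadic scales.\<close>
lemma norm_ocalc_dyadic:
  assumes nu: "om < \<nu>" "\<nu> < s" "s < pi"
  shows "\<exists>M\<ge>0. \<forall>h E \<tau>. \<tau> > 0 \<longrightarrow> decaying s h \<longrightarrow> E \<ge> 0 \<longrightarrow>
    (\<forall>z\<in>sector s. norm (h z) \<le> E * (\<tau> * cmod z / ((cmod z + \<tau>) * (cmod z + 2 * \<tau>)))) \<longrightarrow>
    norm (ocalc \<nu> h) \<le> M * E"
proof -
  have nupi: "\<nu> < pi" using nu by simp
  obtain M where M: "M \<ge> 0" "\<And>l x. l \<noteq> 0 \<Longrightarrow> Re l \<le> cos \<nu> * cmod l \<Longrightarrow> norm (R l x) \<le> M * norm x / cmod l"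
    using R_bound[OF nu(1) nupi] by metis
  have "norm (ocalc \<nu> h) \<le> M * E"
    if \<tau>: "\<tau> > 0" and h: "decaying s h" and E0: "E \<ge> 0"
      and E: "\<And>z. z \<in> sector s \<Longrightarrow> norm (h z) \<le> E * (\<tau> * cmod z / ((cmod z + \<tau>) * (cmod z + 2 * \<tau>)))" for h E \<tau>
  proof -
    define g where "g t = (M * E) * (1 / (t + \<tau>) - 1 / (t + 2 * \<tau>))" for t
    define G where "G t = (M * E) * (ln (t + \<tau>) - ln (t + 2 * \<tau>))" for t
    have ME: "M * E \<ge> 0" using M E0 by simp
    have bd: "norm (R l (h l)) \<le> g (cmod l)"
      if l: "l \<in> sector s" "Re l \<le> cos \<nu> * cmod l" for l
    proof -
      have l0: "cmod l > 0" using l sector_pos by simp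
      have "norm (R l (h l)) \<le> M * norm (h l) / cmod l" using M(2)[of l "h l"] l l0 by simp
      also have "\<dots> \<le> M * (E * (\<tau> * cmod l / ((cmod l + \<tau>) * (cmod l + 2 * \<tau>)))) / cmod l"
        using E[OF l(1)] M(1) l0 by (intro divide_right_mono mult_left_mono) auto
      also have "\<dots> = (M * E) * (\<tau> / ((cmod l + \<tau>) * (cmod l + 2 * \<tau>)))" using l0 by simp
      also have "\<tau> / ((cmod l + \<tau>) * (cmod l + 2 * \<tau>)) = 1 / (cmod l + \<tau>) - 1 / (cmod l + 2 * \<tau>)"
      proof -
        have "cmod l + \<tau> \<noteq> 0" "cmod l + 2 * \<tau> \<noteq> 0" using l0 \<tau> by linarith+
        then show ?thesis by (simp add: field_simps)
      qed
      finally show ?thesis unfolding g_def .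
    qed
    have Gd: "(G has_real_derivative g t) (at t)" if "t > 0" for t
    proof -
      have "t + \<tau> > 0" "t + 2 * \<tau> > 0" using that \<tau> by linarith+
      then show ?thesis unfolding G_def g_def by (auto intro!: derivative_eq_intros)
    qed
    have GB: "G y - G x \<le> M * E" if "0 < x" "x \<le> y" for x y
    proof -
      have "ln (y + \<tau>) \<le> ln (y + 2 * \<tau>)" using that \<tau> by (subst ln_le_cancel_iff) auto
      moreover have "ln (x + 2 * \<tau>) \<le> ln (2 * (x + \<tau>))" using that \<tau> by (subst ln_le_cancel_iff) auto
      moreover have "ln (2 * (x + \<tau>)) = ln 2 + ln (x + \<tau>)" using that \<tau> by (subst ln_mult) auto
      moreover have "ln (2::real) \<le> 1" using ln_le_minus_one[of "2::real"] by simp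
      ultimately have "(ln (y + \<tau>) - ln (y + 2 * \<tau>)) - (ln (x + \<tau>) - ln (x + 2 * \<tau>)) \<le> 1" by linarith
      then have "(M * E) * ((ln (y + \<tau>) - ln (y + 2 * \<tau>)) - (ln (x + \<tau>) - ln (x + 2 * \<tau>))) \<le> (M * E) * 1"
        using ME by (rule mult_left_mono)
      then show ?thesis unfolding G_def by (simp add: right_diff_distrib)
    qed
    note t2 = tame2_R[OF nu h]
    have i1: "norm (integral {0..} (\<lambda>t. R (ray t \<nu>) (h (ray t \<nu>)))) \<le> M * E"
    proof (rule tame_norm_FTC[OF _ _ Gd GB])
      show "tame (\<lambda>t. R (ray t \<nu>) (h (ray t \<nu>)))" using t2 unfolding tame2_def by blast
      show "norm (R (ray t \<nu>) (h (ray t \<nu>))) \<le> g t" if t: "t > 0" for t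
        using bd[OF rays(3)[OF nu t] ray_outer(3)[OF nu(1) nupi t]] t by (simp add: norm_mult)
    qed
    have i2: "norm (integral {0..} (\<lambda>t. R (ray t (- \<nu>)) (h (ray t (- \<nu>))))) \<le> M * E"
    proof (rule tame_norm_FTC[OF _ _ Gd GB])
      show "tame (\<lambda>t. R (ray t (- \<nu>)) (h (ray t (- \<nu>))))" using t2 unfolding tame2_def by blast
      show "norm (R (ray t (- \<nu>)) (h (ray t (- \<nu>)))) \<le> g t" if t: "t > 0" for t
        using bd[OF rays(4)[OF nu t] ray_outer(4)[OF nu(1) nupi t]] t by (simp add: norm_mult)
    qed
    have "norm (bnd_int J \<nu> (\<lambda>l. R l (h l))) \<le> 2 * (M * E)"
      unfolding bnd_int_split[OF t2] using i1 i2 by (intro norm_triangle_le) simp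
    then have "1 / (2 * pi) * norm (bnd_int J \<nu> (\<lambda>l. R l (h l))) \<le> 1 / (2 * pi) * (2 * (M * E))"
      by (intro mult_left_mono) auto
    also have "\<dots> = (M * E) / pi" by simp
    also have "\<dots> \<le> M * E" using ME pi_ge_two mult_left_mono[of 1 pi "M * E"] by (simp add: divide_le_eq)
    finally show ?thesis unfolding ocalc_def by (simp add: norm_divide norm_mult)
  qed
  then show ?thesis using M(1) by blast
qed

text \<open>The constant is built from the geometry of the space, the calculus of \<open>A\<close>
  and the angles. The decay constants of \<open>H\<close> do not enter it, only the uniform bound
  \<open>M\<close> does; this gives uniformity in n when \<open>H\<close> carries a factor phi_n,
  whose decay constant is unbounded in n.\<close>

lemma ocalc_telescoping_bound:
  assumes GT: "(GT_space (UNIV :: 'a set) (cscale J) \<and> cotype2 (UNIV :: 'a set))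
         \<or> (GT_space (dualsp J) dual_sm \<and> cotype2 (dualsp J))"
    and Hinf: "Hinf_calc J D A s0" "s0 < pi"
    and nu: "om < \<nu>" "\<nu> < s" "s < pi"
  shows "\<exists>C\<ge>0. \<forall>H M x. M \<ge> 0 \<longrightarrow> (\<forall>x. decaying s (\<lambda>l. H l x)) \<longrightarrow> (\<forall>l\<in>sector s. clinear (H l)) \<longrightarrow>
     (\<forall>l\<in>sector s. \<forall>m\<in>outer om. \<forall>x. R m (H l x) = H l (R m x)) \<longrightarrow>
     (\<forall>l\<in>sector s. \<forall>x. norm (H l x) \<le> M * norm x) \<longrightarrow>
     norm (ocalc \<nu> (\<lambda>l. H l x)) \<le> C * M * norm x"
proof -
  obtain G where G: "G \<ge> 0" "\<forall>(n::nat) S T K M q x. (\<forall>i<n. clinear (S i)) \<longrightarrow> (\<forall>i<n. clinear (T i)) \<longrightarrow>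
     (\<forall>i<n. \<forall>x. S i (T i x) = T i (S i x)) \<longrightarrow> K \<ge> 0 \<longrightarrow> M \<ge> 0 \<longrightarrow>
     (\<forall>\<alpha> x. (\<forall>i<n. cmod (\<alpha> i) \<le> 1) \<longrightarrow> norm (\<Sum>i<n. \<alpha> i \<odot> S i x) \<le> K * norm x) \<longrightarrow>
     (\<forall>i<n. \<forall>x. norm (T i x) \<le> M * norm x) \<longrightarrow> cfun q \<longrightarrow> (\<forall>x. cmod (q x) \<le> norm x) \<longrightarrow>
     (\<Sum>i<n. cmod (q (S i (S i (T i x))))) \<le> G * M * K^2 * norm x"
    using GT_sum[OF GT] by (elim exE conjE)
  obtain K where K: "K \<ge> 0" "\<forall>n \<tau>. (\<forall>i. \<tau> i > 0 \<and> \<tau> i \<le> \<tau> (Suc i)) \<longrightarrow> (\<forall>\<alpha> x. (\<forall>i<(n::nat). cmod (\<alpha> i) \<le> 1) \<longrightarrow>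
     norm (\<Sum>i<n. \<alpha> i \<odot> W (\<tau> (Suc i)) (\<tau> i) x) \<le> K * norm x)"
    using Hinf_family[OF Hinf] by (elim exE conjE)
  obtain L where L: "L \<ge> 0" "\<forall>h E \<tau>. \<tau> > 0 \<longrightarrow> decaying s h \<longrightarrow> E \<ge> 0 \<longrightarrow>
    (\<forall>z\<in>sector s. norm (h z) \<le> E * (\<tau> * cmod z / ((cmod z + \<tau>) * (cmod z + 2 * \<tau>)))) \<longrightarrow>
    norm (ocalc \<nu> h) \<le> L * E"
    using norm_ocalc_dyadic[OF nu] by (elim exE conjE)
  have s: "0 \<le> s" using nu om by simp
  define k where "k = angle_const s"
  have k: "k > 0" unfolding k_def by (rule angle_const_pos[OF s nu(3)])
  \<comment> \<open>A common bound for \<open>vf\<close> and \<open>wfun\<close>: the former is at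
    most \<open>1 / k\<close>, the latter is a difference of two such functions.\<close>
  define c where "c = 2 / k"
  have c: "c \<ge> 1 / k" "c \<ge> 0" unfolding c_def using k by (simp_all add: divide_right_mono)
  define P where "P = 30 * (1 + c)^2 + 10 * (1 + 2 * c)^2 + 6 * c^2 + 30 * ((1 + c) * (1 + 2 * c))
     + 20 * (c * (1 + c)) + 15 * (c * (1 + 2 * c))"
  have P0: "P \<ge> 0" unfolding P_def using c(2) by simp
  define Y where "Y = c^3 * (10 + 15 * c + 6 * c^2)"
  define vf where "vf a l = of_real a / (of_real a + l)" for a :: real and l :: complex
  have vb: "cmod (vf a l) \<le> c" if "l \<in> sector s" "a > 0" for a l
    using order_trans[OF vfun_bound[OF s nu(3) that, folded k_def] c(1)] unfolding vf_def .
  have wb: "cmod (wfun a b l) \<le> c" if "l \<in> sector s" "a > 0" "b > 0" for a b l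
  proof -
    have "cmod (wfun a b l) \<le> cmod (vf a l) + cmod (vf b l)" unfolding wfun_def vf_def by (rule norm_triangle_ineq4)
    also have "\<dots> \<le> 1 / k + 1 / k"
      using vfun_bound[OF s nu(3) that(1,2)] vfun_bound[OF s nu(3) that(1,3)] unfolding vf_def k_def by (rule add_mono)
    finally show ?thesis unfolding c_def by simp
  qed
  have vh: "vf a holomorphic_on sector s" if "a > 0" for a
    using vfun_holomorphic[OF s nu(3) that] unfolding vf_def[abs_def] .
  have wh: "wfun a b holomorphic_on sector s" if "a > 0" "b > 0" for a b by (rule wfun_holomorphic[OF s nu(3) that])
  have vw: "vf (2 * a) l = vf a l + wfun (2 * a) a l" for a l unfolding vf_def wfun_def by simp
  \<comment> \<open>Of the three factors \<open>wfun\<close> in an increment of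
    \<open>smoothstep\<close> one stays here. Its decay at 0 and at infinity bounds the operators
    \<open>T\<close> below in terms of \<open>M\<close> alone; the other two factors are taken out
    as operators.\<close>
  define \<rho> where "\<rho> a l = wfun (2 * a) a l * smoothstep_quot (vf a l) (wfun (2 * a) a l)" for a l
  have rh: "\<rho> a holomorphic_on sector s" if "a > 0" for a
  proof -
    have "2 * a > 0" using that by simp
    note h = vh[OF that] wh[OF this that]
    show ?thesis unfolding \<rho>_def[abs_def] smoothstep_quot_def by (intro holomorphic_intros h)
  qed
  have qb: "cmod (smoothstep_quot (vf a l) (wfun (2 * a) a l)) \<le> P" if "l \<in> sector s" "a > 0" for a l
    unfolding P_def using that by (intro smoothstep_quot_bound vb wb) auto
  have rb: "cmod (\<rho> a l) \<le> P / k^2 * (a * cmod l / ((cmod l + a) * (cmod l + 2 * a)))" if "l \<in> sector s" "a > 0" for a l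
  proof -
    have "cmod (wfun (2 * a) a l) \<le> \<bar>2 * a - a\<bar> * cmod l / (k^2 * ((cmod l + 2 * a) * (cmod l + a)))"
      unfolding k_def using that by (intro wfun_bound[OF s nu(3)]) auto
    also have "\<dots> = 1 / k^2 * (a * cmod l / ((cmod l + a) * (cmod l + 2 * a)))" using that(2) by (simp add: mult_ac)
    finally have "cmod (\<rho> a l) \<le> (1 / k^2 * (a * cmod l / ((cmod l + a) * (cmod l + 2 * a)))) * P"
      unfolding \<rho>_def norm_mult using qb[OF that] P0 that(2)
      by (intro mult_mono) (auto intro!: divide_nonneg_nonneg mult_nonneg_nonneg add_nonneg_nonneg)
    then show ?thesis by (simp add: mult_ac)
  qed
  have rb': "cmod (\<rho> a l) \<le> c * P" if "l \<in> sector s" "a > 0" for a l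
    unfolding \<rho>_def norm_mult using qb[OF that] wb[of l "2 * a" a] that c by (intro mult_mono) auto
  have sv: "(\<lambda>l. smoothstep (vf a l)) holomorphic_on sector s" if "a > 0" for a
    unfolding smoothstep_def by (intro holomorphic_intros vh[OF that])
  have svb: "cmod (smoothstep (vf a l)) \<le> Y" if "l \<in> sector s" "a > 0" for a l
    unfolding Y_def by (rule smoothstep_bound[OF vb[OF that]])
  have diff: "smoothstep (vf (2 * a) l) - smoothstep (vf a l) = wfun (2 * a) a l * (wfun (2 * a) a l * \<rho> a l)"
    if l: "l \<in> sector s" and a: "a > 0" for a l
  proof -
    have n1: "of_real a + l \<noteq> 0" by (rule cmod_add_sector(2)[OF s nu(3) l a])
    have n2: "2 * of_real a + l \<noteq> 0" using cmod_add_sector(2)[OF s nu(3) l, of "2 * a"] a by simp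
    have "wfun (2 * a) a l * (1 + vf a l) = vf a l * (1 - vf a l)"
      using vfun_wfun_relation[OF n1 n2] unfolding wfun_def vf_def by simp
    then show ?thesis unfolding vw \<rho>_def by (rule smoothstep_diff)
  qed
  \<comment> \<open>GT constant, bound for the operators \<open>T\<close> per unit of
    \<open>M\<close>, and the square of the unconditionality constant.\<close>
  define C where "C = G * (L * (P / k^2)) * K^2"
  have C0: "C \<ge> 0" unfolding C_def using G(1) L(1) P0 by simp
  have main: "norm (ocalc \<nu> (\<lambda>l. H l x)) \<le> C * M * norm x"
    if M: "M \<ge> 0" and decaying: "\<And>x. decaying s (\<lambda>l. H l x)" and clin: "\<And>l. l \<in> sector s \<Longrightarrow> clinear (H l)"
      and comm: "\<And>l m x. l \<in> sector s \<Longrightarrow> m \<in> outer om \<Longrightarrow> R m (H l x) = H l (R m x)"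
      and HM: "\<And>l x. l \<in> sector s \<Longrightarrow> norm (H l x) \<le> M * norm x" for H M x
  proof (rule norm_leI_cfun)
    fix q assume q: "cfun q" "\<And>y. cmod (q y) \<le> norm y"
    define T where "T a y = ocalc \<nu> (\<lambda>l. \<rho> a l \<odot> H l y)" for a y
    have gT: "decaying s (\<lambda>l. \<rho> a l \<odot> H l y)" if "a > 0" for a y
      by (rule decaying_mult[OF decaying rh[OF that] rb'[OF _ that]])
    have TM: "norm (T a y) \<le> (L * (P / k^2) * M) * norm y" if a: "a > 0" for a y
    proof -
      have "norm (\<rho> a z \<odot> H z y) \<le> (P / k^2 * (M * norm y)) * (a * cmod z / ((cmod z + a) * (cmod z + 2 * a)))"
        if z: "z \<in> sector s" for z
      proof -
        have "norm (\<rho> a z \<odot> H z y) \<le> (P / k^2 * (a * cmod z / ((cmod z + a) * (cmod z + 2 * a)))) * (M * norm y)"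
          unfolding norm_scale using rb[OF z a] HM[OF z, of y] P0 a by (intro mult_mono) auto
        then show ?thesis by (simp add: mult_ac)
      qed
      then have "norm (T a y) \<le> L * (P / k^2 * (M * norm y))"
        unfolding T_def by (rule L(2)[rule_format, OF a gT[OF a], rotated]) (use P0 M in simp_all)
      then show ?thesis by (simp add: mult_ac)
    qed
    have Tadd: "T a (y + z) = T a y + T a z" if a: "a > 0" for a y z
    proof -
      have "T a (y + z) = ocalc \<nu> (\<lambda>l. \<rho> a l \<odot> H l y + \<rho> a l \<odot> H l z)"
        unfolding T_def using rays[OF nu] by (intro ocalc_cong) (simp_all add: clinear_add[OF clin] scale_add_right)
      then show ?thesis unfolding ocalc_add[OF nu gT[OF a] gT[OF a]] T_def .
    qed
    have Tsc: "T a (b \<odot> y) = b \<odot> T a y" if a: "a > 0" for a b y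
    proof -
      have "T a (b \<odot> y) = ocalc \<nu> (\<lambda>l. b \<odot> \<rho> a l \<odot> H l y)"
        unfolding T_def using rays[OF nu] by (intro ocalc_cong) (simp_all add: clinear_apply_scale[OF clin] scale_scale mult.commute)
      then show ?thesis unfolding ocalc_scale[OF nu gT[OF a], symmetric] T_def .
    qed
    have Tcl: "clinear (T a)" if a: "a > 0" for a
      unfolding clinear_def
    proof (intro conjI allI Tsc[OF a])
      show "bounded_linear (T a)"
      proof (rule bounded_linear_intro)
        show "T a (r *\<^sub>R y) = r *\<^sub>R T a y" for r y using Tsc[OF a, of "of_real r" y] unfolding scale_of_real .
        show "norm (T a y) \<le> norm y * (L * (P / k^2) * M)" for y using TM[OF a, of y] by (simp add: mult.commute)
      qed (rule Tadd[OF a])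
    qed
    have WT: "W (2 * a) a (T a y) = T a (W (2 * a) a y)" if a: "a > 0" for a y
    proof -
      have a2: "2 * a > 0" using a by simp
      note Wc = W_clinear[OF a2 a]
      have WH: "W (2 * a) a (H l y) = H l (W (2 * a) a y)" if l: "l \<in> sector s" for l
        using W_commute[OF a2 a clin[OF l], of y] comm[OF l] by simp
      have "W (2 * a) a (T a y) = ocalc \<nu> (\<lambda>l. W (2 * a) a (\<rho> a l \<odot> H l y))"
        unfolding T_def using W_R_commute[OF a2 a] by (intro ocalc_commute[OF nu gT[OF a] Wc]) auto
      also have "\<dots> = T a (W (2 * a) a y)"
        unfolding T_def using rays[OF nu] by (intro ocalc_cong) (simp_all add: clinear_apply_scale[OF Wc] WH)
      finally show ?thesis .
    qed
    \<comment> \<open>Each \<open>W\<close> multiplies the symbol by one more \<open>wfun\<close>,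
      which restores the three factors of \<open>smoothstep_diff\<close>.\<close>
    have WWT: "W (2 * a) a (W (2 * a) a (T a y)) = ocalc \<nu> (\<lambda>l. (smoothstep (vf (2 * a) l) - smoothstep (vf a l)) \<odot> H l y)"
      if a: "a > 0" for a y
    proof -
      have a2: "2 * a > 0" using a by simp
      note W1 = W_ocalc[OF nu gT[OF a] a2 a]
      have "W (2 * a) a (W (2 * a) a (T a y)) = ocalc \<nu> (\<lambda>l. wfun (2 * a) a l \<odot> wfun (2 * a) a l \<odot> \<rho> a l \<odot> H l y)"
        unfolding T_def W1(1) W_ocalc(1)[OF nu W1(2) a2 a] ..
      also have "\<dots> = ocalc \<nu> (\<lambda>l. (smoothstep (vf (2 * a) l) - smoothstep (vf a l)) \<odot> H l y)"
        using rays[OF nu] a by (intro ocalc_cong) (simp_all add: diff scale_scale)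
      finally show ?thesis .
    qed
    have gS: "decaying s (\<lambda>l. (smoothstep (vf b l) - smoothstep (vf a l)) \<odot> H l x)" if "a > 0" "b > 0" for a b
    proof (rule decaying_mult[OF decaying])
      show "(\<lambda>l. smoothstep (vf b l) - smoothstep (vf a l)) holomorphic_on sector s"
        using sv that by (intro holomorphic_on_diff) auto
      show "cmod (smoothstep (vf b l) - smoothstep (vf a l)) \<le> 2 * Y" if l: "l \<in> sector s" for l
        using svb[OF l \<open>a > 0\<close>] svb[OF l \<open>b > 0\<close>] norm_triangle_ineq4[of "smoothstep (vf b l)" "smoothstep (vf a l)"] by linarith
    qed
    \<comment> \<open>The partial sum over the scales from 2^-N to 2^N, already telescoped.\<close>
    define F where "F N = ocalc \<nu> (\<lambda>l. (smoothstep (vf (2 ^ N) l) - smoothstep (vf (1 / 2 ^ N) l)) \<odot> H l x)" for N :: nat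
    have bound: "cmod (q (F N)) \<le> C * M * norm x" for N
    proof -
      \<comment> \<open>Equal to 2^(i - N): the \<open>2 * N\<close> doublings lead from 2^-N to
        2^N.\<close>
      define \<tau> where "\<tau> i = 2 ^ i / (2 ^ N :: real)" for i
      have t0: "\<tau> i > 0" and t1: "\<tau> (Suc i) = 2 * \<tau> i" for i unfolding \<tau>_def by simp_all
      have tmono: "\<forall>i. \<tau> i > 0 \<and> \<tau> i \<le> \<tau> (Suc i)" using t0 t1 by (simp add: less_imp_le)
      define S where "S i = W (\<tau> (Suc i)) (\<tau> i)" for i
      have "(\<Sum>i<2*N. cmod (q (S i (S i (T (\<tau> i) x))))) \<le> G * (L * (P / k^2) * M) * K^2 * norm x"
      proof (rule G(2)[rule_format, where n = "2 * N" and S = S and T = "\<lambda>i. T (\<tau> i)" and K = K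
            and M = "L * (P / k^2) * M" and q = q and x = x])
        show "clinear (S i)" for i unfolding S_def using t0 by (intro W_clinear) auto
        show "clinear (T (\<tau> i))" for i by (rule Tcl[OF t0])
        show "S i (T (\<tau> i) y) = T (\<tau> i) (S i y)" for i y unfolding S_def t1 by (rule WT[OF t0])
        show "norm (\<Sum>i<2*N. \<alpha> i \<odot> S i y) \<le> K * norm y" if "\<And>i. i < 2*N \<Longrightarrow> cmod (\<alpha> i) \<le> 1" for \<alpha> y
          using K(2) tmono that unfolding S_def by blast
        show "norm (T (\<tau> i) y) \<le> (L * (P / k^2) * M) * norm y" for i y by (rule TM[OF t0])
        show "0 \<le> L * (P / k^2) * M" using L(1) P0 M by simp
      qed (use K q in auto)
      moreover have "F N = (\<Sum>i<2*N. S i (S i (T (\<tau> i) x)))"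
      proof -
        define g where "g i l = (smoothstep (vf (\<tau> (Suc i)) l) - smoothstep (vf (\<tau> i) l)) \<odot> H l x" for i l
        have "(\<Sum>i<2*N. S i (S i (T (\<tau> i) x))) = (\<Sum>i<2*N. ocalc \<nu> (g i))"
          unfolding S_def t1 WWT[OF t0] g_def ..
        also have "\<dots> = ocalc \<nu> (\<lambda>l. \<Sum>i<2*N. g i l)"
        proof -
          have "decaying s (g i)" for i unfolding g_def using gS[OF t0 t0] .
          then show ?thesis using ocalc_sum[OF nu, of "2*N" g] by simp
        qed
        also have "(\<lambda>l. \<Sum>i<2*N. g i l) = (\<lambda>l. (smoothstep (vf (\<tau> (2*N)) l) - smoothstep (vf (\<tau> 0) l)) \<odot> H l x)"
          unfolding g_def scale_sum_left[symmetric]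
            sum_lessThan_telescope[of "\<lambda>i. smoothstep (vf (\<tau> i) _)" "2 * N"] ..
        also have "\<tau> (2 * N) = 2 ^ N" unfolding \<tau>_def by (simp add: mult_2 power_add)
        finally show ?thesis unfolding F_def \<tau>_def by simp
      qed
      ultimately have "cmod (q (F N)) \<le> G * (L * (P / k^2) * M) * K^2 * norm x"
        using norm_sum[of "\<lambda>i. q (S i (S i (T (\<tau> i) x)))" "{..<2*N}"] by (simp add: cfun_sum[OF q(1)])
      then show ?thesis unfolding C_def by (simp add: mult_ac)
    qed
    \<comment> \<open>At each contour point \<open>vf (2 ^ N)\<close> tends to 1 and
      \<open>vf (1 / 2 ^ N)\<close> to 0, so the scalar factors tend to
      \<open>smoothstep 1 - smoothstep 0 = 1\<close>. Testing with \<open>q\<close> first reduces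
      the limit to scalar dominated convergence.\<close>
    have lim: "(\<lambda>N. q (F N)) \<longlonglongrightarrow> q (ocalc \<nu> (\<lambda>l. H l x))"
    proof -
      define g where "g N l = smoothstep (vf (2 ^ N) l) - smoothstep (vf (1 / 2 ^ N) l)" for N :: nat and l
      have pos: "(2::real) ^ N > 0" "1 / (2::real) ^ N > 0" for N by simp_all
      have gg: "decaying s (\<lambda>l. g N l \<odot> H l x)" for N unfolding g_def by (rule gS[OF pos(2) pos(1)])
      obtain C1 where C1: "C1 \<ge> 0" "\<And>z. z \<in> sector s \<Longrightarrow> norm (H z x) \<le> C1 * cmod z / (1 + (cmod z)^2)"
        using decaying_bound[OF decaying[of x]] by metis
      have nupi: "\<nu> < pi" using nu by simp
      obtain M1 where M1: "M1 \<ge> 0" "\<And>l x. l \<noteq> 0 \<Longrightarrow> Re l \<le> cos \<nu> * cmod l \<Longrightarrow> norm (R l x) \<le> M1 * norm x / cmod l"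
        using R_bound[OF nu(1) nupi] by metis
      have "(\<lambda>N. cbnd_int \<nu> (\<lambda>l. q (R l (g N l \<odot> H l x)))) \<longlonglongrightarrow> cbnd_int \<nu> (\<lambda>l. q (R l (H l x)))"
      proof (rule cbnd_int_dominated[where C = "M1 * (2 * Y * C1)"])
        show "tame2 \<nu> (\<lambda>l. q (R l (g N l \<odot> H l x)))" for N
          by (rule tame2_bounded_linear[OF tame2_R[OF nu gg] cfun_bounded_linear[OF q(1)]])
        fix t \<theta> :: real assume t: "t > 0" and th: "\<theta> = \<nu> \<or> \<theta> = - \<nu>"
        define l where "l = ray t \<theta>"
        have l: "l \<in> sector s" "l \<in> outer om" "Re l \<le> cos \<nu> * cmod l"
          unfolding l_def using th rays[OF nu t] ray_outer(3,4)[OF nu(1) nupi t] by auto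
        have ct: "cmod l = t" unfolding l_def using t by (simp add: norm_mult)
        have l0: "l \<noteq> 0" using ct t by auto
        have gb: "cmod (g N l) \<le> 2 * Y" for N
          using svb[OF l(1) pos(1)] svb[OF l(1) pos(2)] norm_triangle_ineq4[of "smoothstep (vf (2^N) l)" "smoothstep (vf (1/2^N) l)"]
          unfolding g_def by (smt (verit))
        show "cmod (q (R l (g N l \<odot> H l x))) \<le> M1 * (2 * Y * C1) / (1 + t^2)" for N
        proof -
          have "cmod (q (R l (g N l \<odot> H l x))) \<le> norm (R l (g N l \<odot> H l x))" by (rule q(2))
          also have "\<dots> \<le> M1 * norm (g N l \<odot> H l x) / t" using M1(2)[OF l0 l(3)] unfolding ct .
          also have "norm (g N l \<odot> H l x) \<le> (2 * Y) * (C1 * t / (1 + t^2))"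
            unfolding norm_scale using gb[of N] C1(2)[OF l(1)] C1(1) order_trans[OF norm_ge_zero gb[of N]] unfolding ct
            by (intro mult_mono) auto
          finally show ?thesis using t M1(1) by (simp add: mult_left_mono divide_right_mono)
        qed
        have v1: "(\<lambda>N. vf (2 ^ N) l) \<longlonglongrightarrow> 1"
        proof -
          have z: "(\<lambda>N. of_real ((1/2) ^ N) :: complex) \<longlonglongrightarrow> of_real 0"
            by (intro tendsto_of_real LIMSEQ_realpow_zero) auto
          have "(\<lambda>N. 1 / (1 + of_real ((1/2) ^ N) * l)) \<longlonglongrightarrow> 1 / (1 + of_real 0 * l)"
            by (intro tendsto_divide tendsto_add tendsto_mult tendsto_const z) simp
          moreover have "1 / (1 + of_real ((1/2) ^ N) * l) = vf (2 ^ N) l" for N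
          proof -
            have "(2::complex) ^ N + l = 2 ^ N * (1 + of_real ((1/2) ^ N) * l)" by (simp add: algebra_simps power_one_over)
            then show ?thesis unfolding vf_def by simp
          qed
          ultimately show ?thesis by simp
        qed
        have v2: "(\<lambda>N. vf (1 / 2 ^ N) l) \<longlonglongrightarrow> 0"
        proof -
          have z: "(\<lambda>N. of_real (1 / 2 ^ N) :: complex) \<longlonglongrightarrow> of_real 0"
            using LIMSEQ_realpow_zero[of "1/2"] by (intro tendsto_of_real) (simp add: power_one_over)
          have "(\<lambda>N. vf (1 / 2 ^ N) l) \<longlonglongrightarrow> of_real 0 / (of_real 0 + l)"
            unfolding vf_def using l0 by (intro tendsto_divide tendsto_add tendsto_const z) simp
          then show ?thesis by simp
        qed
        have "(\<lambda>N. g N l) \<longlonglongrightarrow> smoothstep 1 - smoothstep 0"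
          unfolding g_def smoothstep_def using v1 v2 by (intro tendsto_intros)
        then have "(\<lambda>N. g N l) \<longlonglongrightarrow> 1" by (simp add: smoothstep_def)
        then have "(\<lambda>N. g N l * q (R l (H l x))) \<longlonglongrightarrow> 1 * q (R l (H l x))" by (intro tendsto_mult tendsto_const)
        then show "(\<lambda>N. q (R l (g N l \<odot> H l x))) \<longlonglongrightarrow> q (R l (H l x))"
          by (simp add: clinear_apply_scale[OF R_clinear[OF l(2)]] cfun_scale[OF q(1)])
      qed
      then have "(\<lambda>N. 1 / (2 * pi * \<i>) * cbnd_int \<nu> (\<lambda>l. q (R l (g N l \<odot> H l x))))
        \<longlonglongrightarrow> 1 / (2 * pi * \<i>) * cbnd_int \<nu> (\<lambda>l. q (R l (H l x)))" by (intro tendsto_mult tendsto_const)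
      then show ?thesis unfolding F_def g_def[symmetric] ocalc_def cfun_scale[OF q(1)]
          cfun_bnd_int[OF q(1) tame2_R[OF nu gg]] cfun_bnd_int[OF q(1) tame2_R[OF nu decaying]] .
    qed
    show "cmod (q (ocalc \<nu> (\<lambda>l. H l x))) \<le> C * M * norm x"
      by (rule LIMSEQ_le_const2[OF tendsto_norm[OF lim]]) (use bound in blast)
  qed
  show ?thesis by (rule exI[of _ C]) (use C0 main in simp)
qed

end

section \<open>Analytic dependence of f(z,B) on the parameter\<close>

lemma uniformly_Lipschitz_parameter:
  assumes f: "\<And>m. m \<in> S \<Longrightarrow> (\<lambda>l. f l m) holomorphic_on U" and K: "\<And>l m. l \<in> U \<Longrightarrow> m \<in> S \<Longrightarrow> cmod (f l m) \<le> K"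
    and U: "open U" "l0 \<in> U"
  shows "\<exists>r>0. \<exists>L\<ge>0. ball l0 r \<subseteq> U \<and>
    (\<forall>l\<in>ball l0 r. \<forall>l'\<in>ball l0 r. \<forall>m\<in>S. cmod (f l m - f l' m) \<le> L * cmod (l - l'))"
proof -
  obtain e where e: "e > 0" "ball l0 e \<subseteq> U" using U openE by blast
  \<comment> \<open>A third of the radius leaves room for a disc of radius \<open>r\<close> around
    every point of the smaller ball; Cauchy's estimate on these discs gives the constant
    \<open>\<bar>K\<bar> / r\<close> for all \<open>m\<close> at once.\<close>
  define r where "r = e / 3"
  have r: "r > 0" unfolding r_def using e by simp
  have sub: "cball z r \<subseteq> U" if "z \<in> ball l0 r" for z
  proof
    fix y assume "y \<in> cball z r"
    then have "dist l0 y < e" using that dist_triangle[of l0 y z] e unfolding r_def by simp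
    then show "y \<in> U" using e by auto
  qed
  have "cmod (f l m - f l' m) \<le> (\<bar>K\<bar> / r) * cmod (l - l')"
    if l: "l \<in> ball l0 r" "l' \<in> ball l0 r" and m: "m \<in> S" for l l' m
  proof (rule field_differentiable_bound[of "ball l0 r" "\<lambda>l. f l m" "deriv (\<lambda>l. f l m)"])
    fix z assume z: "z \<in> ball l0 r"
    have zU: "z \<in> U" using sub[OF z] r by auto
    show "((\<lambda>l. f l m) has_field_derivative deriv (\<lambda>l. f l m) z) (at z within ball l0 r)"
      using holomorphic_derivI[OF f[OF m] U(1) zU] by (rule has_field_derivative_at_within)
    have "norm ((deriv ^^ 1) (\<lambda>l. f l m) z) \<le> fact 1 * \<bar>K\<bar> / r ^ 1"
    proof (rule Cauchy_inequality)
      show "(\<lambda>l. f l m) holomorphic_on ball z r"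
        by (rule holomorphic_on_subset[OF f[OF m]]) (use sub[OF z] in auto)
      show "continuous_on (cball z r) (\<lambda>l. f l m)"
        by (rule continuous_on_subset[OF holomorphic_on_imp_continuous_on[OF f[OF m]] sub[OF z]])
      show "norm (f y m) \<le> \<bar>K\<bar>" if "norm (z - y) = r" for y
      proof -
        have "y \<in> U" using sub[OF z] that by (auto simp: dist_norm subset_eq)
        then show ?thesis using K[OF _ m, of y] by linarith
      qed
    qed (rule r)
    then show "norm (deriv (\<lambda>l. f l m) z) \<le> \<bar>K\<bar> / r" by simp
  qed (use l in auto)
  moreover have "ball l0 r \<subseteq> U" using e unfolding r_def by auto
  ultimately show ?thesis using r by (intro exI[of _ r] exI[of _ "\<bar>K\<bar> / r"] conjI) auto
qed

context sectorial_op
begin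

text \<open>Differentiation under the contour integral. \<open>f\<close> is analytic in each
  variable separately; the Lipschitz constant in \<open>l\<close>, uniform over \<open>m\<close>,
  dominates the difference quotients, and the decay comes from \<open>phi n\<close>. The result
  makes an operator-valued function of \<open>l\<close> a legitimate symbol for a second
  operator.\<close>

lemma ocalc_parameter:
  fixes f :: "complex \<Rightarrow> complex \<Rightarrow> complex"
  assumes nu: "om < \<nu>" "\<nu> < s" "s < pi" and U: "open U"
    and f1: "\<And>m. m \<in> sector s \<Longrightarrow> (\<lambda>l. f l m) holomorphic_on U"
    and f2: "\<And>l. l \<in> U \<Longrightarrow> f l holomorphic_on sector s"
    and K: "\<And>l m. l \<in> U \<Longrightarrow> m \<in> sector s \<Longrightarrow> cmod (f l m) \<le> K"
    and n: "n \<ge> 1"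
  defines "F \<equiv> \<lambda>l x. ocalc \<nu> (\<lambda>m. (phi n m * f l m) \<odot> x)"
  shows "continuous_on U (\<lambda>l. F l x)" "cfun q \<Longrightarrow> (\<lambda>l. q (F l x)) holomorphic_on U"
proof -
  have s: "0 \<le> s" using nu om by simp
  have decaying: "decaying s (\<lambda>m. (phi n m * f l m) \<odot> x)" if "l \<in> U" for l x
    using f2[OF that] K[OF that] by (intro decaying_phi[OF s nu(3) n]) auto
  obtain C where C: "C \<ge> 0" "\<And>z. z \<in> sector s \<Longrightarrow> cmod (phi n z) \<le> C * cmod z / (1 + (cmod z)^2)"
    using phi_decay[OF s nu(3) n] by metis
  obtain M where M: "M \<ge> 0" "\<forall>h E. decaying s h \<longrightarrow> (\<forall>z\<in>sector s. norm (h z) \<le> E * cmod z / (1 + (cmod z)^2)) \<longrightarrow>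
    norm (ocalc \<nu> h) \<le> M * E"
    using norm_ocalc_le[OF nu] by (elim exE conjE)
  have diff: "F l x - F l' x = ocalc \<nu> (\<lambda>m. (phi n m * (f l m - f l' m)) \<odot> x)" if "l \<in> U" "l' \<in> U" for l l'
  proof -
    have "decaying s (\<lambda>m. (phi n m * (f l m - f l' m)) \<odot> x)"
    proof (rule decaying_phi[OF s nu(3) n])
      show "(\<lambda>m. f l m - f l' m) holomorphic_on sector s" using f2 that by (intro holomorphic_on_diff) auto
      show "cmod (f l z - f l' z) \<le> 2 * K" if z: "z \<in> sector s" for z
        using norm_triangle_ineq4[of "f l z" "f l' z"] K[OF \<open>l \<in> U\<close> z] K[OF \<open>l' \<in> U\<close> z] by linarith
    qed
    from ocalc_add[OF nu this decaying[OF that(2), of x]]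
    have "ocalc \<nu> (\<lambda>m. (phi n m * (f l m - f l' m)) \<odot> x + (phi n m * f l' m) \<odot> x)
      = ocalc \<nu> (\<lambda>m. (phi n m * (f l m - f l' m)) \<odot> x) + F l' x" unfolding F_def .
    moreover have "(phi n m * (f l m - f l' m)) \<odot> x + (phi n m * f l' m) \<odot> x = (phi n m * f l m) \<odot> x" for m
      unfolding scale_add_left[symmetric] by (simp add: algebra_simps)
    ultimately show ?thesis unfolding F_def by simp
  qed
  have lip: "\<exists>r>0. \<exists>L\<ge>0. ball l0 r \<subseteq> U \<and> (\<forall>l\<in>ball l0 r. \<forall>l'\<in>ball l0 r. \<forall>m\<in>sector s. cmod (f l m - f l' m) \<le> L * cmod (l - l'))"
    if l0: "l0 \<in> U" for l0
    by (rule uniformly_Lipschitz_parameter[where K = K]) (use f1 K U l0 in auto)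
  show "continuous_on U (\<lambda>l. F l x)"
  proof (rule continuous_at_imp_continuous_on, rule ballI)
    fix l0 assume l0: "l0 \<in> U"
    obtain r L where r: "r > 0" "L \<ge> 0" "ball l0 r \<subseteq> U"
      "\<forall>l\<in>ball l0 r. \<forall>l'\<in>ball l0 r. \<forall>m\<in>sector s. cmod (f l m - f l' m) \<le> L * cmod (l - l')"
      using lip[OF l0] by metis
    have bd: "norm (F l x - F l0 x) \<le> M * (C * L * cmod (l - l0) * norm x)" if l: "l \<in> ball l0 r" for l
    proof -
      have lU: "l \<in> U" using l r by blast
      have g: "decaying s (\<lambda>m. (phi n m * (f l m - f l0 m)) \<odot> x)"
      proof (rule decaying_phi[OF s nu(3) n])
        show "(\<lambda>m. f l m - f l0 m) holomorphic_on sector s" using f2 lU l0 by (intro holomorphic_on_diff) auto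
        show "cmod (f l z - f l0 z) \<le> L * cmod (l - l0)" if z: "z \<in> sector s" for z
          using r(4) l z r(1) by auto
      qed
      show ?thesis unfolding diff[OF lU l0]
      proof (rule M(2)[rule_format, OF g])
        fix z assume z: "z \<in> sector s"
        have "cmod (f l z - f l0 z) \<le> L * cmod (l - l0)" using r(4) l z r(1) by auto
        then have "norm ((phi n z * (f l z - f l0 z)) \<odot> x) \<le> (C * cmod z / (1 + (cmod z)^2)) * (L * cmod (l - l0)) * norm x"
          unfolding norm_scale norm_mult using C(2)[OF z] C(1) r(2) by (intro mult_right_mono mult_mono) auto
        then show "norm ((phi n z * (f l z - f l0 z)) \<odot> x) \<le> C * L * cmod (l - l0) * norm x * cmod z / (1 + (cmod z)^2)"
          by (simp add: mult_ac)
      qed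
    qed
    have "((\<lambda>l. F l x - F l0 x) \<longlongrightarrow> 0) (at l0)"
    proof (rule Lim_null_comparison)
      show "\<forall>\<^sub>F l in at l0. norm (F l x - F l0 x) \<le> M * (C * L * cmod (l - l0) * norm x)"
        unfolding eventually_at using bd r(1) by (intro exI[of _ r]) (auto simp: dist_commute)
      have "((\<lambda>l. M * (C * L * cmod (l - l0) * norm x)) \<longlongrightarrow> M * (C * L * cmod (l0 - l0) * norm x)) (at l0)"
        by (intro tendsto_intros)
      then show "((\<lambda>l. M * (C * L * cmod (l - l0) * norm x)) \<longlongrightarrow> 0) (at l0)" by simp
    qed
    then show "isCont (\<lambda>l. F l x) l0" unfolding continuous_at by (rule LIM_zero_cancel)
  qed
  assume q: "cfun q"
  have nupi: "\<nu> < pi" using nu by simp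
  obtain M1 where M1: "M1 \<ge> 0" "\<And>l x. l \<noteq> 0 \<Longrightarrow> Re l \<le> cos \<nu> * cmod l \<Longrightarrow> norm (R l x) \<le> M1 * norm x / cmod l"
    using R_bound[OF nu(1) nupi] by metis
  obtain Kq where Kq: "Kq \<ge> 0" "\<And>x. cmod (q x) \<le> Kq * norm x" using cfun_bound[OF q] by metis
  have "\<exists>d. ((\<lambda>l. q (F l x)) has_field_derivative d) (at l0)" if l0: "l0 \<in> U" for l0
  proof -
    obtain r L where r: "r > 0" "L \<ge> 0" "ball l0 r \<subseteq> U"
      "\<forall>l\<in>ball l0 r. \<forall>l'\<in>ball l0 r. \<forall>m\<in>sector s. cmod (f l m - f l' m) \<le> L * cmod (l - l')"
      using lip[OF l0] by metis
    define d where "d = 1 / (2 * pi * \<i>) * cbnd_int \<nu> (\<lambda>m. phi n m * deriv (\<lambda>l. f l m) l0 * q (R m x))"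
    have "((\<lambda>l. (q (F l x) - q (F l0 x)) / (l - l0)) \<longlongrightarrow> d) (at l0 within ball l0 r)"
      \<comment> \<open>Dominated convergence is sequential, so the derivative is tested along
        sequences.\<close>
      unfolding tendsto_at_iff_sequentially
    proof (intro allI impI)
      fix X :: "nat \<Rightarrow> complex" assume X: "\<forall>i. X i \<in> ball l0 r - {l0}" "X \<longlonglongrightarrow> l0"
      have XU: "X i \<in> U" and Xn: "X i \<noteq> l0" for i using X r by auto
      define h where "h i m = (phi n m * ((f (X i) m - f l0 m) / (X i - l0))) \<odot> x" for i m
      have dq: "cmod ((f (X i) m - f l0 m) / (X i - l0)) \<le> L" if m: "m \<in> sector s" for i m
      proof -
        have "cmod (f (X i) m - f l0 m) \<le> L * cmod (X i - l0)" using r(4) r(1) X m by auto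
        then show ?thesis using Xn[of i] by (simp add: norm_divide divide_le_eq)
      qed
      have gh: "decaying s (h i)" for i
        unfolding h_def
      proof (rule decaying_phi[OF s nu(3) n _ dq])
        show "(\<lambda>m. (f (X i) m - f l0 m) / (X i - l0)) holomorphic_on sector s"
          using f2 XU l0 Xn[of i] by (intro holomorphic_on_divide holomorphic_on_diff holomorphic_on_const) auto
      qed
      have eq: "(q (F (X i) x) - q (F l0 x)) / (X i - l0) = 1 / (2 * pi * \<i>) * cbnd_int \<nu> (\<lambda>m. q (R m (h i m)))" for i
      proof -
        have g: "decaying s (\<lambda>m. (phi n m * (f (X i) m - f l0 m)) \<odot> x)"
        proof (rule decaying_phi[OF s nu(3) n])
          show "(\<lambda>m. f (X i) m - f l0 m) holomorphic_on sector s" using f2 XU l0 by (intro holomorphic_on_diff) auto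
          show "cmod (f (X i) z - f l0 z) \<le> 2 * K" if z: "z \<in> sector s" for z
            using norm_triangle_ineq4[of "f (X i) z" "f l0 z"] K[OF XU z, of i] K[OF l0 z] by linarith
        qed
        have "(q (F (X i) x) - q (F l0 x)) / (X i - l0) = q ((1 / (X i - l0)) \<odot> (F (X i) x - F l0 x))"
          unfolding cfun_scale[OF q] cfun_diff[OF q] by simp
        also have "(1 / (X i - l0)) \<odot> (F (X i) x - F l0 x) = ocalc \<nu> (h i)"
          unfolding diff[OF XU l0] ocalc_scale[OF nu g] h_def by (simp add: scale_scale mult_ac)
        also have "q (ocalc \<nu> (h i)) = 1 / (2 * pi * \<i>) * cbnd_int \<nu> (\<lambda>m. q (R m (h i m)))"
          unfolding ocalc_def cfun_scale[OF q] cfun_bnd_int[OF q tame2_R[OF nu gh]] ..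
        finally show ?thesis .
      qed
      have "(\<lambda>i. cbnd_int \<nu> (\<lambda>m. q (R m (h i m)))) \<longlonglongrightarrow> cbnd_int \<nu> (\<lambda>m. phi n m * deriv (\<lambda>l. f l m) l0 * q (R m x))"
      proof (rule cbnd_int_dominated[where C = "Kq * (M1 * (C * L * norm x))"])
        show "tame2 \<nu> (\<lambda>m. q (R m (h i m)))" for i
          by (rule tame2_bounded_linear[OF tame2_R[OF nu gh] cfun_bounded_linear[OF q]])
        fix t \<theta> :: real assume t: "t > 0" and th: "\<theta> = \<nu> \<or> \<theta> = - \<nu>"
        define m where "m = ray t \<theta>"
        have m: "m \<in> sector s" "m \<in> outer om" "Re m \<le> cos \<nu> * cmod m"
          unfolding m_def using th rays[OF nu t] ray_outer(3,4)[OF nu(1) nupi t] by auto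
        have ct: "cmod m = t" unfolding m_def using t by (simp add: norm_mult)
        have m0: "m \<noteq> 0" using ct t by auto
        have "cmod (q (R m (h i m))) \<le> Kq * (M1 * (C * L * norm x)) / (1 + t^2)" for i
        proof -
          have "cmod (q (R m (h i m))) \<le> Kq * norm (R m (h i m))" by (rule Kq(2))
          also have "\<dots> \<le> Kq * (M1 * norm (h i m) / t)" using M1(2)[OF m0 m(3)] Kq(1) unfolding ct by (intro mult_left_mono)
          also have "\<dots> \<le> Kq * (M1 * ((C * t / (1 + t^2)) * L * norm x) / t)"
          proof (intro mult_left_mono divide_right_mono)
            show "norm (h i m) \<le> (C * t / (1 + t^2)) * L * norm x"
              unfolding h_def norm_scale norm_mult using dq[OF m(1), of i] C(2)[OF m(1)] C(1) t unfolding ct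
              by (intro mult_right_mono mult_mono) auto
          qed (use t M1(1) Kq(1) in auto)
          also have "\<dots> = Kq * (M1 * (C * L * norm x)) / (1 + t^2)" using t by simp
          finally show ?thesis .
        qed
        then show "cmod (q (R (ray t \<theta>) (h i (ray t \<theta>)))) \<le> Kq * (M1 * (C * L * norm x)) / (1 + t^2)" for i
          unfolding m_def .
        have "((\<lambda>l. f l m) has_field_derivative deriv (\<lambda>l. f l m) l0) (at l0)"
          by (rule holomorphic_derivI[OF f1[OF m(1)] U l0])
        then have "((\<lambda>l. (f l m - f l0 m) / (l - l0)) \<longlongrightarrow> deriv (\<lambda>l. f l m) l0) (at l0)"
          unfolding has_field_derivative_iff .
        then have "(\<lambda>i. (f (X i) m - f l0 m) / (X i - l0)) \<longlonglongrightarrow> deriv (\<lambda>l. f l m) l0"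
          by (rule filterlim_compose) (use X Xn in \<open>auto simp: filterlim_at\<close>)
        then have "(\<lambda>i. phi n m * ((f (X i) m - f l0 m) / (X i - l0)) * q (R m x)) \<longlonglongrightarrow> phi n m * deriv (\<lambda>l. f l m) l0 * q (R m x)"
          by (intro tendsto_mult tendsto_const)
        then have "(\<lambda>i. q (R m (h i m))) \<longlonglongrightarrow> phi n m * deriv (\<lambda>l. f l m) l0 * q (R m x)"
          unfolding h_def clinear_apply_scale[OF R_clinear[OF m(2)]] cfun_scale[OF q] .
        then show "(\<lambda>i. q (R (ray t \<theta>) (h i (ray t \<theta>)))) \<longlonglongrightarrow>
           phi n (ray t \<theta>) * deriv (\<lambda>l. f l (ray t \<theta>)) l0 * q (R (ray t \<theta>) x)"
          unfolding m_def .
      qed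
      then have "(\<lambda>i. (q (F (X i) x) - q (F l0 x)) / (X i - l0)) \<longlonglongrightarrow> d"
        unfolding eq d_def by (intro tendsto_mult tendsto_const)
      then show "((\<lambda>l. (q (F l x) - q (F l0 x)) / (l - l0)) \<circ> X) \<longlonglongrightarrow> d" by (simp add: o_def)
    qed
    then have "((\<lambda>l. q (F l x)) has_field_derivative d) (at l0 within ball l0 r)"
      unfolding has_field_derivative_iff .
    then show ?thesis using at_within_open[of l0 "ball l0 r"] r(1) by auto
  qed
  then show "(\<lambda>l. q (F l x)) holomorphic_on U" using holomorphic_on_open[OF U] by blast
qed

lemma fcalc_clinear:
  assumes nu: "om < s" and g: "g holomorphic_on sector s" "\<And>z. z \<in> sector s \<Longrightarrow> cmod (g z) \<le> K" and n: "n \<ge> 1"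
    and bd: "\<And>x. norm (fcalc J D A s (\<lambda>z. phi n z * g z) x) \<le> M * norm x"
  shows "clinear (fcalc J D A s (\<lambda>z. phi n z * g z))"
    and "clinear S \<Longrightarrow> (\<And>l x. l \<in> outer om \<Longrightarrow> S (R l x) = R l (S x)) \<Longrightarrow>
      S (fcalc J D A s (\<lambda>z. phi n z * g z) x) = fcalc J D A s (\<lambda>z. phi n z * g z) (S x)"
proof -
  define \<nu> where "\<nu> = nu_of J D A s"
  obtain s1 where nu: "om < \<nu>" "\<nu> < s1" "s1 < pi" and s1: "s1 < s" "0 \<le> s1"
    using nu_of_bounds[OF nu] unfolding \<nu>_def by metis
  have sub: "sector s1 \<subseteq> sector s" using sector_mono s1 by simp
  define F where "F x = fcalc J D A s (\<lambda>z. phi n z * g z) x" for x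
  have F: "F x = ocalc \<nu> (\<lambda>l. (phi n l * g l) \<odot> x)" for x
    unfolding F_def \<nu>_def by (rule fcalc_eq_ocalc[OF assms(1)])
  have decaying: "decaying s1 (\<lambda>z. (phi n z * g z) \<odot> x)" for x
    using g sub by (intro decaying_phi[OF s1(2) nu(3) n holomorphic_on_subset[OF g(1) sub]]) auto
  have add: "F (x + y) = F x + F y" for x y
    unfolding F scale_add_right by (rule ocalc_add[OF nu decaying decaying])
  have sc: "F (c \<odot> x) = c \<odot> F x" for c x
    unfolding F ocalc_scale[OF nu decaying] by (simp add: scale_scale mult.commute)
  have "bounded_linear F"
  proof (rule bounded_linear_intro)
    show "F (r *\<^sub>R x) = r *\<^sub>R F x" for r x using sc[of "of_real r" x] unfolding scale_of_real .
    show "norm (F x) \<le> norm x * M" for x using bd[of x] unfolding F_def by (simp add: mult.commute)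
  qed (rule add)
  then show "clinear (fcalc J D A s (\<lambda>z. phi n z * g z))"
    unfolding F_def[abs_def, symmetric] clinear_def using sc by simp
  assume S: "clinear S" "\<And>l x. l \<in> outer om \<Longrightarrow> S (R l x) = R l (S x)"
  have "S (F x) = ocalc \<nu> (\<lambda>l. S ((phi n l * g l) \<odot> x))" unfolding F by (rule ocalc_commute[OF nu decaying S])
  then show "S (fcalc J D A s (\<lambda>z. phi n z * g z) x) = fcalc J D A s (\<lambda>z. phi n z * g z) (S x)"
    unfolding F_def[symmetric] F clinear_apply_scale[OF S(1)] .
qed

end

section \<open>Bounded analytic functions for angles above pi\<close>

lemma bounded_holomorphic_punctured_plane_const:
  assumes "g holomorphic_on - {0}" "\<And>z. z \<noteq> 0 \<Longrightarrow> cmod (g z) \<le> K" "z \<noteq> 0"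
  shows "g z = g 1"
proof -
  have "exp ` UNIV \<subseteq> - {0::complex}" by auto
  \<comment> \<open>Composition with \<open>exp\<close>, which maps the plane onto the punctured
    plane, gives a bounded entire function without any analysis of the singularity at 0.\<close>
  then have "(\<lambda>w. g (exp w)) holomorphic_on UNIV"
    using holomorphic_on_compose_gen[OF holomorphic_on_exp assms(1), of UNIV] by (simp add: o_def)
  moreover have "bounded (range (\<lambda>w. g (exp w)))" using assms(2) by (intro boundedI[of _ K]) auto
  ultimately have "(\<lambda>w. g (exp w)) constant_on UNIV" by (rule Liouville_theorem)
  then have "g (exp (Ln z)) = g (exp 0)" unfolding constant_on_def by (metis UNIV_I)
  then show ?thesis using assms(3) by simp
qed

lemma sector_beyond_pi:
  assumes "pi < s"
  shows "sector s = - {0}"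
proof -
  have "\<bar>Arg z\<bar> < s" for z using Arg_bounded[of z] assms by auto
  then show ?thesis unfolding sector_def by auto
qed

lemma open_sector: "open (sector s)" if "0 \<le> s"
proof (cases "s \<le> pi")
  case True
  then show ?thesis using sector_eq_cone[OF that] open_cone by simp
next
  case False
  then have "sector s = - {0}" by (intro sector_beyond_pi) simp
  then show ?thesis using open_Compl[OF closed_singleton[of "0::complex"]] by simp
qed

theorem theorem7p4:
  fixes J :: "'a::banach \<Rightarrow> 'a"
    and DA DB :: "'a set" and A B :: "'a \<Rightarrow> 'a"
    and f :: "complex \<Rightarrow> complex \<Rightarrow> complex"
    and \<sigma> \<sigma>' :: real
  assumes "cstruct J"
    and "(GT_space (UNIV :: 'a set) (cscale J) \<and> cotype2 (UNIV :: 'a set))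
         \<or> (GT_space (dualsp J) dual_sm \<and> cotype2 (dualsp J))"
    and "sectorial J DA A" and "sectorial J DB B"
    and "commuting J DA A DB B"
    and "admits_Hinf J DA A"
    and "\<sigma> > omegaH J DA A" and "\<sigma>' > omega J DB B"
    and "Hinf2 \<sigma> \<sigma>' f"
    and "\<forall>z\<in>sector \<sigma>. in_H J DB B \<sigma>' (f z)"
    and "\<exists>M. \<forall>z\<in>sector \<sigma>. \<forall>x. norm (fcalc_lim J DB B \<sigma>' (f z) x) \<le> M * norm x"
  shows "in_H2 J DA A DB B \<sigma> \<sigma>' f"
proof -
  interpret A: sectorial_op J DA A
    by unfold_locales (use assms in auto)
  interpret B: sectorial_op J DB B
    by unfold_locales (use assms in auto)
  have Hne: "{s. Hinf_calc J DA A s} \<noteq> {}" using assms(6) unfolding admits_Hinf_def by auto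
  have Hom: "A.om < s" if "Hinf_calc J DA A s" for s using that unfolding Hinf_calc_def by blast
  have "A.om \<le> omegaH J DA A" unfolding omegaH_def using Hne Hom by (intro cInf_greatest) (auto intro: less_imp_le)
  then have sig: "A.om < \<sigma>" using assms(7) by linarith
  \<comment> \<open>The calculus of \<open>A\<close> is available at some angle below
    \<open>\<sigma>\<close>, whose contour may differ from the one in f(A,B); only the bound for the
    family \<open>W\<close> is taken over from it.\<close>
  obtain s0 where s0: "Hinf_calc J DA A s0" "s0 < \<sigma>"
    using cInf_lessD[OF Hne] assms(7) unfolding omegaH_def by blast
  have sig': "B.om < \<sigma>'" by (rule assms(8))
  obtain K where K: "\<And>l m. l \<in> sector \<sigma> \<Longrightarrow> m \<in> sector \<sigma>' \<Longrightarrow> cmod (f l m) \<le> K"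
    using assms(9) unfolding Hinf2_def bounded_iff by auto
  have f1: "(\<lambda>l. f l m) holomorphic_on sector \<sigma>" if "m \<in> sector \<sigma>'" for m
    using assms(9) that unfolding Hinf2_def by blast
  have f2: "f l holomorphic_on sector \<sigma>'" if "l \<in> sector \<sigma>" for l
    using assms(9) that unfolding Hinf2_def by blast
  obtain MB where MB: "\<And>l x. l \<in> sector \<sigma> \<Longrightarrow> norm (fcalc_lim J DB B \<sigma>' (f l) x) \<le> MB * norm x"
    using assms(11) by metis
  obtain MP where MP: "MP \<ge> 0" "\<forall>n\<ge>1. \<forall>x. norm (B.Phi n x) \<le> MP * norm x"
    using B.Phi_bound by (elim exE conjE)
  define F where "F n l x = fcalc J DB B \<sigma>' (\<lambda>z. phi n z * f l z) x" for n l x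
  define MF where "MF = MP * \<bar>MB\<bar>"
  have MF0: "MF \<ge> 0" unfolding MF_def using MP by simp
  \<comment> \<open>The bound in \<open>in_H\<close> may vary with \<open>l\<close>; factoring
    through \<open>fcalc_lim\<close> replaces it by \<open>MP\<close> times the bound that the
    hypothesis gives uniformly in \<open>l\<close>.\<close>
  have Fb: "norm (F n l x) \<le> MF * norm x" if l: "l \<in> sector \<sigma>" and n: "n \<ge> 1" for n l x
  proof -
    have "F n l x = B.Phi n (fcalc_lim J DB B \<sigma>' (f l) x)"
      unfolding F_def using assms(10) l by (intro B.fcalc_lim_factor[OF sig' f2[OF l] K[OF l] _ n]) auto
    then have "norm (F n l x) \<le> MP * norm (fcalc_lim J DB B \<sigma>' (f l) x)" using MP(2) n by simp
    also have "\<dots> \<le> MP * (\<bar>MB\<bar> * norm x)"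
    proof (rule mult_left_mono[OF _ MP(1)])
      have "MB * norm x \<le> \<bar>MB\<bar> * norm x" by (intro mult_right_mono) auto
      then show "norm (fcalc_lim J DB B \<sigma>' (f l) x) \<le> \<bar>MB\<bar> * norm x" using MB[OF l, of x] by linarith
    qed
    finally show ?thesis unfolding MF_def by simp
  qed
  define \<nu> where "\<nu> = nu_of J DA A \<sigma>"
  \<comment> \<open>A sector between the contour and \<open>\<sigma>\<close>, with
    \<open>s < pi\<close> even if \<open>\<sigma>\<close> is larger; all estimates of symbols for
    \<open>A\<close> take place on it.\<close>
  obtain s where nu: "A.om < \<nu>" "\<nu> < s" "s < pi" and s: "s < \<sigma>" "0 \<le> s"
    using A.nu_of_bounds[OF sig] unfolding \<nu>_def by metis
  have sub: "sector s \<subseteq> sector \<sigma>" using sector_mono s by simp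
  define \<nu>' where "\<nu>' = nu_of J DB B \<sigma>'"
  obtain s' where nu': "B.om < \<nu>'" "\<nu>' < s'" "s' < pi" and s': "s' < \<sigma>'" "0 \<le> s'"
    using B.nu_of_bounds[OF sig'] unfolding \<nu>'_def by metis
  have sub': "sector s' \<subseteq> sector \<sigma>'" using sector_mono s' by simp
  have decayingB: "A.decaying s' (\<lambda>m. cscale J (phi n m * f l m) x)" if "l \<in> sector \<sigma>" "n \<ge> 1" for n l x
    using sub' K[OF that(1)]
    by (intro B.decaying_phi[OF s'(2) nu'(3) that(2) holomorphic_on_subset[OF f2[OF that(1)] sub']]) auto
  have Fo: "F n l x = B.ocalc \<nu>' (\<lambda>m. cscale J (phi n m * f l m) x)" for n l x
    unfolding F_def \<nu>'_def by (rule B.fcalc_eq_ocalc[OF sig'])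
  have opn: "open (sector \<sigma>)" using open_sector sig A.om by simp
  have par: "continuous_on (sector \<sigma>) (\<lambda>l. F n l x)"
    "A.cfun q \<Longrightarrow> (\<lambda>l. q (F n l x)) holomorphic_on sector \<sigma>" if n: "n \<ge> 1" for n x q
  proof -
    have f2': "f l holomorphic_on sector s'" if "l \<in> sector \<sigma>" for l
      by (rule holomorphic_on_subset[OF f2[OF that] sub'])
    note P = B.ocalc_parameter[OF nu' opn, where f = f and K = K and n = n and x = x, folded Fo]
    show "continuous_on (sector \<sigma>) (\<lambda>l. F n l x)" by (rule P(1)) (use f1 f2' K sub' n in auto)
    show "(\<lambda>l. q (F n l x)) holomorphic_on sector \<sigma>" if "A.cfun q" by (rule P(2)) (use f1 f2' K sub' n that in auto)
  qed
  have decayingA: "A.decaying s (\<lambda>l. cscale J (phi n l) (F n l x))" if n: "n \<ge> 1" for n x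
  proof -
    obtain C where C: "C \<ge> 0" "\<And>z. z \<in> sector s \<Longrightarrow> cmod (phi n z) \<le> C * cmod z / (1 + (cmod z)^2)"
      using A.phi_decay[OF s(2) nu(3) n] by metis
    note ph = A.phi_holomorphic[OF s(2) nu(3) n]
    show ?thesis
    proof (rule A.decayingI[of _ _ "C * (MF * norm x)"])
      show "continuous_on (sector s) (\<lambda>l. cscale J (phi n l) (F n l x))"
        by (intro A.continuous_on_scale holomorphic_on_imp_continuous_on[OF ph] continuous_on_subset[OF par(1)[OF n] sub])
      show "(\<lambda>l. q (cscale J (phi n l) (F n l x))) holomorphic_on sector s" if q: "A.cfun q" for q
        unfolding A.cfun_scale[OF q] by (intro holomorphic_on_mult ph holomorphic_on_subset[OF par(2)[OF n q] sub])
      fix z assume z: "z \<in> sector s"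
      have "norm (cscale J (phi n z) (F n z x)) \<le> (C * cmod z / (1 + (cmod z)^2)) * (MF * norm x)"
        unfolding A.norm_scale using C(2)[OF z] Fb[of z n x] z sub n C(1) by (intro mult_mono) auto
      then show "norm (cscale J (phi n z) (F n z x)) \<le> C * (MF * norm x) * cmod z / (1 + (cmod z)^2)" by (simp add: mult_ac)
    qed (use C(1) MF0 in simp)
  qed
  have RR: "A.R l (B.R m x) = B.R m (A.R l x)" if "l \<in> outer A.om" "m \<in> outer B.om" for l m x
    using assms(5) A.is_resolvent[OF that(1)] B.is_resolvent[OF that(2)] unfolding commuting_def by blast
  have fcalc2_eq: "fcalc2 J DA A DB B \<sigma> \<sigma>' (\<lambda>l m. phi n l * phi n m * f l m) x = A.ocalc \<nu> (\<lambda>l. cscale J (phi n l) (F n l x))"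
    if n: "n \<ge> 1" for n x
  proof -
    define c where "c = 1 / (2 * complex_of_real pi * \<i>)"
    have c: "(2 * complex_of_real pi * \<i>) * c = 1" unfolding c_def by simp
    \<comment> \<open>The resolvent of \<open>A\<close> is taken out of the inner integral, and what
      remains is \<open>2 * pi * \<i>\<close> times \<open>F n l x\<close>; one of the two factors
      \<open>1 / (2 * pi * \<i>)\<close> is thereby used up.\<close>
    have inner: "bnd_int J \<nu>' (\<lambda>m. cscale J (phi n l * phi n m * f l m) (A.R l (B.R m x)))
       = cscale J (2 * pi * \<i>) (A.R l (cscale J (phi n l) (F n l x)))"
      if l: "l \<in> sector \<sigma>" "l \<in> outer A.om" for l
    proof -
      have "tame2 \<nu>' (\<lambda>m. B.R m (cscale J (phi n m * f l m) x))"
        by (rule B.tame2_R[OF nu' decayingB[OF l(1) n]])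
      then have t: "tame2 \<nu>' (\<lambda>m. cscale J (phi n m * f l m) (B.R m x))"
        using tame2_cong[of "\<lambda>m. B.R m (cscale J (phi n m * f l m) x)" \<nu>' "\<lambda>m. cscale J (phi n m * f l m) (B.R m x)"]
          A.clinear_apply_scale[OF B.R_clinear] B.rays(1,2)[OF nu'] by simp
      define S where "S y = A.R l (cscale J (phi n l) y)" for y
      note Rl = A.R_clinear[OF l(2)]
      have S: "A.clinear S"
        unfolding A.clinear_def S_def[abs_def]
        using bounded_linear_compose[OF A.R_bounded_linear[OF l(2)] A.bounded_linear_scale]
        by (simp add: A.clinear_apply_scale[OF Rl] A.scale_scale mult.commute)
      have "F n l x = cscale J c (bnd_int J \<nu>' (\<lambda>m. cscale J (phi n m * f l m) (B.R m x)))"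
        unfolding F_def fcalc_def \<nu>'_def c_def by simp
      then have b: "bnd_int J \<nu>' (\<lambda>m. cscale J (phi n m * f l m) (B.R m x)) = cscale J (2 * pi * \<i>) (F n l x)"
        using c by (simp add: A.scale_scale)
      have "bnd_int J \<nu>' (\<lambda>m. cscale J (phi n l * phi n m * f l m) (A.R l (B.R m x)))
          = bnd_int J \<nu>' (\<lambda>m. S (cscale J (phi n m * f l m) (B.R m x)))"
        unfolding S_def by (simp add: A.clinear_apply_scale[OF Rl] A.scale_scale mult.assoc)
      also have "\<dots> = S (cscale J (2 * pi * \<i>) (F n l x))" unfolding A.clinear_bnd_int[OF S t, symmetric] b ..
      finally show ?thesis by (simp add: S_def A.clinear_apply_scale[OF Rl] A.scale_scale mult.commute)
    qed
    have "bnd_int J \<nu> (\<lambda>l. bnd_int J \<nu>' (\<lambda>m. cscale J (phi n l * phi n m * f l m) (A.R l (B.R m x))))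
       = bnd_int J \<nu> (\<lambda>l. cscale J (2 * pi * \<i>) (A.R l (cscale J (phi n l) (F n l x))))"
      using A.rays[OF nu] sub by (intro A.bnd_int_cong inner) auto
    also have "\<dots> = cscale J (2 * pi * \<i>) (bnd_int J \<nu> (\<lambda>l. A.R l (cscale J (phi n l) (F n l x))))"
      by (rule A.clinear_bnd_int[OF A.clinear_scale A.tame2_R[OF nu decayingA[OF n]], symmetric])
    finally have outer: "bnd_int J \<nu> (\<lambda>l. bnd_int J \<nu>' (\<lambda>m. cscale J (phi n l * phi n m * f l m) (A.R l (B.R m x))))
       = cscale J (2 * pi * \<i>) (bnd_int J \<nu> (\<lambda>l. A.R l (cscale J (phi n l) (F n l x))))" .
    have "(1 / (2 * complex_of_real pi * \<i>))^2 * (2 * complex_of_real pi * \<i>) = 1 / (2 * complex_of_real pi * \<i>)"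
      using c unfolding c_def by (simp add: power2_eq_square)
    then show ?thesis
      unfolding fcalc2_def A.ocalc_def \<nu>_def[symmetric] \<nu>'_def[symmetric] outer A.scale_scale by simp
  qed
  show ?thesis
  proof (cases "\<sigma> \<le> pi")
    case True
    define k where "k = angle_const s"
    have k: "k > 0" unfolding k_def by (rule angle_const_pos[OF s(2) nu(3)])
    \<comment> \<open>In this case the angle of the calculus is below pi, as
      \<open>Hinf_family\<close> requires.\<close>
    have s0pi: "s0 < pi" using s0 True by simp
    obtain C where C: "C \<ge> 0" "\<forall>H M x. M \<ge> 0 \<longrightarrow> (\<forall>x. A.decaying s (\<lambda>l. H l x)) \<longrightarrow> (\<forall>l\<in>sector s. A.clinear (H l)) \<longrightarrow>
     (\<forall>l\<in>sector s. \<forall>m\<in>outer A.om. \<forall>x. A.R m (H l x) = H l (A.R m x)) \<longrightarrow>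
     (\<forall>l\<in>sector s. \<forall>x. norm (H l x) \<le> M * norm x) \<longrightarrow>
     norm (A.ocalc \<nu> (\<lambda>l. H l x)) \<le> C * M * norm x"
      using A.ocalc_telescoping_bound[OF assms(2) s0(1) s0pi nu] by (elim exE conjE)
    have "norm (A.ocalc \<nu> (\<lambda>l. cscale J (phi n l) (F n l x))) \<le> C * (2 / k * MF) * norm x" if n: "n \<ge> 1" for n x
    proof (rule C(2)[rule_format, where H = "\<lambda>l x. cscale J (phi n l) (F n l x)"])
      show "0 \<le> 2 / k * MF" using k MF0 by simp
      show "A.decaying s (\<lambda>l. cscale J (phi n l) (F n l x))" for x by (rule decayingA[OF n])
      fix l assume l: "l \<in> sector s"
      then have ls: "l \<in> sector \<sigma>" using sub by blast
      have bd: "norm (fcalc J DB B \<sigma>' (\<lambda>z. phi n z * f l z) x) \<le> MF * norm x" for x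
        using Fb[OF ls n] unfolding F_def .
      have Fcl: "A.clinear (F n l)"
        unfolding F_def[abs_def] by (rule B.fcalc_clinear(1)[OF sig' f2[OF ls] _ n bd]) (rule K[OF ls])
      \<comment> \<open>Used for the resolvents of \<open>A\<close>, whose commutation with those of
        \<open>B\<close> is the hypothesis that the operators commute.\<close>
      have Fcomm: "S (F n l x) = F n l (S x)"
        if "A.clinear S" "\<And>m x. m \<in> outer B.om \<Longrightarrow> S (B.R m x) = B.R m (S x)" for S x
        unfolding F_def by (rule B.fcalc_clinear(2)[OF sig' f2[OF ls] _ n bd that(1)]) (use K[OF ls] that(2) in auto)
      have "bounded_linear (\<lambda>x. cscale J (phi n l) (F n l x))"
        by (rule bounded_linear_compose[OF A.bounded_linear_scale A.clinear_bounded_linear[OF Fcl]])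
      then show "A.clinear (\<lambda>x. cscale J (phi n l) (F n l x))"
        unfolding A.clinear_def by (simp add: A.clinear_apply_scale[OF Fcl] A.scale_scale mult.commute)
      show "A.R m (cscale J (phi n l) (F n l x)) = cscale J (phi n l) (F n l (A.R m x))" if m: "m \<in> outer A.om" for m x
        using Fcomm[of "A.R m" x, OF A.R_clinear[OF m] RR[OF m]] A.clinear_apply_scale[OF A.R_clinear[OF m]] by simp
      show "norm (cscale J (phi n l) (F n l x)) \<le> 2 / k * MF * norm x" for x
      proof -
        have n0: "real n > 0" "1 / real n > 0" using n by auto
        have "cmod (phi n l) \<le> 1 / k + 1 / k"
          unfolding phi_wfun[OF n] wfun_def
          using norm_triangle_ineq4 add_mono[OF vfun_bound[OF s(2) nu(3) l n0(1)] vfun_bound[OF s(2) nu(3) l n0(2)]]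
          unfolding k_def by (rule order_trans)
        then have "norm (cscale J (phi n l) (F n l x)) \<le> 2 / k * (MF * norm x)"
          unfolding A.norm_scale using Fb[OF ls n, of x] k by (intro mult_mono) auto
        then show ?thesis by simp
      qed
    qed
    then show ?thesis unfolding in_H2_def using fcalc2_eq by (intro exI[of _ "C * (2 / k * MF)"]) simp
  next
    case False
    then have sec: "sector \<sigma> = - {0}" by (intro sector_beyond_pi) simp
    have const: "f l m = f 1 m" if "l \<noteq> 0" "m \<in> sector \<sigma>'" for l m
      by (rule bounded_holomorphic_punctured_plane_const[of "\<lambda>l. f l m" K])
        (use f1[OF that(2)] K[OF _ that(2)] that(1) sec in auto)
    have Fc: "F n l x = F n 1 x" if "l \<noteq> 0" for n l x
      unfolding Fo using const[OF that] B.rays(3,4)[OF nu'] sub' by (intro B.ocalc_cong) (simp_all add: subset_iff)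
    obtain MA where MA: "MA \<ge> 0" "\<forall>n\<ge>1. \<forall>x. norm (A.Phi n x) \<le> MA * norm x"
      using A.Phi_bound by (elim exE conjE)
    have nupi: "\<nu> < pi" using nu by simp
    have "norm (A.ocalc \<nu> (\<lambda>l. cscale J (phi n l) (F n l x))) \<le> (MA * MF) * norm x" if n: "n \<ge> 1" for n x
    proof -
      have n0: "real n > 0" "1 / real n > 0" using n by auto
      \<comment> \<open>With \<open>F n l\<close> constant in \<open>l\<close> the outer symbol is
        the scalar \<open>phi n\<close> times a fixed vector, and its value is \<open>Phi n\<close>
        of that vector.\<close>
      have "A.ocalc \<nu> (\<lambda>l. cscale J (phi n l) (F n l x)) = A.ocalc \<nu> (\<lambda>l. cscale J (phi n l) (F n 1 x))"
      proof (intro A.ocalc_cong)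
        fix t :: real assume t: "t > 0"
        then have "ray t \<nu> \<noteq> 0" "ray t (- \<nu>) \<noteq> 0" by auto
        then show "cscale J (phi n (ray t \<nu>)) (F n (ray t \<nu>) x) = cscale J (phi n (ray t \<nu>)) (F n 1 x)"
          "cscale J (phi n (ray t (- \<nu>))) (F n (ray t (- \<nu>)) x) = cscale J (phi n (ray t (- \<nu>))) (F n 1 x)"
          using Fc by metis+
      qed
      also have "\<dots> = A.Phi n (F n 1 x)"
        unfolding A.Phi_def phi_wfun[OF n] by (rule A.ocalc_wfun[OF nu(1) nupi n0])
      finally have "norm (A.ocalc \<nu> (\<lambda>l. cscale J (phi n l) (F n l x))) \<le> MA * norm (F n 1 x)" using MA(2) n by simp
      also have "\<dots> \<le> MA * (MF * norm x)" using Fb[of 1 n x] sec n MA(1) by (intro mult_left_mono) auto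
      finally show ?thesis by simp
    qed
    then show ?thesis unfolding in_H2_def using fcalc2_eq by (intro exI[of _ "MA * MF"]) simp
  qed
qed

end
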